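(* Consider a kernel-based spatial random graph as in the context in dimension $d\ge1$, with $\alpha\in(1,\infty]$, $\sigma\ge0$ and $\tau\in(2,\infty]$. There is a constant $A>0$ such that for all $\rho>0$ and $n\ge1$, $$\mathbb{P}\big(|\mathcal{C}_n^{(1)}|<\rho n\big)\ \ge\ \exp\big(-(A/\rho)\cdot n^{\zeta_\star}(\log n)^{\mathfrak{m}_\star-1}\big).$$
   Context: Model. The vertex set $V$ is either $\mathbb{Z}^d$ or a unit-intensity homogeneous Poisson point process on $\mathbb{R}^d$. Each vertex $u$ at location $x_u$ has an i.i.d. mark $w_u\ge1$, with $\mathbb{P}(W\ge w)=w^{-(\tau-1)}$, $w\ge1$, if $\tau<\infty$, and $w_u\equiv1$ if $\tau=\infty$. Let $\beta>0$, $p\in(0,1]$. The kernel $\kappa$ is either $\kappa_\sigma(w_1,w_2)=(w_1\vee w_2)(w_1\wedge w_2)^\sigma$ with $\sigma\ge0$, or $\kappa_{\mathrm{sum}}(w_1,w_2)=(w_1^{1/d}+w_2^{1/d})^d$, in which case one sets $\sigma:=0$. Conditionally on all locations and marks, each pair $\{u,v\}$ is independently an edge with probability $p\,\varrho\big(\beta\kappa(w_u,w_v)/\|x_u-x_v\|^d\big)$, where $\varrho(s)=(1\wedge s)^\alpha$ if $\alpha<\infty$ and $\varrho(s)=\mathbf{1}\{s\ge1\}$ if $\alpha=\infty$. If $V=\mathbb{Z}^d$ it is assumed that $p\wedge\beta<1$. $\Lambda_n:=[-n^{1/d}/2,n^{1/d}/2]^d$; $\mathcal{G}_n$ is the subgraph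 induced by vertices located in $\Lambda_n$; $\mathcal{C}_n^{(1)}$ is its largest component. Exponents. $\zeta_{\mathrm{ll}}:=2-\alpha$; $\zeta_{\mathrm{hl}}:=(\tau-1)/\alpha-(\tau-2)$; $\zeta_{\mathrm{hh}}:=\frac{\sigma+2-\tau}{\sigma+1-(\tau-1)/\alpha}$ if $\tau\le\sigma+2$ and $\alpha<\infty$, and $\zeta_{\mathrm{hh}}:=\frac{\sigma+2-\tau}{\sigma+1}$ if $\tau>\sigma+2$ or $\alpha=\infty$; $\zeta_{\mathrm{short}}:=(d-1)/d$. If $\alpha=\infty$ or $\tau=\infty$ the corresponding limits are taken (so $\zeta_{\mathrm{ll}}=-\infty$ and $\zeta_{\mathrm{hl}}=-(\tau-2)$ if $\alpha=\infty$; $\zeta_{\mathrm{hl}}=\zeta_{\mathrm{hh}}=-\infty$ if $\tau=\infty$). $\zeta_\star:=\max(\zeta_{\mathrm{ll}},\zeta_{\mathrm{hl}},\zeta_{\mathrm{hh}},\zeta_{\mathrm{short}})$, and $\mathfrak{m}_\star$ is the number of these four exponents that are equal to $\zeta_\star$.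
   Formalization: The claim fails in corner cases, so it is proved with: ρn>1 if V=ℤ^d; n≥2 (instead of n≥1) if V is Poisson and 𝔪⋆≥2; and, for V=ℤ^d with κ_sum, also p∧(2^dβ)<1 (otherwise all nearest-neighbour edges are present). *)

theory Defs
  imports "HOL-Probability.Probability"
begin

datatype vertex_space = Integer_Lattice | Poisson_Process

datatype kernel = Kernel_sigma real | Kernel_sum

text \<open>The parameter \<open>\<sigma>\<close> of a kernel; by convention it is \<open>0\<close> for \<open>\<kappa>\<^sub>s\<^sub>u\<^sub>m\<close>.\<close>

fun kernel_param :: "kernel \<Rightarrow> real" where
  "kernel_param (Kernel_sigma \<sigma>) = \<sigma>"
| "kernel_param Kernel_sum = 0"

fun kernel_fun :: "nat \<Rightarrow> kernel \<Rightarrow> real \<Rightarrow> real \<Rightarrow> real" where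
  "kernel_fun d (Kernel_sigma \<sigma>) w1 w2 = max w1 w2 * (min w1 w2) powr \<sigma>"
| "kernel_fun d Kernel_sum w1 w2 = (w1 powr (1 / real d) + w2 powr (1 / real d)) ^ d"

definition profile :: "ereal \<Rightarrow> real \<Rightarrow> real" where
  "profile \<alpha> s =
     (if \<alpha> = \<infinity> then (if s \<ge> 1 then 1 else 0) else (min 1 s) powr real_of_ereal \<alpha>)"

definition integer_lattice :: "(real ^ 'd) set" where
  "integer_lattice = {x. \<forall>i. x $ i \<in> \<int>}"

text \<open>The box \<open>\<Lambda>\<^sub>n\<close>, of volume \<open>n\<close>.\<close>

definition volume_box :: "real \<Rightarrow> (real ^ 'd::finite) set" where
  "volume_box n = {x. \<forall>i. \<bar>x $ i\<bar> \<le> n powr (1 / real CARD('d)) / 2}"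

text \<open>A (simple) homogeneous Poisson point process of unit intensity, as a random locally finite set.
  The Poisson weights are written out because \<open>poisson_pmf\<close> excludes the rate \<open>0\<close>; for a null set
  \<open>B\<close> the formula below gives the point mass at \<open>0\<close>, since \<open>0 ^ 0 = 1\<close>.\<close>

definition (in prob_space) unit_poisson_process :: "('a \<Rightarrow> (real ^ 'd::finite) set) \<Rightarrow> bool" where
  "unit_poisson_process V \<longleftrightarrow>
     (\<forall>\<omega>\<in>space M. \<forall>B. bounded B \<longrightarrow> finite (V \<omega> \<inter> B)) \<and>
     (\<forall>B\<in>sets borel. bounded B \<longrightarrow>
        random_variable (count_space UNIV) (\<lambda>\<omega>. card (V \<omega> \<inter> B)) \<and>
        (\<forall>k. prob {\<omega> \<in> space M. card (V \<omega> \<inter> B) = k} =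
              measure lborel B ^ k / fact k * exp (- measure lborel B))) \<and>
     (\<forall>S. finite S \<and> disjoint S \<and> (\<forall>B\<in>S. B \<in> sets borel \<and> bounded B) \<longrightarrow>
        indep_vars (\<lambda>_. count_space UNIV) (\<lambda>B \<omega>. card (V \<omega> \<inter> B)) S)"

text \<open>Graphs have vertices in \<open>nat\<close> and an edge set of two-element sets. The connected components
  of the subgraph induced by the vertex set \<open>S\<close>:\<close>

definition components_within :: "nat set set \<Rightarrow> nat set \<Rightarrow> nat set set" where
  "components_within E S =
     S // {(u, v). u \<in> S \<and> (u, v) \<in> {(x, y). x \<in> S \<and> y \<in> S \<and> {x, y} \<in> E}\<^sup>*}"

text \<open>The size of a largest component for finite \<open>S\<close>; it is \<open>0\<close> if there are no vertices.\<close>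

definition largest_component_size :: "nat set set \<Rightarrow> nat set \<Rightarrow> nat" where
  "largest_component_size E S = Max (insert 0 (card ` components_within E S))"

text \<open>Vertices are indices \<open>i :: nat\<close>. Vertex \<open>i\<close> has location \<open>X i \<omega>\<close> and mark \<open>W i \<omega>\<close>; the
  locations enumerate the random set \<open>V \<omega>\<close> without repetition. \<open>E \<omega>\<close> is the set of edges. The
  exponents \<open>\<alpha>\<close> and \<open>\<tau>\<close> may be infinite.\<close>

locale kernel_spatial_random_graph = prob_space M
  for M :: "'a measure"
    and vs :: vertex_space and K :: kernel and \<alpha> \<tau> :: ereal and \<beta> p :: real
    and V :: "'a \<Rightarrow> (real ^ 'd::finite) set"
    and X :: "nat \<Rightarrow> 'a \<Rightarrow> real ^ 'd"
    and W :: "nat \<Rightarrow> 'a \<Rightarrow> real"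
    and E :: "'a \<Rightarrow> nat set set" +
  assumes beta_pos: "\<beta> > 0"
    and p_pos: "p > 0" and p_le_1: "p \<le> 1"
    and lattice_nontrivial: "vs = Integer_Lattice \<Longrightarrow> min p \<beta> < 1"
    and vertices_lattice:
      "vs = Integer_Lattice \<Longrightarrow> \<omega> \<in> space M \<Longrightarrow> V \<omega> = integer_lattice"
    and vertices_poisson: "vs = Poisson_Process \<Longrightarrow> unit_poisson_process V"
    and enumeration: "\<omega> \<in> space M \<Longrightarrow> bij_betw (\<lambda>i. X i \<omega>) UNIV (V \<omega>)"
    and location_measurable: "\<And>i. random_variable borel (X i)"
    and marks_indep: "indep_vars (\<lambda>_. borel) W UNIV"
    and marks_pareto: "\<And>i w. \<tau> \<noteq> \<infinity> \<Longrightarrow> w \<ge> 1 \<Longrightarrow>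
      prob {\<omega> \<in> space M. W i \<omega> \<ge> w} = w powr (- (real_of_ereal \<tau> - 1))"
    and marks_one: "\<And>i. \<tau> = \<infinity> \<Longrightarrow> AE \<omega> in M. W i \<omega> = 1"
    and marks_locations_indep:
      "indep_set
         (sets (vimage_algebra (space M) (\<lambda>\<omega> i. X i \<omega>) (Pi\<^sub>M UNIV (\<lambda>_. borel))))
         (sets (vimage_algebra (space M) (\<lambda>\<omega> i. W i \<omega>) (Pi\<^sub>M UNIV (\<lambda>_. borel))))"
    and edges_pairs: "\<omega> \<in> space M \<Longrightarrow> E \<omega> \<subseteq> {{i, j} | i j. i \<noteq> j}"
    and edge_measurable: "\<And>i j. {\<omega> \<in> space M. {i, j} \<in> E \<omega>} \<in> events"
    \<comment> \<open>Conditionally on the sigma-algebra generated by all locations and marks, the edges are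
      independent with the given probabilities; each unordered pair is listed once, as \<open>i < j\<close>.\<close>
    and edges_cond_indep: "\<And>F. finite F \<Longrightarrow> F \<subseteq> {(i, j). i < j} \<Longrightarrow>
      AE \<omega> in M.
        real_cond_exp M
          (vimage_algebra (space M) (\<lambda>\<omega> i. (X i \<omega>, W i \<omega>)) (Pi\<^sub>M UNIV (\<lambda>_. borel)))
          (indicator {\<omega> \<in> space M. \<forall>(i, j)\<in>F. {i, j} \<in> E \<omega>}) \<omega>
        = (\<Prod>(i, j)\<in>F. p * profile \<alpha>
            (\<beta> * kernel_fun CARD('d) K (W i \<omega>) (W j \<omega>) / norm (X i \<omega> - X j \<omega>) ^ CARD('d)))"

text \<open>The exponents are extended reals. The values for infinite \<open>\<tau>\<close> are listed separately where
  \<open>ereal\<close> arithmetic would not return the limit (\<open>\<infinity> - \<infinity> = \<infinity>\<close> there).\<close>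

definition zeta_ll :: "ereal \<Rightarrow> ereal" where
  "zeta_ll \<alpha> = 2 - \<alpha>"

definition zeta_hl :: "ereal \<Rightarrow> ereal \<Rightarrow> ereal" where
  "zeta_hl \<alpha> \<tau> =
     (if \<tau> = \<infinity> then - \<infinity>
      else if \<alpha> = \<infinity> then - (\<tau> - 2)
      else (\<tau> - 1) / \<alpha> - (\<tau> - 2))"

definition zeta_hh :: "ereal \<Rightarrow> ereal \<Rightarrow> real \<Rightarrow> ereal" where
  "zeta_hh \<alpha> \<tau> \<sigma> =
     (if \<tau> = \<infinity> then - \<infinity>
      else if \<tau> \<le> ereal (\<sigma> + 2) \<and> \<alpha> < \<infinity>
        then (ereal (\<sigma> + 2) - \<tau>) / (ereal (\<sigma> + 1) - (\<tau> - 1) / \<alpha>)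
      else (ereal (\<sigma> + 2) - \<tau>) / ereal (\<sigma> + 1))"

definition zeta_short :: "nat \<Rightarrow> ereal" where
  "zeta_short d = ereal ((real d - 1) / real d)"

definition zeta_list :: "nat \<Rightarrow> ereal \<Rightarrow> ereal \<Rightarrow> real \<Rightarrow> ereal list" where
  "zeta_list d \<alpha> \<tau> \<sigma> = [zeta_ll \<alpha>, zeta_hl \<alpha> \<tau>, zeta_hh \<alpha> \<tau> \<sigma>, zeta_short d]"

definition zeta_star :: "nat \<Rightarrow> ereal \<Rightarrow> ereal \<Rightarrow> real \<Rightarrow> ereal" where
  "zeta_star d \<alpha> \<tau> \<sigma> = Max (set (zeta_list d \<alpha> \<tau> \<sigma>))"

definition mult_star :: "nat \<Rightarrow> ereal \<Rightarrow> ereal \<Rightarrow> real \<Rightarrow> nat" where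
  "mult_star d \<alpha> \<tau> \<sigma> = count_list (zeta_list d \<alpha> \<tau> \<sigma>) (zeta_star d \<alpha> \<tau> \<sigma>)"

end

theory Submission
  imports Defs "HOL-Library.Discrete_Functions" "HOL-Real_Asymp.Real_Asymp"
begin

text \<open>
  Cut space into about \<open>1 / \<rho>\<close> cells of volume of order \<open>\<rho> n\<close>. If no edge of the graph joins two different
  cells and no cell contains too many vertices, then all components are small; so it suffices to bound from
  below the probability that the cells are separated, at a cost \<open>n\<^sup>\<zeta> (log n)\<^sup>m\<close>, \<open>m = \<mm>\<^sub>\<star> - 1\<close>, per cell.

  A vertex at distance \<open>r\<close> from the boundary of its cell is asked to have mark at most of order \<open>r\<^bsup>d \<gamma>\<^esup>\<close>, where
  \<open>\<gamma> = (1 - max \<zeta>\<^sub>h\<^sub>l \<zeta>\<^sub>h\<^sub>h) / (\<tau> - 1)\<close>. Suppressing the larger marks costs \<open>\<Sum> r\<^bsup>- d \<gamma> (\<tau> - 1)\<^esup>\<close>, which has the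
  exponent \<open>1 - \<gamma> (\<tau> - 1) = max \<zeta>\<^sub>h\<^sub>l \<zeta>\<^sub>h\<^sub>h\<close>. Since \<open>\<gamma> (\<sigma> + 1) \<le> 1\<close>, the edge probabilities between different cells are then
  bounded away from 1, and by Jensen's inequality the absence of all of them costs their expected number.
  This number is a sum over dyadic scales of the distance and of both marks; each of the three geometric sums
  contributes a logarithm exactly when its exponent vanishes, that is when two of the four exponents agree.

  In the Poisson case one also empties the cubes within a bounded distance of the cell boundaries, and a second
  application of Jensen's inequality averages over the numbers of vertices in unit cubes.
\<close>

section \<open>Unit cubes and cells\<close>

text \<open>The cap on a mark may depend on the depth of its own vertex alone, because both
  endpoints of an edge between different cells have depth at most their distance. The value of
  \<gamma> is a balance. Write \<open>t\<close> for \<tau> - 1 and let \<alpha> be finite. The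
  exponent 1 - \<gamma> t of the suppressed marks meets the exponent 2 - \<alpha> + \<gamma>
  (\<alpha> - t) of the edges between a large and an ordinary mark at \<gamma> = 1 - 1/\<alpha>,
  with common value \<open>zeta_hl\<close>. It meets the exponent 2 - \<alpha> + \<gamma> (\<alpha>
  (\<sigma> + 1) - 2 t) of the edges between two large marks at \<gamma> = (1 - 1/\<alpha>) /
  (\<sigma> + 1 - t/\<alpha>), with common value \<open>zeta_hh\<close> if \<tau> \<le> \<sigma> +
  2. For larger \<tau> the second condition becomes \<gamma> \<le> 1/(\<sigma> + 1). A further
  obstacle is the random enumeration of the vertices: the model gives edge probabilities for fixed
  pairs of indices, while it is random which pairs lie in different cells. The locations are
  therefore split into finitely many configurations of the first indices, and all costs are
  rewritten as sums over fixed cubes weighted with their random counts.\<close>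

lemma card_vec_prod:
  fixes A :: "'d::finite \<Rightarrow> int set"
  assumes "\<And>i. finite (A i)"
  shows "finite {z :: int ^ 'd. \<forall>i. z $ i \<in> A i}"
    and "card {z :: int ^ 'd. \<forall>i. z $ i \<in> A i} = (\<Prod>i\<in>UNIV. card (A i))"
proof -
  have eq: "{z :: int ^ 'd. \<forall>i. z $ i \<in> A i} = vec_lambda ` PiE UNIV A"
  proof (intro set_eqI iffI)
    fix z :: "int ^ 'd" assume "z \<in> {z. \<forall>i. z $ i \<in> A i}"
    then have "vec_nth z \<in> PiE UNIV A" by (simp add: PiE_iff)
    then have "vec_lambda (vec_nth z) \<in> vec_lambda ` PiE UNIV A" by (rule imageI)
    then show "z \<in> vec_lambda ` PiE UNIV A" by simp
  qed auto
  have inj: "inj_on (vec_lambda :: ('d \<Rightarrow> int) \<Rightarrow> int ^ 'd) (PiE UNIV A)"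
    by (rule inj_onI) (simp add: vec_lambda_inject)
  show "finite {z :: int ^ 'd. \<forall>i. z $ i \<in> A i}"
    unfolding eq by (intro finite_imageI finite_PiE assms) simp
  show "card {z :: int ^ 'd. \<forall>i. z $ i \<in> A i} = (\<Prod>i\<in>UNIV. card (A i))"
    unfolding eq by (simp add: card_image[OF inj] card_PiE)
qed

definition cube :: "real ^ 'd \<Rightarrow> int ^ 'd::finite" where
  "cube x = (\<chi> i. \<lfloor>x $ i\<rfloor>)"

definition cell :: "nat \<Rightarrow> int ^ 'd \<Rightarrow> int ^ 'd::finite" where
  "cell l z = (\<chi> i. z $ i div int l)"

text \<open>Supremum distance of cube indices, kept as a natural number so that
  \<open>floor_log\<close> yields its dyadic scale.\<close>

definition gap :: "int ^ 'd \<Rightarrow> int ^ 'd::finite \<Rightarrow> nat" where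
  "gap u v = Max (range (\<lambda>i. nat \<bar>u $ i - v $ i\<bar>))"

text \<open>Distance, counted from 1, to the boundary of the own cell.\<close>

definition depth :: "nat \<Rightarrow> int ^ 'd::finite \<Rightarrow> nat" where
  "depth l z = Suc (Min (range (\<lambda>i. nat (min (z $ i mod int l) (int l - 1 - z $ i mod int l)))))"

lemma gap_le_iff: "gap u v \<le> k \<longleftrightarrow> (\<forall>i. \<bar>u $ i - v $ i\<bar> \<le> int k)"
  unfolding gap_def by (subst Max_le_iff) (auto simp: nat_le_iff)

lemma gap_ge: "\<bar>u $ i - v $ i\<bar> \<le> int (gap u v)"
  using gap_le_iff[of u v "gap u v"] by auto

lemma gap_attained: "\<exists>i. \<bar>u $ i - v $ i\<bar> = int (gap u v)"
proof -
  have "gap u v \<in> range (\<lambda>i. nat \<bar>u $ i - v $ i\<bar>)"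
    unfolding gap_def by (rule Max_in) auto
  then show ?thesis by auto
qed

lemma depth_pos: "depth l z \<ge> 1"
  by (simp add: depth_def)

lemma depth_le_iff:
  "depth l z \<le> k \<longleftrightarrow> (\<exists>i. nat (min (z $ i mod int l) (int l - 1 - z $ i mod int l)) < k)"
  unfolding depth_def Suc_le_eq by (subst Min_less_iff) auto

lemma depth_ge:
  assumes "l \<ge> 1"
  shows "int (depth l z) \<le> z $ i mod int l + 1" "int (depth l z) \<le> int l - z $ i mod int l"
proof -
  have m: "0 \<le> z $ i mod int l" "z $ i mod int l < int l" using assms by auto
  have "depth l z \<le> nat (min (z $ i mod int l) (int l - 1 - z $ i mod int l)) + 1"
    unfolding depth_le_iff by (rule exI[of _ i]) simp
  then show "int (depth l z) \<le> z $ i mod int l + 1" "int (depth l z) \<le> int l - z $ i mod int l"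
    using m by linarith+
qed

lemma depth_le_side: "l \<ge> 1 \<Longrightarrow> depth l z \<le> l"
  using depth_ge(2)[of l z undefined] pos_mod_sign[of "int l" "z $ undefined"] by linarith

text \<open>In a coordinate where the cells differ, the way from \<open>u\<close> to
  \<open>v\<close> runs through the rest of the one cell and the initial part of the other, and
  these parts are at least as long as the depths. The \<open>+ 1\<close> arises because depths count
  from 1, while adjacent cubes of different cells have gap 1.\<close>

lemma depth_add_le_gap:
  assumes l: "l \<ge> 1" and ne: "cell l u \<noteq> cell l v"
  shows "depth l u + depth l v \<le> gap u v + 1"
proof -
  have key: "int (depth l u) + int (depth l v) \<le> v $ i - u $ i + 1"
    if "u $ i div int l < v $ i div int l" for u v :: "int ^ 'd" and i
  proof -
    have "v $ i - u $ i = int l * (v $ i div int l - u $ i div int l) + v $ i mod int l - u $ i mod int l"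
      by (simp add: algebra_simps)
    moreover have "int l * 1 \<le> int l * (v $ i div int l - u $ i div int l)"
      using that l by (intro mult_left_mono) auto
    ultimately show ?thesis using depth_ge[OF l, of u i] depth_ge[OF l, of v i] by linarith
  qed
  obtain i where "u $ i div int l \<noteq> v $ i div int l"
    using ne by (auto simp: cell_def vec_eq_iff)
  then consider "u $ i div int l < v $ i div int l" | "v $ i div int l < u $ i div int l" by linarith
  then show ?thesis
    using key[of u i v] key[of v i u] gap_ge[of u i v] by cases linarith+
qed

lemma gap_ge_depth:
  assumes "l \<ge> 1" "cell l u \<noteq> cell l v"
  shows "depth l u \<le> gap u v" "depth l v \<le> gap u v" "1 \<le> gap u v"
  using depth_add_le_gap[OF assms] depth_pos[of l u] depth_pos[of l v] by linarith+

lemma cube_distance: "real (gap (cube x) (cube y)) - 1 \<le> norm (x - y)"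
proof -
  obtain i where i: "\<bar>cube x $ i - cube y $ i\<bar> = int (gap (cube x) (cube y))"
    using gap_attained by blast
  have "real (gap (cube x) (cube y)) - 1 \<le> \<bar>x $ i - y $ i\<bar>"
    using i unfolding cube_def by simp linarith
  also have "\<dots> \<le> norm (x - y)"
    using component_le_norm_cart[of "x - y" i] by simp
  finally show ?thesis .
qed

text \<open>Lattice points are corners of their cubes, so the unit lost in
  \<open>cube_distance\<close> is kept. In the lattice with \<open>p = 1\<close> there is no slack
  for nearest neighbours in different cells, and the exact distance matters.\<close>

lemma lattice_distance:
  assumes "x \<in> integer_lattice" "y \<in> integer_lattice"
  shows "real (gap (cube x) (cube y)) \<le> norm (x - y)"
proof -
  obtain i where i: "\<bar>cube x $ i - cube y $ i\<bar> = int (gap (cube x) (cube y))"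
    using gap_attained by blast
  have fl: "real_of_int \<lfloor>x $ i\<rfloor> = x $ i" "real_of_int \<lfloor>y $ i\<rfloor> = y $ i"
    using assms by (auto simp: integer_lattice_def)
  have "real (gap (cube x) (cube y)) = real_of_int \<bar>cube x $ i - cube y $ i\<bar>" using i by simp
  also have "\<dots> = \<bar>x $ i - y $ i\<bar>" by (simp add: cube_def fl)
  also have "\<dots> \<le> norm (x - y)"
    using component_le_norm_cart[of "x - y" i] by simp
  finally show ?thesis .
qed

lemma finite_gap_ball: "finite {v :: int ^ 'd::finite. gap u v \<le> k}"
  and card_gap_ball: "card {v :: int ^ 'd::finite. gap u v \<le> k} = (2 * k + 1) ^ CARD('d)"
proof -
  have eq: "{v :: int ^ 'd. gap u v \<le> k} = {v. \<forall>i. v $ i \<in> {u $ i - int k .. u $ i + int k}}"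
    by (auto simp: gap_le_iff abs_le_iff algebra_simps)
  show "finite {v :: int ^ 'd. gap u v \<le> k}" unfolding eq by (rule card_vec_prod) auto
  show "card {v :: int ^ 'd. gap u v \<le> k} = (2 * k + 1) ^ CARD('d)"
    unfolding eq by (subst card_vec_prod) (auto simp: nat_add_distrib nat_mult_distrib)
qed

lemma div_eq_iff_interval:
  assumes "l \<ge> 1"
  shows "{x :: int. x div int l = q} = (\<lambda>j. q * int l + j) ` {0..<int l}"
proof (intro set_eqI iffI)
  fix x assume "x \<in> {x. x div int l = q}"
  then have "x = q * int l + x mod int l" by auto
  then show "x \<in> (\<lambda>j. q * int l + j) ` {0..<int l}" using assms by (intro image_eqI) auto
next
  fix x assume "x \<in> (\<lambda>j. q * int l + j) ` {0..<int l}"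
  then obtain j where "x = q * int l + j" "0 \<le> j" "j < int l" by (auto simp del: image_add_atLeastLessThan image_add_atLeastLessThan')
  then show "x \<in> {x. x div int l = q}" using assms by simp
qed

lemma finite_cell: "l \<ge> 1 \<Longrightarrow> finite {z :: int ^ 'd::finite. cell l z = q}"
  and card_cell: "l \<ge> 1 \<Longrightarrow> card {z :: int ^ 'd::finite. cell l z = q} = l ^ CARD('d)"
proof -
  assume l: "l \<ge> 1"
  have eq: "{z :: int ^ 'd. cell l z = q} = {z. \<forall>i. z $ i \<in> (\<lambda>j. q $ i * int l + j) ` {0..<int l}}"
    unfolding div_eq_iff_interval[OF l, symmetric] by (auto simp: cell_def vec_eq_iff)
  show "finite {z :: int ^ 'd. cell l z = q}" unfolding eq by (rule card_vec_prod) auto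
  show "card {z :: int ^ 'd. cell l z = q} = l ^ CARD('d)"
    unfolding eq by (subst card_vec_prod) (auto simp: card_image)
qed

text \<open>Shallow cubes lie in slabs of thickness \<open>k\<close> along the \<open>2 * d\<close>
  faces of the cell. The factor \<open>l ^ (d - 1)\<close> is the surface order behind the exponent
  \<open>zeta_short\<close>.\<close>

lemma card_shallow:
  assumes l: "l \<ge> 1"
  shows "card {z :: int ^ 'd::finite. cell l z = q \<and> depth l z \<le> k}
    \<le> CARD('d) * (2 * k) * l ^ (CARD('d) - 1)"
proof -
  \<comment> \<open>\<open>A i\<close> describes the two slabs orthogonal to direction
    \<open>i\<close>. For large \<open>k\<close> their intervals overlap or leave the cell, which is
    harmless for an upper bound.\<close>
  define A where "A i j = (if j = i then {q $ j * int l ..< q $ j * int l + int k} \<union>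
      {q $ j * int l + int l - int k ..< q $ j * int l + int l}
    else {q $ j * int l ..< q $ j * int l + int l})" for i j
  define B where "B i = {z :: int ^ 'd. \<forall>j. z $ j \<in> A i j}" for i
  have finA: "finite (A i j)" for i j by (auto simp: A_def)
  have cardB: "card (B i) \<le> 2 * k * l ^ (CARD('d) - 1)" for i
  proof -
    have "card (B i) = (\<Prod>j\<in>UNIV. card (A i j))"
      unfolding B_def by (rule card_vec_prod) (rule finA)
    also have "\<dots> = card (A i i) * (\<Prod>j\<in>UNIV - {i}. card (A i j))"
      by (rule prod.remove) auto
    also have "(\<Prod>j\<in>UNIV - {i}. card (A i j)) = (\<Prod>j\<in>UNIV - {i}. l)"
      by (rule prod.cong) (auto simp: A_def)
    also have "\<dots> = l ^ (CARD('d) - 1)" by (simp add: card_Diff_subset)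
    also have "card (A i i) \<le> 2 * k"
    proof -
      have "card (A i i) \<le> card {q $ i * int l ..< q $ i * int l + int k} +
          card {q $ i * int l + int l - int k ..< q $ i * int l + int l}"
        unfolding A_def by (simp only: if_True refl) (rule card_Un_le)
      then show ?thesis by simp
    qed
    finally show ?thesis by (simp add: mult_right_mono)
  qed
  have "{z :: int ^ 'd. cell l z = q \<and> depth l z \<le> k} \<subseteq> (\<Union>i. B i)"
  proof safe
    fix z :: "int ^ 'd" assume z: "depth l z \<le> k" and q: "q = cell l z"
    obtain i where i: "nat (min (z $ i mod int l) (int l - 1 - z $ i mod int l)) < k"
      using z by (auto simp: depth_le_iff)
    have zj: "z $ j = cell l z $ j * int l + z $ j mod int l" for j by (simp add: cell_def)
    have m: "0 \<le> z $ j mod int l" "z $ j mod int l < int l" for j using l by auto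
    have "z $ j \<in> A i j" for j
    proof (cases "j = i")
      case True
      show ?thesis using i zj[of i] m[of i] unfolding A_def q True by auto
    next
      case False
      show ?thesis using zj[of j] m[of j] unfolding A_def q using False by auto
    qed
    then show "z \<in> (\<Union>i. B i)" by (auto simp: B_def)
  qed
  then have "card {z :: int ^ 'd. cell l z = q \<and> depth l z \<le> k} \<le> card (\<Union>i. B i)"
    by (rule card_mono[rotated]) (auto simp: B_def intro!: card_vec_prod finA)
  also have "\<dots> \<le> (\<Sum>i\<in>UNIV. card (B i))" by (rule card_UN_le) simp
  also have "\<dots> \<le> (\<Sum>i\<in>(UNIV :: 'd set). 2 * k * l ^ (CARD('d) - 1))"
    by (rule sum_mono) (rule cardB)
  finally show ?thesis by simp
qed

section \<open>Dyadic sums\<close>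

definition geo :: "real \<Rightarrow> nat \<Rightarrow> nat \<Rightarrow> real" where
  "geo x J K = (\<Sum>k\<le>K. 2 powr (x * real k) * real (k + 1) ^ J)"

lemma geo_nonneg: "geo x J K \<ge> 0"
  unfolding geo_def by (intro sum_nonneg) auto

lemma power_le_exponential:
  fixes \<epsilon> :: real
  assumes "\<epsilon> > 0"
  shows "\<exists>C>0. \<forall>k::nat. real (k + 1) ^ J \<le> C * 2 powr (\<epsilon> * real k)"
proof -
  have "(\<lambda>k::nat. real (k + 1) ^ J * 2 powr (- \<epsilon> * real k)) \<longlonglongrightarrow> 0"
    using assms by real_asymp
  then have "Bseq (\<lambda>k::nat. real (k + 1) ^ J * 2 powr (- \<epsilon> * real k))"
    by (intro convergent_imp_Bseq) (auto simp: convergent_def)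
  then obtain C where C: "C > 0" "\<And>k::nat. norm (real (k + 1) ^ J * 2 powr (- \<epsilon> * real k)) \<le> C"
    by (auto simp: Bseq_def)
  have "real (k + 1) ^ J \<le> C * 2 powr (\<epsilon> * real k)" for k
  proof -
    have "real (k + 1) ^ J = real (k + 1) ^ J * 2 powr (- \<epsilon> * real k) * 2 powr (\<epsilon> * real k)"
      by (simp add: powr_add[symmetric] del: of_nat_add)
    also have "\<dots> \<le> C * 2 powr (\<epsilon> * real k)"
      using C(2)[of k] by (intro mult_right_mono) auto
    finally show ?thesis .
  qed
  then show ?thesis using C(1) by blast
qed

lemma sum_geometric_le:
  fixes x :: real
  assumes "x < 0"
  shows "(\<Sum>k\<le>K. 2 powr (x * real k)) \<le> 1 / (1 - 2 powr x)"
proof -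
  define r where "r = 2 powr x"
  have r: "0 < r" "r < 1" using assms by (auto simp: r_def powr_less_one)
  have "(\<Sum>k\<le>K. 2 powr (x * real k)) = (\<Sum>k<Suc K. r ^ k)"
    unfolding r_def by (intro sum.cong) (auto simp: powr_realpow[symmetric] powr_powr)
  also have "\<dots> = (1 - r ^ Suc K) / (1 - r)" using r by (subst sum_gp_strict) auto
  also have "\<dots> \<le> 1 / (1 - r)" using r by (intro divide_right_mono) auto
  finally show ?thesis by (simp add: r_def)
qed

text \<open>The sum is dominated by its first term, spread evenly over the scales, or dominated by
  its last term. Only a vanishing exponent raises the power of \<open>K + 1\<close>, the binary
  logarithm of the largest scale; this is the sole source of logarithms.\<close>

lemma geo_bound:
  "\<exists>C>0. \<forall>K. geo x J K \<le> C * 2 powr (max x 0 * real K) *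
     real (K + 1) ^ (if x < 0 then 0 else if x = 0 then J + 1 else J)"
proof -
  consider "x < 0" | "x = 0" | "x > 0" by linarith
  then show ?thesis
  proof cases
    case 1
    \<comment> \<open>Half of the decay rate is spent on the polynomial factor, the other half keeps
      the series convergent.\<close>
    then obtain C where C: "C > 0" "\<And>k::nat. real (k + 1) ^ J \<le> C * 2 powr ((- x / 2) * real k)"
      using power_le_exponential[of "- x / 2" J] by auto
    have "geo x J K \<le> C * (1 / (1 - 2 powr (x / 2)))" for K
    proof -
      have "geo x J K \<le> (\<Sum>k\<le>K. 2 powr (x * real k) * (C * 2 powr ((- x / 2) * real k)))"
        unfolding geo_def by (intro sum_mono mult_left_mono C) auto
      also have "\<dots> = C * (\<Sum>k\<le>K. 2 powr ((x / 2) * real k))"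
        unfolding sum_distrib_left
        by (intro sum.cong) (auto simp: powr_add[symmetric] field_simps)
      also have "\<dots> \<le> C * (1 / (1 - 2 powr (x / 2)))"
        using C(1) 1 by (intro mult_left_mono sum_geometric_le) auto
      finally show ?thesis .
    qed
    moreover have "C * (1 / (1 - 2 powr (x / 2))) > 0"
      using C(1) 1 powr_less_one[of 2 "x / 2"] by simp
    ultimately show ?thesis using 1
      by (intro exI[of _ "C * (1 / (1 - 2 powr (x / 2)))"]) auto
  next
    case 2
    have "geo x J K \<le> real (K + 1) ^ (J + 1)" for K
    proof -
      have "geo x J K \<le> (\<Sum>k\<le>K. real (K + 1) ^ J)"
        unfolding geo_def 2 by (intro sum_mono) (auto intro!: power_mono)
      then show ?thesis by simp
    qed
    then show ?thesis using 2 by (intro exI[of _ 1]) auto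
  next
    case 3
    have "geo x J K \<le> (1 / (1 - 2 powr (- x))) * 2 powr (x * real K) * real (K + 1) ^ J" for K
    proof -
      have "geo x J K \<le> (\<Sum>k\<le>K. 2 powr (x * real k) * real (K + 1) ^ J)"
        unfolding geo_def by (intro sum_mono mult_left_mono power_mono) auto
      also have "\<dots> = (\<Sum>k\<le>K. 2 powr (x * real k)) * real (K + 1) ^ J"
        by (simp add: sum_distrib_right)
      \<comment> \<open>Counted from the top scale downwards the terms decay geometrically.\<close>
      also have "(\<Sum>k\<le>K. 2 powr (x * real k)) = (\<Sum>k\<le>K. 2 powr (x * real (K - k)))"
        using sum.atLeastAtMost_rev[of "\<lambda>k. 2 powr (x * real k)" 0 K]
        by (simp add: atMost_atLeast0)
      also have "\<dots> = (\<Sum>k\<le>K. 2 powr ((- x) * real k)) * 2 powr (x * real K)"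
        unfolding sum_distrib_right
        by (intro sum.cong) (auto simp: powr_add[symmetric] of_nat_diff algebra_simps)
      also have "\<dots> \<le> (1 / (1 - 2 powr (- x))) * 2 powr (x * real K)"
        using 3 by (intro mult_right_mono sum_geometric_le) auto
      finally show ?thesis by (simp add: mult_right_mono)
    qed
    moreover have "1 / (1 - 2 powr (- x)) > 0" using 3 powr_less_one[of 2 "- x"] by simp
    ultimately show ?thesis using 3 by (intro exI[of _ "1 / (1 - 2 powr (- x))"]) auto
  qed
qed

text \<open>Dyadic form of the expectation of \<open>max w w' powr a * min w w' powr (a * s)\<close>
  for two marks with tail exponent \<open>t\<close>, capped at \<open>2 ^ K\<close>. For a given
  larger mark the sum over the smaller one has exponent \<open>x\<close>; the remaining sum over the
  larger one has exponent \<open>y\<close>. A logarithm of the inner sum survives only if the outer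
  sum does not converge.\<close>

lemma geo_moment_bound:
  fixes a s t x y :: real
  defines "x \<equiv> a * s - t"
  defines "y \<equiv> a - t + max x 0"
  defines "J \<equiv> (if y < 0 then 0 else (if y = 0 then 1 else 0) + (if x = 0 then 1 else 0)) :: nat"
  shows "\<exists>C>0. \<forall>K::nat. (\<Sum>k\<le>K. \<Sum>m\<le>K. 2 powr (a * real (max k m) + a * s * real (min k m) - t * real (k + m)))
     \<le> C * 2 powr (max y 0 * real K) * real (K + 1) ^ J"
proof -
  define j where "j = (if x = 0 then 1 else 0 :: nat)"
  obtain C1 where C1: "C1 > 0" "\<And>K. geo x 0 K \<le> C1 * 2 powr (max x 0 * real K) *
     real (K + 1) ^ (if x < 0 then 0 else if x = 0 then 0 + 1 else 0)"
    using geo_bound[of x 0] by blast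
  have C1': "geo x 0 K \<le> C1 * 2 powr (max x 0 * real K) * real (K + 1) ^ j" for K
    using C1(2)[of K] by (auto simp: j_def split: if_splits)
  obtain C2 where C2: "C2 > 0" "\<And>K. geo y j K \<le> C2 * 2 powr (max y 0 * real K) *
     real (K + 1) ^ (if y < 0 then 0 else if y = 0 then j + 1 else j)"
    using geo_bound[of y j] by blast
  have J: "(if y < 0 then 0 else if y = 0 then j + 1 else j) = J"
    by (auto simp: J_def j_def)
  define f where "f k m = 2 powr (a * real (max k m) + a * s * real (min k m) - t * real (k + m))"
    for k m :: nat
  have fsym: "f k m = f m k" for k m by (simp add: f_def max.commute min.commute add.commute)
  have f0: "f k m \<ge> 0" for k m by (simp add: f_def)
  have tri: "(\<Sum>k\<le>K. \<Sum>m\<le>k. f k m) \<le> C1 * geo y j K" for K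
  proof -
    have "(\<Sum>m\<le>k. f k m) \<le> C1 * (2 powr (y * real k) * real (k + 1) ^ j)" for k
    proof -
      have "(\<Sum>m\<le>k. f k m) = 2 powr ((a - t) * real k) * geo x 0 k"
        unfolding geo_def sum_distrib_left
        by (intro sum.cong) (auto simp: f_def x_def powr_add[symmetric] algebra_simps)
      also have "\<dots> \<le> 2 powr ((a - t) * real k) * (C1 * 2 powr (max x 0 * real k) * real (k + 1) ^ j)"
        by (intro mult_left_mono C1') auto
      also have "\<dots> = C1 * (2 powr (y * real k) * real (k + 1) ^ j)"
        unfolding y_def by (simp add: powr_add powr_diff algebra_simps del: of_nat_add)
      finally show ?thesis .
    qed
    then have "(\<Sum>k\<le>K. \<Sum>m\<le>k. f k m) \<le> (\<Sum>k\<le>K. C1 * (2 powr (y * real k) * real (k + 1) ^ j))"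
      by (intro sum_mono)
    then show ?thesis by (simp add: geo_def sum_distrib_left)
  qed
  have "(\<Sum>k\<le>K. \<Sum>m\<le>K. f k m) \<le> 2 * (C1 * (C2 * 2 powr (max y 0 * real K) * real (K + 1) ^ J))" for K
  proof -
    \<comment> \<open>The diagonal belongs to both halves, hence only an inequality. By symmetry
      both halves give the same triangular sum.\<close>
    have "(\<Sum>m\<le>K. f k m) \<le> (\<Sum>m\<in>{m. m \<le> k \<and> m \<le> K}. f k m) + (\<Sum>m\<in>{m. k \<le> m \<and> m \<le> K}. f k m)" for k
    proof -
      have "{..K} = {m. m \<le> k \<and> m \<le> K} \<union> {m. k \<le> m \<and> m \<le> K}" by auto
      then show ?thesis
        using sum_Un_nat sum.union_inter[of "{m. m \<le> k \<and> m \<le> K}" "{m. k \<le> m \<and> m \<le> K}" "f k"]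
          sum_nonneg[of "{m. m \<le> k \<and> m \<le> K} \<inter> {m. k \<le> m \<and> m \<le> K}" "f k"] f0 by simp
    qed
    then have "(\<Sum>k\<le>K. \<Sum>m\<le>K. f k m) \<le> (\<Sum>k\<le>K. (\<Sum>m\<in>{m. m \<le> k \<and> m \<le> K}. f k m) + (\<Sum>m\<in>{m. k \<le> m \<and> m \<le> K}. f k m))"
      by (intro sum_mono)
    also have "\<dots> = (\<Sum>k\<le>K. \<Sum>m\<in>{m. m \<le> k \<and> m \<le> K}. f k m) + (\<Sum>k\<le>K. \<Sum>m\<in>{m. k \<le> m \<and> m \<le> K}. f k m)"
      by (simp add: sum.distrib)
    also have "(\<Sum>k\<le>K. \<Sum>m\<in>{m. m \<le> k \<and> m \<le> K}. f k m) = (\<Sum>k\<le>K. \<Sum>m\<le>k. f k m)"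
      by (intro sum.cong) auto
    also have "(\<Sum>k\<le>K. \<Sum>m\<in>{m. k \<le> m \<and> m \<le> K}. f k m) = (\<Sum>k\<le>K. \<Sum>m\<in>{m. m \<in> {..K} \<and> k \<le> m}. f m k)"
      by (intro sum.cong) (auto simp: fsym)
    also have "\<dots> = (\<Sum>m\<le>K. \<Sum>k\<in>{k. k \<in> {..K} \<and> k \<le> m}. f m k)"
      by (rule sum.swap_restrict) auto
    also have "\<dots> = (\<Sum>k\<le>K. \<Sum>m\<le>k. f k m)"
      by (intro sum.cong) auto
    also have "(\<Sum>k\<le>K. \<Sum>m\<le>k. f k m) + (\<Sum>k\<le>K. \<Sum>m\<le>k. f k m) \<le> 2 * (C1 * geo y j K)"
      using tri[of K] by simp
    also have "\<dots> \<le> 2 * (C1 * (C2 * 2 powr (max y 0 * real K) * real (K + 1) ^ J))"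
      using C2(2)[of K] C1(1) unfolding J by (intro mult_left_mono) auto
    finally show ?thesis .
  qed
  then show ?thesis using C1(1) C2(1) unfolding f_def
    by (intro exI[of _ "2 * C1 * C2"]) (auto simp: mult.assoc)
qed

text \<open>A term of order \<open>n\<^sup>\<eta> (log n)\<^sup>J\<close> per unit volume of the scale is admissible if, after the summation
  over the distance to the boundary (which gains a logarithm if \<open>\<eta>\<close> equals the surface exponent),
  it is at most of order \<open>n\<^sup>\<zeta> (log n)\<^sup>\<mu>\<close>.\<close>

definition admissible :: "nat \<Rightarrow> real \<Rightarrow> nat \<Rightarrow> real \<Rightarrow> nat \<Rightarrow> bool" where
  "admissible d \<zeta> \<mu> \<eta> J \<longleftrightarrow> \<eta> < \<zeta> \<or>
     (\<eta> = \<zeta> \<and> J + (if \<eta> = (real d - 1) / real d then 1 else 0) \<le> \<mu>)"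

text \<open>The prefactor is the surface of a cell of side \<open>2 ^ K\<close>, and the exponent
  inside \<open>geo\<close> is \<open>d\<close> times the excess of \<eta> over the surface
  exponent. The product thus has exponent \<open>d * max \<eta> ((d - 1) / d)\<close>. If this is
  below \<open>d * \<zeta>\<close>, a small power absorbs all logarithms; in the case of equality
  \<open>admissible\<close> counts them.\<close>

lemma geo_admissible:
  assumes d: "d \<ge> 1" and short: "(real d - 1) / real d \<le> \<zeta>" and adm: "admissible d \<zeta> \<mu> \<eta> J"
  shows "\<exists>C>0. \<forall>K. 2 powr ((real d - 1) * real K) * geo (real d * \<eta> - real d + 1) J K
    \<le> C * 2 powr (real d * \<zeta> * real K) * real (K + 1) ^ \<mu>"
proof -
  define x where "x = real d * \<eta> - real d + 1"
  define J' where "J' = (if x < 0 then 0 else if x = 0 then J + 1 else J)"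
  define e where "e = (real d - 1) + max x 0"
  obtain C where C: "C > 0" "\<And>K. geo x J K \<le> C * 2 powr (max x 0 * real K) * real (K + 1) ^ J'"
    using geo_bound[of x J] unfolding J'_def by blast
  have main: "2 powr ((real d - 1) * real K) * geo x J K \<le> C * (2 powr (e * real K) * real (K + 1) ^ J')" for K
  proof -
    have "2 powr ((real d - 1) * real K) * geo x J K
        \<le> 2 powr ((real d - 1) * real K) * (C * 2 powr (max x 0 * real K) * real (K + 1) ^ J')"
      by (intro mult_left_mono C) auto
    also have "\<dots> = C * (2 powr (e * real K) * real (K + 1) ^ J')"
      by (simp add: e_def powr_add powr_diff algebra_simps del: of_nat_add)
    finally show ?thesis .
  qed
  have dpos: "real d > 0" using d by simp
  have xle: "x \<le> 0 \<longleftrightarrow> \<eta> \<le> (real d - 1) / real d" "x = 0 \<longleftrightarrow> \<eta> = (real d - 1) / real d"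
    using dpos by (auto simp: x_def field_simps)
  have short': "real d - 1 \<le> real d * \<zeta>" using short dpos by (simp add: field_simps)
  have ele: "e \<le> real d * \<zeta>"
  proof (cases "x \<le> 0")
    case False
    have "\<eta> \<le> \<zeta>" using adm by (auto simp: admissible_def)
    then have "real d * \<eta> \<le> real d * \<zeta>" using dpos by simp
    then show ?thesis using False by (simp add: e_def x_def)
  qed (use short' in \<open>simp add: e_def\<close>)
  consider "e < real d * \<zeta>" | "e = real d * \<zeta>" using ele by linarith
  then show ?thesis
  proof cases
    case 1
    obtain C' where C': "C' > 0" "\<And>k::nat. real (k + 1) ^ J' \<le> C' * 2 powr ((real d * \<zeta> - e) * real k)"
      using power_le_exponential[of "real d * \<zeta> - e" J'] 1 by auto
    have "2 powr ((real d - 1) * real K) * geo x J K \<le> C * C' * 2 powr (real d * \<zeta> * real K) * real (K + 1) ^ \<mu>" for K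
    proof -
      have "C * (2 powr (e * real K) * real (K + 1) ^ J')
          \<le> C * (2 powr (e * real K) * (C' * 2 powr ((real d * \<zeta> - e) * real K)))"
        using C(1) by (intro mult_left_mono C') auto
      also have "\<dots> = C * C' * 2 powr (real d * \<zeta> * real K)"
        by (simp add: powr_add[symmetric] algebra_simps)
      also have "\<dots> \<le> C * C' * 2 powr (real d * \<zeta> * real K) * real (K + 1) ^ \<mu>"
      proof -
        have "1 \<le> real (K + 1) ^ \<mu>" by (intro one_le_power) auto
        then show ?thesis using mult_left_mono[of 1 "real (K + 1) ^ \<mu>" "C * C' * 2 powr (real d * \<zeta> * real K)"]
          C(1) C'(1) by simp
      qed
      finally show ?thesis using main[of K] by linarith
    qed
    then show ?thesis unfolding x_def using C(1) C'(1) by (intro exI[of _ "C * C'"]) auto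
  next
    case 2
    \<comment> \<open>For \<open>x < 0\<close> the sum over the scales converges and no logarithm
      survives. For \<open>x = 0\<close> the exponents \<eta>, \<zeta> and the surface exponent
      coincide, and the new logarithm is the extra one in \<open>admissible\<close>. For
      \<open>x > 0\<close> the surface exponent is strictly smaller.\<close>
    have "J' \<le> \<mu>"
    proof -
      consider "x < 0" | "x = 0" | "x > 0" by linarith
      then show ?thesis
      proof cases
        case b: 2
        then have "\<eta> = (real d - 1) / real d" using xle by simp
        moreover have "\<zeta> = (real d - 1) / real d" using 2 b dpos by (simp add: e_def field_simps)
        ultimately show ?thesis using adm b by (auto simp: admissible_def J'_def)
      next
        case c: 3
        then have "real d * \<eta> = real d * \<zeta>" using 2 by (simp add: e_def x_def)
        then have "\<eta> = \<zeta>" using dpos by simp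
        then show ?thesis using adm c by (auto simp: admissible_def J'_def split: if_splits)
      qed (simp add: J'_def)
    qed
    have "2 powr ((real d - 1) * real K) * geo x J K \<le> C * 2 powr (real d * \<zeta> * real K) * real (K + 1) ^ \<mu>" for K
    proof -
      have "C * (2 powr (e * real K) * real (K + 1) ^ J') \<le> C * (2 powr (e * real K) * real (K + 1) ^ \<mu>)"
        using C(1) \<open>J' \<le> \<mu>\<close> by (intro mult_left_mono power_increasing) auto
      then show ?thesis using main[of K] 2 by (simp add: mult.assoc)
    qed
    then show ?thesis unfolding x_def using C(1) by (intro exI[of _ C]) auto
  qed
qed

section \<open>Sums over the cubes of a cell and over pairs of cubes\<close>

lemma two_powr_nat: "2 powr real k = 2 ^ k"
  by (simp add: powr_realpow)

lemma floor_log_bounds: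
  assumes "l \<ge> 1"
  shows "2 ^ floor_log l \<le> l" "l \<le> 2 * 2 ^ floor_log l"
  using assms floor_log_exp2_le[of l] floor_log_exp2_ge[of l] by auto

text \<open>The scale \<open>2 ^ floor_log l\<close> is within a factor 2 of \<open>l\<close>, so
  the estimate passes from powers of 2 to all sides.\<close>

lemma surface_geo_bound:
  assumes d: "d \<ge> 1" and short: "(real d - 1) / real d \<le> \<zeta>" and adm: "admissible d \<zeta> \<mu> \<eta> J"
  shows "\<exists>C>0. \<forall>l\<ge>1. real l ^ (d - 1) * geo (real d * \<eta> - real d + 1) J (floor_log l)
    \<le> C * real l powr (real d * \<zeta>) * real (floor_log l + 1) ^ \<mu>"
proof -
  define x where "x = real d * \<eta> - real d + 1"
  obtain C where C: "C > 0" "\<And>K. 2 powr ((real d - 1) * real K) * geo x J K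
      \<le> C * 2 powr (real d * \<zeta> * real K) * real (K + 1) ^ \<mu>"
    using geo_admissible[OF assms] unfolding x_def by blast
  have "0 \<le> (real d - 1) / real d" using d by simp
  then have z: "\<zeta> \<ge> 0" using short by linarith
  have "real l ^ (d - 1) * geo x J (floor_log l)
     \<le> (2 ^ (d - 1) * C) * real l powr (real d * \<zeta>) * real (floor_log l + 1) ^ \<mu>" if l: "l \<ge> 1" for l
  proof -
    define \<kappa> where "\<kappa> = floor_log l"
    have b: "real l \<le> 2 * 2 powr real \<kappa>" "2 powr real \<kappa> \<le> real l"
      using floor_log_bounds[OF l] unfolding \<kappa>_def two_powr_nat
      by (metis of_nat_le_iff of_nat_mult of_nat_numeral of_nat_power)+
    have "real l ^ (d - 1) \<le> (2 * 2 powr real \<kappa>) ^ (d - 1)" using b by (intro power_mono) auto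
    also have "\<dots> = 2 ^ (d - 1) * 2 powr ((real d - 1) * real \<kappa>)"
      using d by (simp add: power_mult_distrib powr_realpow[symmetric] powr_powr of_nat_diff mult.commute)
    finally have "real l ^ (d - 1) * geo x J \<kappa> \<le> 2 ^ (d - 1) * (2 powr ((real d - 1) * real \<kappa>) * geo x J \<kappa>)"
      by (subst mult.assoc[symmetric]) (rule mult_right_mono[OF _ geo_nonneg])
    also have "\<dots> \<le> 2 ^ (d - 1) * (C * 2 powr (real d * \<zeta> * real \<kappa>) * real (\<kappa> + 1) ^ \<mu>)"
      by (intro mult_left_mono C) auto
    also have "2 powr (real d * \<zeta> * real \<kappa>) = (2 powr real \<kappa>) powr (real d * \<zeta>)"
      by (simp add: powr_powr mult.commute)
    also have "2 ^ (d - 1) * (C * (2 powr real \<kappa>) powr (real d * \<zeta>) * real (\<kappa> + 1) ^ \<mu>)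
        \<le> 2 ^ (d - 1) * (C * real l powr (real d * \<zeta>) * real (\<kappa> + 1) ^ \<mu>)"
      using C(1) z b by (intro mult_left_mono mult_right_mono powr_mono2) auto
    finally show ?thesis by (simp add: \<kappa>_def mult.assoc)
  qed
  then show ?thesis using C(1) unfolding x_def by (intro exI[of _ "2 ^ (d - 1) * C"]) auto
qed

text \<open>For \<open>b = \<gamma> * t\<close> the summand is, up to a constant, the probability
  that a vertex at this depth has a mark above its cap. The sum is then the price of the caps in one
  cell.\<close>

lemma cell_vertex_sum:
  fixes b :: real
  defines "d \<equiv> CARD('d::finite)"
  assumes short: "(real d - 1) / real d \<le> \<zeta>" and adm: "admissible d \<zeta> \<mu> (1 - b) 0"
  shows "\<exists>C>0. \<forall>l\<ge>1. \<forall>q :: int ^ 'd.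
    (\<Sum>u | cell l u = q. 2 powr (- real d * b * real (floor_log (depth l u))))
    \<le> C * real l powr (real d * \<zeta>) * real (floor_log l + 1) ^ \<mu>"
proof -
  have d: "d \<ge> 1" by (simp add: d_def Suc_leI)
  define x where "x = 1 - real d * b"
  have x: "real d * (1 - b) - real d + 1 = x" by (simp add: x_def algebra_simps)
  obtain C where C: "C > 0" "\<And>l. l \<ge> 1 \<Longrightarrow> real l ^ (d - 1) * geo x 0 (floor_log l)
    \<le> C * real l powr (real d * \<zeta>) * real (floor_log l + 1) ^ \<mu>"
    using surface_geo_bound[OF d short adm] unfolding x by blast
  have "(\<Sum>u | cell l u = q. 2 powr (- real d * b * real (floor_log (depth l u))))
    \<le> 4 * real d * C * real l powr (real d * \<zeta>) * real (floor_log l + 1) ^ \<mu>"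
    if l: "l \<ge> 1" for l and q :: "int ^ 'd"
  proof -
    define Q where "Q = {u :: int ^ 'd. cell l u = q}"
    define H where "H k = 2 powr (- real d * b * real k)" for k :: nat
    define \<kappa> where "\<kappa> = floor_log l"
    have finQ: "finite Q" unfolding Q_def by (rule finite_cell[OF l])
    \<comment> \<open>Each cube is charged to all dyadic layers that contain it, not only to the one
      of its own scale. Then only the nested layers of \<open>card_shallow\<close> have to be
      counted.\<close>
    have "(\<Sum>u\<in>Q. H (floor_log (depth l u))) \<le> (\<Sum>u\<in>Q. \<Sum>k\<le>\<kappa>. if depth l u \<le> 2 * 2 ^ k then H k else 0)"
    proof (rule sum_mono)
      fix u assume "u \<in> Q"
      have "floor_log (depth l u) \<le> \<kappa>"
        unfolding \<kappa>_def by (rule floor_log_le_iff) (rule depth_le_side[OF l])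
      moreover have "depth l u \<le> 2 * 2 ^ floor_log (depth l u)" by (rule floor_log_exp2_ge)
      ultimately have "H (floor_log (depth l u)) =
          (\<Sum>k\<in>{floor_log (depth l u)}. if depth l u \<le> 2 * 2 ^ k then H k else 0)" by simp
      also have "\<dots> \<le> (\<Sum>k\<le>\<kappa>. if depth l u \<le> 2 * 2 ^ k then H k else 0)"
        using \<open>floor_log (depth l u) \<le> \<kappa>\<close> by (intro sum_mono2) (auto simp: H_def)
      finally show "H (floor_log (depth l u)) \<le> (\<Sum>k\<le>\<kappa>. if depth l u \<le> 2 * 2 ^ k then H k else 0)" .
    qed
    also have "\<dots> = (\<Sum>k\<le>\<kappa>. \<Sum>u\<in>Q. if depth l u \<le> 2 * 2 ^ k then H k else 0)" by (rule sum.swap)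
    also have "\<dots> = (\<Sum>k\<le>\<kappa>. real (card {u. cell l u = q \<and> depth l u \<le> 2 * 2 ^ k}) * H k)"
      using finQ by (intro sum.cong refl) (simp add: sum.If_cases Q_def Collect_conj_eq Int_commute)
    also have "\<dots> \<le> (\<Sum>k\<le>\<kappa>. real (d * (2 * (2 * 2 ^ k)) * l ^ (d - 1)) * H k)"
      unfolding d_def
      by (intro sum_mono mult_right_mono of_nat_mono card_shallow[OF l]) (simp add: H_def)
    also have "\<dots> = 4 * real d * (real l ^ (d - 1) * geo x 0 \<kappa>)"
      unfolding geo_def sum_distrib_left H_def x_def
      by (intro sum.cong) (auto simp: two_powr_nat[symmetric] powr_add powr_diff algebra_simps powr_minus_divide)
    also have "\<dots> \<le> 4 * real d * (C * real l powr (real d * \<zeta>) * real (floor_log l + 1) ^ \<mu>)"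
      unfolding \<kappa>_def by (intro mult_left_mono C l) auto
    finally show ?thesis by (simp add: Q_def H_def mult.assoc)
  qed
  then show ?thesis using C(1) d by (intro exI[of _ "4 * real d * C"]) auto
qed

text \<open>Up to constants this is \<open>D powr (- d * a)\<close> times
  \<open>L powr (d * e)\<close> times the power \<open>J\<close> of the logarithm of
  \<open>L\<close>, with \<open>L = min D l\<close>. It bounds the expected edge probability of two
  capped vertices at distance \<open>D\<close>; the second factor stops growing at the cell side
  because depths, and with them the caps, do.\<close>

abbreviation pair_weight :: "nat \<Rightarrow> real \<Rightarrow> real \<Rightarrow> nat \<Rightarrow> nat \<Rightarrow> nat \<Rightarrow> real" where
  "pair_weight d a e J l D \<equiv> 2 powr (- real d * a * real (floor_log D))
    * 2 powr (real d * e * real (min (floor_log D) (floor_log l))) * real (min (floor_log D) (floor_log l) + 1) ^ J"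

text \<open>At distances of order \<open>2 ^ k\<close> a cube has at most of order
  \<open>2 ^ (d * k)\<close> partners, and its own depth is at most of order \<open>2 ^ k\<close>.
  Up to the scale of the cell this gives surface times a geometric sum; beyond it all cubes of the
  cell count, and \<open>a > 1\<close> makes the tail converge. Hence the bound is uniform in the
  set \<open>U\<close> of possible partners.\<close>

lemma cell_pair_sum:
  fixes a e :: real
  defines "d \<equiv> CARD('d::finite)"
  assumes a: "a > 1" and e: "e \<ge> 0"
    and short: "(real d - 1) / real d \<le> \<zeta>" and adm: "admissible d \<zeta> \<mu> (2 - a + e) J"
  shows "\<exists>C>0. \<forall>l\<ge>1. \<forall>q :: int ^ 'd. \<forall>U. finite U \<longrightarrow>
    (\<Sum>u | cell l u = q. \<Sum>v\<in>{v \<in> U. cell l v \<noteq> q}.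
       pair_weight d a e J l (gap u v))
    \<le> C * real l powr (real d * \<zeta>) * real (floor_log l + 1) ^ \<mu>"
proof -
  have d: "d \<ge> 1" by (simp add: d_def Suc_leI)
  define x where "x = 1 + real d * (1 - a) + real d * e"
  have x: "real d * (2 - a + e) - real d + 1 = x" by (simp add: x_def algebra_simps)
  obtain C where C: "C > 0" "\<And>l. l \<ge> 1 \<Longrightarrow> real l ^ (d - 1) * geo x J (floor_log l)
    \<le> C * real l powr (real d * \<zeta>) * real (floor_log l + 1) ^ \<mu>"
    using surface_geo_bound[OF d short adm] unfolding x by blast
  define y where "y = real d * (1 - a)"
  have y: "y < 0" using d a by (simp add: y_def mult_less_0_iff)
  define S where "S = 1 / (1 - 2 powr y)"
  have S: "S > 0" using y powr_less_one[of 2 y] by (simp add: S_def)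
  define C' where "C' = 5 ^ d * (4 * real d + 2 * S)"
  have C': "C' > 0" using S d unfolding C'_def by (intro mult_pos_pos add_nonneg_pos) auto
  have "(\<Sum>u | cell l u = q. \<Sum>v\<in>{v \<in> U. cell l v \<noteq> q}.
       pair_weight d a e J l (gap u v))
    \<le> C' * C * real l powr (real d * \<zeta>) * real (floor_log l + 1) ^ \<mu>"
    if l: "l \<ge> 1" and U: "finite U" for l and q :: "int ^ 'd" and U
  proof -
    define Q where "Q = {u :: int ^ 'd. cell l u = q}"
    define U' where "U' = {v \<in> U. cell l v \<noteq> q}"
    define \<kappa> where "\<kappa> = floor_log l"
    define H where "H k = 2 powr (- real d * a * real k) * 2 powr (real d * e * real (min k \<kappa>))
       * real (min k \<kappa> + 1) ^ J" for k :: nat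
    have H0: "H k \<ge> 0" for k by (simp add: H_def)
    have finQ: "finite Q" unfolding Q_def by (rule finite_cell[OF l])
    have finU: "finite U'" using U by (simp add: U'_def)
    \<comment> \<open>The largest scale that occurs only makes the sum over scales finite; the final
      bound does not depend on it.\<close>
    define m where "m = Max (insert \<kappa> ((\<lambda>(u, v). floor_log (gap u v)) ` (Q \<times> U')))"
    have mk: "\<kappa> \<le> m" unfolding m_def using finQ finU by (intro Max_ge) auto
    have mle: "floor_log (gap u v) \<le> m" if "u \<in> Q" "v \<in> U'" for u v
      unfolding m_def using finQ finU that by (intro Max_ge) auto
    define c where "c k = card {u. cell l u = q \<and> depth l u \<le> 2 * 2 ^ k}" for k
    have c1: "real (c k) \<le> 4 * real d * real l ^ (d - 1) * 2 powr real k" for k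
    proof -
      have "c k \<le> d * (2 * (2 * 2 ^ k)) * l ^ (d - 1)"
        unfolding c_def d_def by (rule card_shallow[OF l])
      then have "real (c k) \<le> real (d * (2 * (2 * 2 ^ k)) * l ^ (d - 1))" by (rule of_nat_mono)
      then show ?thesis by (simp add: two_powr_nat mult_ac)
    qed
    have c2: "real (c k) \<le> real l ^ (d - 1) * (2 * 2 powr real \<kappa>)" for k
    proof -
      have "c k \<le> card {u :: int ^ 'd. cell l u = q}"
        unfolding c_def by (rule card_mono) (auto intro: finite_cell[OF l])
      also have "\<dots> = l ^ (d - 1) * l"
        using d card_cell[OF l, of q] unfolding d_def by (simp add: power_Suc2[symmetric] del: power_Suc)
      also have "\<dots> \<le> l ^ (d - 1) * (2 * 2 ^ \<kappa>)"
        unfolding \<kappa>_def using floor_log_bounds[OF l] by (intro mult_left_mono) auto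
      finally have "real (c k) \<le> real (l ^ (d - 1) * (2 * 2 ^ \<kappa>))" by (rule of_nat_mono)
      then show ?thesis by (simp add: two_powr_nat)
    qed
    have ball: "real (card {v \<in> U'. gap u v \<le> 2 * 2 ^ k}) \<le> 5 ^ d * 2 powr (real d * real k)" for u k
    proof -
      have "card {v \<in> U'. gap u v \<le> 2 * 2 ^ k} \<le> card {v :: int ^ 'd. gap u v \<le> 2 * 2 ^ k}"
        by (rule card_mono) (auto intro: finite_gap_ball)
      also have "\<dots> = (2 * (2 * 2 ^ k) + 1) ^ d" unfolding d_def by (rule card_gap_ball)
      also have "\<dots> \<le> (5 * 2 ^ k) ^ d" by (intro power_mono) auto
      finally have "real (card {v \<in> U'. gap u v \<le> 2 * 2 ^ k}) \<le> real ((5 * 2 ^ k) ^ d)" by (rule of_nat_mono)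
      also have "real ((5 * 2 ^ k) ^ d) = 5 ^ d * 2 powr real (d * k)"
        unfolding two_powr_nat by (simp add: power_mult_distrib power_mult[symmetric] mult.commute)
      finally show ?thesis by simp
    qed
    have "(\<Sum>u\<in>Q. \<Sum>v\<in>U'. H (floor_log (gap u v)))
        \<le> (\<Sum>u\<in>Q. \<Sum>v\<in>U'. \<Sum>k\<le>m. if depth l u \<le> 2 * 2 ^ k \<and> gap u v \<le> 2 * 2 ^ k then H k else 0)"
    proof (intro sum_mono)
      fix u v assume uv: "u \<in> Q" "v \<in> U'"
      define k where "k = floor_log (gap u v)"
      have "gap u v \<le> 2 * 2 ^ k" unfolding k_def by (rule floor_log_exp2_ge)
      moreover have "depth l u \<le> gap u v"
        using uv by (intro gap_ge_depth[OF l]) (auto simp: Q_def U'_def)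
      ultimately have "H k = (\<Sum>k\<in>{k}. if depth l u \<le> 2 * 2 ^ k \<and> gap u v \<le> 2 * 2 ^ k then H k else 0)" by simp
      also have "\<dots> \<le> (\<Sum>k\<le>m. if depth l u \<le> 2 * 2 ^ k \<and> gap u v \<le> 2 * 2 ^ k then H k else 0)"
        using mle[OF uv] H0 by (intro sum_mono2) (auto simp: k_def)
      finally show "H (floor_log (gap u v)) \<le> (\<Sum>k\<le>m. if depth l u \<le> 2 * 2 ^ k \<and> gap u v \<le> 2 * 2 ^ k then H k else 0)"
        by (simp add: k_def)
    qed
    also have "\<dots> = (\<Sum>k\<le>m. \<Sum>u\<in>Q. \<Sum>v\<in>U'. if depth l u \<le> 2 * 2 ^ k \<and> gap u v \<le> 2 * 2 ^ k then H k else 0)"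
      by (subst sum.swap[of _ "{..m}"], intro sum.cong refl sum.swap)
    also have "\<dots> \<le> (\<Sum>k\<le>m. H k * real (c k) * (5 ^ d * 2 powr (real d * real k)))"
    proof (rule sum_mono)
      fix k
      have "(\<Sum>u\<in>Q. \<Sum>v\<in>U'. if depth l u \<le> 2 * 2 ^ k \<and> gap u v \<le> 2 * 2 ^ k then H k else 0)
         = (\<Sum>u\<in>Q. if depth l u \<le> 2 * 2 ^ k then H k * real (card {v \<in> U'. gap u v \<le> 2 * 2 ^ k}) else 0)"
        using finU by (intro sum.cong refl) (auto simp: sum.If_cases Int_def mult.commute)
      also have "\<dots> \<le> (\<Sum>u\<in>Q. if depth l u \<le> 2 * 2 ^ k then H k * (5 ^ d * 2 powr (real d * real k)) else 0)"
        using ball H0 by (intro sum_mono) (auto intro!: mult_left_mono)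
      also have "\<dots> = H k * real (c k) * (5 ^ d * 2 powr (real d * real k))"
        using finQ by (simp add: sum.If_cases c_def Q_def Collect_conj_eq Int_commute)
      finally show "(\<Sum>u\<in>Q. \<Sum>v\<in>U'. if depth l u \<le> 2 * 2 ^ k \<and> gap u v \<le> 2 * 2 ^ k then H k else 0)
        \<le> H k * real (c k) * (5 ^ d * 2 powr (real d * real k))" .
    qed
    also have "\<dots> \<le> (\<Sum>k\<le>\<kappa>. H k * real (c k) * (5 ^ d * 2 powr (real d * real k)))
        + (\<Sum>k=\<kappa>..m. H k * real (c k) * (5 ^ d * 2 powr (real d * real k)))"
    proof -
      define T where "T k = H k * real (c k) * (5 ^ d * 2 powr (real d * real k))" for k
      have T0: "T k \<ge> 0" for k using H0 by (simp add: T_def)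
      have "{..m} = {..\<kappa>} \<union> {\<kappa><..m}" using mk by auto
      then have "sum T {..m} = sum T {..\<kappa>} + sum T {\<kappa><..m}"
        using sum.union_disjoint[of "{..\<kappa>}" "{\<kappa><..m}" T] by (simp add: ivl_disj_int)
      also have "sum T {\<kappa><..m} \<le> sum T {\<kappa>..m}" using T0 by (intro sum_mono2) auto
      finally show ?thesis by (simp add: T_def)
    qed
    also have "(\<Sum>k\<le>\<kappa>. H k * real (c k) * (5 ^ d * 2 powr (real d * real k)))
        \<le> 5 ^ d * (4 * real d) * (real l ^ (d - 1) * geo x J \<kappa>)"
    proof -
      have "H k * real (c k) * (5 ^ d * 2 powr (real d * real k))
         \<le> 5 ^ d * (4 * real d) * (real l ^ (d - 1) * (2 powr (x * real k) * real (k + 1) ^ J))"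
        if "k \<le> \<kappa>" for k
      proof -
        have "H k * real (c k) * (5 ^ d * 2 powr (real d * real k))
          \<le> H k * (4 * real d * real l ^ (d - 1) * 2 powr real k) * (5 ^ d * 2 powr (real d * real k))"
          using H0 by (intro mult_left_mono mult_right_mono c1) auto
        also have "\<dots> = 5 ^ d * (4 * real d) * (real l ^ (d - 1) * ((2 powr (- real d * a * real k)
            * 2 powr (real d * e * real k) * 2 powr real k * 2 powr (real d * real k)) * real (k + 1) ^ J))"
          using that by (simp add: H_def mult_ac min_absorb1)
        also have "2 powr (- real d * a * real k) * 2 powr (real d * e * real k) * 2 powr real k * 2 powr (real d * real k)
           = 2 powr (x * real k)"
          by (simp add: powr_add[symmetric] x_def algebra_simps)
        finally show ?thesis .
      qed
      then have "(\<Sum>k\<le>\<kappa>. H k * real (c k) * (5 ^ d * 2 powr (real d * real k)))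
         \<le> (\<Sum>k\<le>\<kappa>. 5 ^ d * (4 * real d) * (real l ^ (d - 1) * (2 powr (x * real k) * real (k + 1) ^ J)))"
        by (intro sum_mono) auto
      then show ?thesis by (simp add: geo_def sum_distrib_left)
    qed
    also have "(\<Sum>k=\<kappa>..m. H k * real (c k) * (5 ^ d * 2 powr (real d * real k)))
        \<le> 5 ^ d * (2 * S) * (real l ^ (d - 1) * geo x J \<kappa>)"
    proof -
      define P where "P = real l ^ (d - 1) * 2 powr real \<kappa> * 2 powr (real d * e * real \<kappa>) * real (\<kappa> + 1) ^ J"
      have P0: "P \<ge> 0" by (simp add: P_def)
      have "H k * real (c k) * (5 ^ d * 2 powr (real d * real k)) \<le> 5 ^ d * 2 * P * 2 powr (y * real k)"
        if "k \<ge> \<kappa>" for k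
      proof -
        have "H k * real (c k) * (5 ^ d * 2 powr (real d * real k))
          \<le> H k * (real l ^ (d - 1) * (2 * 2 powr real \<kappa>)) * (5 ^ d * 2 powr (real d * real k))"
          using H0 by (intro mult_left_mono mult_right_mono c2) auto
        also have "\<dots> = 5 ^ d * 2 * P * (2 powr (- real d * a * real k) * 2 powr (real d * real k))"
          using that by (simp add: H_def P_def mult_ac min_absorb2)
        also have "2 powr (- real d * a * real k) * 2 powr (real d * real k) = 2 powr (y * real k)"
          by (simp add: powr_add[symmetric] y_def algebra_simps)
        finally show ?thesis .
      qed
      then have "(\<Sum>k=\<kappa>..m. H k * real (c k) * (5 ^ d * 2 powr (real d * real k)))
         \<le> (\<Sum>k=\<kappa>..m. 5 ^ d * 2 * P * 2 powr (y * real k))"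
        by (intro sum_mono) auto
      also have "\<dots> = 5 ^ d * 2 * P * (2 powr (y * real \<kappa>) * (\<Sum>k\<le>m - \<kappa>. 2 powr (y * real k)))"
        unfolding sum_distrib_left sum.atLeastAtMost_shift_0[OF mk] atMost_atLeast0
        by (intro sum.cong) (auto simp: powr_add algebra_simps)
      also have "\<dots> \<le> 5 ^ d * 2 * P * (2 powr (y * real \<kappa>) * S)"
        unfolding S_def using P0 by (intro mult_left_mono sum_geometric_le y) auto
      also have "\<dots> = 5 ^ d * (2 * S) * (real l ^ (d - 1) * ((2 powr real \<kappa> * 2 powr (y * real \<kappa>)
          * 2 powr (real d * e * real \<kappa>)) * real (\<kappa> + 1) ^ J))"
        by (simp add: P_def mult_ac)
      also have "2 powr real \<kappa> * 2 powr (y * real \<kappa>) * 2 powr (real d * e * real \<kappa>) = 2 powr (x * real \<kappa>)"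
        by (simp add: powr_add[symmetric] x_def y_def algebra_simps)
      \<comment> \<open>The whole tail has the order of the term at scale \<kappa>, which is the
        last one of the sum below that scale.\<close>
      also have "2 powr (x * real \<kappa>) * real (\<kappa> + 1) ^ J \<le> geo x J \<kappa>"
        unfolding geo_def by (rule member_le_sum) auto
      finally show ?thesis using S by (simp add: mult_left_mono)
    qed
    finally have "(\<Sum>u\<in>Q. \<Sum>v\<in>U'. H (floor_log (gap u v))) \<le> C' * (real l ^ (d - 1) * geo x J \<kappa>)"
      by (simp add: C'_def algebra_simps)
    also have "\<dots> \<le> C' * (C * real l powr (real d * \<zeta>) * real (floor_log l + 1) ^ \<mu>)"
      unfolding \<kappa>_def using C' by (intro mult_left_mono C l) auto
    finally show ?thesis by (simp add: Q_def U'_def H_def \<kappa>_def mult.assoc)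
  qed
  then show ?thesis using C(1) C' by (intro exI[of _ "C' * C"]) auto
qed

section \<open>The exponents\<close>

text \<open>The exponent of the edges is compared with \<open>zll\<close> if the sum over the larger
  mark does not grow (\<open>y \<le> 0\<close>), with \<open>zhl\<close> if only the larger mark
  contributes growth, and with \<open>zhh\<close> if both marks do. A vanishing \<open>x\<close> or
  \<open>y\<close> makes two of these values coincide, so that each logarithm is paid for by a unit
  of \<mu>. In the regimes where such a comparison fails the exponent is negative, hence admissible
  because \<zeta> is nonnegative.\<close>

lemma admissible_exponents:
  fixes a t s :: real and d :: nat
  assumes a: "a > 1" and t: "t > 1" and s: "s \<ge> 0" and d: "d \<ge> 1"
  defines "zll \<equiv> 2 - a" and "zhl \<equiv> t / a - (t - 1)"
    and "zhh \<equiv> (if t \<le> s + 1 then (s + 1 - t) / (s + 1 - t / a) else (s + 1 - t) / (s + 1))"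
    and "zsh \<equiv> (real d - 1) / real d"
  defines "\<zeta> \<equiv> max (max zll zhl) (max zhh zsh)"
  defines "\<mu> \<equiv> of_bool (zll = \<zeta>) + of_bool (zhl = \<zeta>) + of_bool (zhh = \<zeta>) + of_bool (zsh = \<zeta>) - 1 :: nat"
  defines "\<gamma> \<equiv> (1 - max zhl zhh) / t"
  defines "x \<equiv> a * s - t"
  defines "y \<equiv> a - t + max x 0"
  defines "J \<equiv> (if y < 0 then 0 else (if y = 0 then 1 else 0) + (if x = 0 then 1 else 0)) :: nat"
  shows "\<gamma> > 0" "\<gamma> * (s + 1) \<le> 1" "admissible d \<zeta> \<mu> (1 - \<gamma> * t) 0"
    "admissible d \<zeta> \<mu> (2 - a + \<gamma> * max y 0) J"
proof -
  define c3 where "c3 = of_bool (zll = \<zeta>) + of_bool (zhl = \<zeta>) + (of_bool (zhh = \<zeta>) :: nat)"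
  have sh0: "zsh \<ge> 0" using d by (simp add: zsh_def)
  have \<zeta>0: "\<zeta> \<ge> 0" using sh0 by (simp add: \<zeta>_def)
  \<comment> \<open>The \<open>- 1\<close> in \<mu> takes one coincidence away from the first three
    exponents. The fourth summand of \<mu>, for the surface exponent, is exactly the additional
    logarithm asked for by \<open>admissible\<close>.\<close>
  have adm: "admissible d \<zeta> \<mu> \<eta> j" if "\<eta> \<le> \<zeta>" "\<eta> = \<zeta> \<Longrightarrow> j + 1 \<le> c3" for \<eta> j
    using that unfolding admissible_def \<mu>_def c3_def zsh_def[symmetric] by (cases "\<eta> = \<zeta>") auto
  have adm_neg: "admissible d \<zeta> \<mu> \<eta> j" if "\<eta> < 0" for \<eta> j
    using that \<zeta>0 by (simp add: admissible_def)
  define D where "D = s + 1 - t / a"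
  have D: "D > 0" if "t \<le> s + 1"
  proof -
    have "t / a < t" using a t by (simp add: field_simps)
    then show ?thesis using that by (simp add: D_def)
  qed
  have hl: "1 - zhl = t * (1 - 1 / a)" by (simp add: zhl_def field_simps)
  have g1: "\<gamma> \<le> 1 - 1 / a"
  proof -
    have "1 - max zhl zhh \<le> t * (1 - 1 / a)" unfolding hl[symmetric] by simp
    then show ?thesis using t by (simp add: \<gamma>_def divide_le_eq mult.commute)
  qed
  have hh1: "1 - zhh = t * ((1 - 1 / a) / D)" if "t \<le> s + 1"
  proof -
    have "1 - zhh = (D - (s + 1 - t)) / D"
      using that D[OF that] by (simp add: zhh_def D_def[symmetric] diff_divide_distrib)
    also have "D - (s + 1 - t) = t * (1 - 1 / a)" by (simp add: D_def algebra_simps)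
    finally show ?thesis by simp
  qed
  have g2: "\<gamma> \<le> (1 - 1 / a) / D" if "t \<le> s + 1"
  proof -
    have "1 - max zhl zhh \<le> t * ((1 - 1 / a) / D)" unfolding hh1[OF that, symmetric] by simp
    then show ?thesis using t by (simp add: \<gamma>_def divide_le_eq mult.commute)
  qed
  have hh2: "1 - zhh = t * (1 / (s + 1))" if "t > s + 1"
    using that s by (simp add: zhh_def field_simps)
  have g3: "\<gamma> \<le> 1 / (s + 1)" if "t > s + 1"
  proof -
    have "1 - max zhl zhh \<le> t * (1 / (s + 1))" unfolding hh2[OF that, symmetric] by simp
    then show ?thesis using t by (simp add: \<gamma>_def divide_le_eq mult.commute)
  qed
  show gpos: "\<gamma> > 0"
  proof -
    have "t * (1 - 1 / a) > 0" using a t by simp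
    moreover have "1 - zhh > 0"
    proof (cases "t \<le> s + 1")
      case True
      then show ?thesis unfolding hh1[OF True] using D[OF True] a t by simp
    next
      case False
      then show ?thesis using hh2 s t by simp
    qed
    ultimately show ?thesis using hl t by (simp add: \<gamma>_def)
  qed
  show "\<gamma> * (s + 1) \<le> 1"
  proof (cases "t \<le> s + 1")
    case True
    have "(1 - 1 / a) * (s + 1) \<le> D"
    proof -
      have "D - (1 - 1 / a) * (s + 1) = (s + 1 - t) / a" by (simp add: D_def algebra_simps diff_divide_distrib add_divide_distrib)
      moreover have "(s + 1 - t) / a \<ge> 0" using True a by simp
      ultimately show ?thesis by linarith
    qed
    then have "(1 - 1 / a) / D * (s + 1) \<le> 1" using D[OF True] by (simp add: field_simps)
    moreover have "\<gamma> * (s + 1) \<le> (1 - 1 / a) / D * (s + 1)"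
      using g2[OF True] s by (intro mult_right_mono) auto
    ultimately show ?thesis by linarith
  next
    case False
    then have "\<gamma> * (s + 1) \<le> 1 / (s + 1) * (s + 1)" using g3 s by (intro mult_right_mono) auto
    then show ?thesis using s by simp
  qed
  have "1 - \<gamma> * t = max zhl zhh" using t by (simp add: \<gamma>_def)
  then show "admissible d \<zeta> \<mu> (1 - \<gamma> * t) 0"
    by (intro adm) (auto simp: c3_def \<zeta>_def max_def)
  have zle: "zll \<le> \<zeta>" "zhl \<le> \<zeta>" "zhh \<le> \<zeta>" by (auto simp: \<zeta>_def)
  have zhl_y: "2 - a + (1 - 1 / a) * (a - t) = zhl" using a by (simp add: zhl_def field_simps)
  have le_hl: "2 - a + \<gamma> * max y 0 \<le> zhl" if "y > 0" "y = a - t"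
  proof -
    have "\<gamma> * y \<le> (1 - 1 / a) * y" using g1 that by (intro mult_right_mono) auto
    then have "2 - a + \<gamma> * y \<le> zhl" using zhl_y that(2) by (smt (verit))
    then show ?thesis using that(1) by (simp add: max_def)
  qed
  show "admissible d \<zeta> \<mu> (2 - a + \<gamma> * max y 0) J"
  proof -
    consider "y < 0" | "x < 0" "y = 0" | "x < 0" "y > 0" | "x = 0" "y = 0" | "x = 0" "y > 0"
      | "x > 0" "y = 0" | "x > 0" "y > 0" by linarith
    then show ?thesis
    proof cases
      case 1
      then show ?thesis using zle by (intro adm) (auto simp: J_def c3_def zll_def)
    next
      case 2
      then have "t = a" by (simp add: y_def)
      then have "zhl = zll" using a by (simp add: zhl_def zll_def)
      then show ?thesis using 2 zle by (intro adm) (auto simp: J_def c3_def zll_def)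
    next
      case 3
      then have "y = a - t" by (simp add: y_def)
      then show ?thesis using 3 le_hl zle by (intro adm) (auto simp: J_def c3_def)
    next
      case 4
      \<comment> \<open>Two logarithms occur, so three exponents have to coincide: with
        \<open>t = a\<close> and \<open>s = 1\<close> all of \<open>zll\<close>, \<open>zhl\<close>
        and \<open>zhh\<close> agree as long as \<open>t\<close> is at most 2.\<close>
      then have ta: "t = a" by (simp add: y_def)
      with 4 have s1: "s = 1" using a by (simp add: x_def)
      show ?thesis
      proof (cases "t \<le> 2")
        case True
        have "zhl = zll" "zhh = zll" using a ta s1 True by (auto simp: zhl_def zll_def zhh_def)
        then show ?thesis using 4 zle by (intro adm) (auto simp: J_def c3_def zll_def)
      next
        case False
        then show ?thesis using 4 ta by (intro adm_neg) simp
      qed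
    next
      case 5
      then have y: "y = a - t" by (simp add: y_def)
      have sa: "t / a = s" using 5 a by (simp add: x_def field_simps)
      have zhl: "zhl = s + 1 - t" by (simp add: zhl_def sa)
      show ?thesis
      proof (cases "t \<le> s + 1")
        case True
        have "zhh = zhl" using True zhl by (simp add: zhh_def sa)
        then show ?thesis using 5 y le_hl zle by (intro adm) (auto simp: J_def c3_def)
      next
        case False
        then show ?thesis using le_hl[OF 5(2) y] zhl by (intro adm_neg) simp
      qed
    next
      case 6
      then have y: "t + t = a * (s + 1)" by (simp add: y_def x_def algebra_simps)
      show ?thesis
      proof (cases "t \<le> s + 1")
        case True
        have s1: "s + 1 = 2 * t / a" using y a by (simp add: field_simps)
        have "zhh = (2 * t / a - t) / (t / a)" unfolding zhh_def using True by (simp add: s1)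
        also have "\<dots> = zll" using a t by (simp add: zll_def field_simps)
        finally show ?thesis using 6 zle by (intro adm) (auto simp: J_def c3_def zll_def)
      next
        case False
        then have "2 * (s + 1) < a * (s + 1)" using y by simp
        then have "a > 2" by (rule mult_right_less_imp_less) (use s in simp)
        then show ?thesis using 6 by (intro adm_neg) simp
      qed
    next
      case 7
      then have y: "y = a * (s + 1) - 2 * t" by (simp add: y_def x_def algebra_simps)
      show ?thesis
      proof (cases "t \<le> s + 1")
        case True
        have yD: "y = a * D - t" using a by (simp add: y D_def field_simps)
        have "\<gamma> * y \<le> (1 - 1 / a) / D * y" using g2[OF True] 7 by (intro mult_right_mono) auto
        also have "(1 - 1 / a) / D * y = a - 1 - (1 - zhh)"
          unfolding hh1[OF True] yD using D[OF True] a by (simp add: field_simps)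
        finally have "2 - a + \<gamma> * max y 0 \<le> zhh" using 7 by simp
        then show ?thesis using 7 zle by (intro adm) (auto simp: J_def c3_def)
      next
        case False
        have "\<gamma> * y \<le> 1 / (s + 1) * y" using g3 False 7 by (intro mult_right_mono) auto
        also have "\<dots> = a - 2 * t / (s + 1)" using s by (simp add: y field_simps)
        also have "\<dots> < a - 2" using False s by (simp add: field_simps)
        finally show ?thesis using 7 by (intro adm_neg) simp
      qed
    qed
  qed
qed

section \<open>Components, marks and edges\<close>

abbreviation seq_space :: "(nat \<Rightarrow> 'a::topological_space) measure" where
  "seq_space \<equiv> Pi\<^sub>M UNIV (\<lambda>_. borel)"

text \<open>All pairs of levels reached by the two marks contribute, not only the pair of their
  exact dyadic classes. Each term is then a product of two one-sided events, whose probabilities are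
  plain tails, and for nonnegative coefficients the sum is at least the coefficient of the exact
  pair.\<close>

abbreviation thresholds :: "(nat \<Rightarrow> nat \<Rightarrow> real) \<Rightarrow> nat \<Rightarrow> real \<Rightarrow> real \<Rightarrow> real" where
  "thresholds C K w w' \<equiv>
    \<Sum>k\<le>K. \<Sum>m\<le>K. C k m * indicator {w. 2 ^ k \<le> w} w * indicator {w. 2 ^ m \<le> w} w'"

text \<open>The label \<open>c\<close> is constant along paths, so each component lies in one label
  class. The labels are the cells in the main case; a constant label turns a bound on the number of
  vertices into one on the components.\<close>

lemma largest_component_size_less:
  assumes fin: "finite S" and x: "x > 0"
    and sep: "\<And>i j. i \<in> S \<Longrightarrow> j \<in> S \<Longrightarrow> {i, j} \<in> E \<Longrightarrow> c i = c j"
    and small: "\<And>i. i \<in> S \<Longrightarrow> real (card {j \<in> S. c j = c i}) < x"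
  shows "real (largest_component_size E S) < x"
proof -
  define R where "R = {(x, y). x \<in> S \<and> y \<in> S \<and> {x, y} \<in> E}"
  have reach: "v \<in> S \<and> c v = c u" if "u \<in> S" "(u, v) \<in> R\<^sup>*" for u v
    using that(2,1) by (induction rule: rtrancl_induct) (auto simp: R_def dest: sep)
  have comps: "components_within E S = S // {(u, v). u \<in> S \<and> (u, v) \<in> R\<^sup>*}"
    by (simp add: components_within_def R_def)
  have cl: "real (card C) < x" if C: "C \<in> components_within E S" for C
  proof -
    obtain u where u: "u \<in> S" "C = {(u, v). u \<in> S \<and> (u, v) \<in> R\<^sup>*} `` {u}"
      using C unfolding comps by (elim quotientE) (rule that)
    have "C \<subseteq> {j \<in> S. c j = c u}"
    proof
      fix v assume "v \<in> C"
      then have "(u, v) \<in> R\<^sup>*" unfolding u(2) by simp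
      then show "v \<in> {j \<in> S. c j = c u}" using reach[OF u(1)] by blast
    qed
    then have "card C \<le> card {j \<in> S. c j = c u}" using fin by (intro card_mono) auto
    then show ?thesis using small[OF u(1)] by linarith
  qed
  have "finite (components_within E S)"
    unfolding comps quotient_def using fin by auto
  then have "largest_component_size E S \<in> insert 0 (card ` components_within E S)"
    unfolding largest_component_size_def by (intro Max_in) auto
  then show ?thesis using cl x by auto
qed

text \<open>For measurability: only the edges within \<open>S\<close> matter, and these are finitely
  many for finite \<open>S\<close>.\<close>

lemma largest_component_size_restrict:
  "largest_component_size E S = largest_component_size (E \<inter> {{i, j} | i j. i \<in> S \<and> j \<in> S}) S"
proof -
  have "{(x, y). x \<in> S \<and> y \<in> S \<and> {x, y} \<in> E} =
      {(x, y). x \<in> S \<and> y \<in> S \<and> {x, y} \<in> E \<inter> {{i, j} | i j. i \<in> S \<and> j \<in> S}}" by auto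
  then show ?thesis by (simp add: largest_component_size_def components_within_def)
qed

text \<open>Jensen's inequality for the measure with density \<open>Y\<close>. Using the tangent of
  the exponential function at \<open>- m\<close> avoids normalising that measure, so
  \<open>Y\<close> may have expectation 0.\<close>

lemma (in prob_space) exp_jensen_event:
  fixes Y S :: "'a \<Rightarrow> real"
  assumes Y: "Y \<in> borel_measurable M" "\<And>\<omega>. \<omega> \<in> space M \<Longrightarrow> 0 \<le> Y \<omega> \<and> Y \<omega> \<le> 1"
    and S: "S \<in> borel_measurable M" "\<And>\<omega>. \<omega> \<in> space M \<Longrightarrow> 0 \<le> S \<omega>"
    and int: "integrable M (\<lambda>\<omega>. Y \<omega> * S \<omega>)"
    and le: "expectation (\<lambda>\<omega>. Y \<omega> * S \<omega>) \<le> expectation Y * m"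
  shows "expectation Y * exp (- m) \<le> expectation (\<lambda>\<omega>. Y \<omega> * exp (- S \<omega>))"
proof -
  have intY: "integrable M Y"
    using Y by (intro integrable_const_bound[of _ 1]) auto
  have intE: "integrable M (\<lambda>\<omega>. Y \<omega> * exp (- S \<omega>))"
    using Y S by (intro integrable_const_bound[of _ 1]) (auto simp: abs_mult intro!: mult_le_one)
  have "expectation Y * exp (- m) \<le> exp (- m) * ((1 + m) * expectation Y - expectation (\<lambda>\<omega>. Y \<omega> * S \<omega>))"
    using le by (simp add: algebra_simps)
  also have "\<dots> = expectation (\<lambda>\<omega>. exp (- m) * ((1 + m) * Y \<omega> - Y \<omega> * S \<omega>))"
    using intY int by simp
  also have "\<dots> \<le> expectation (\<lambda>\<omega>. Y \<omega> * exp (- S \<omega>))"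
  proof (rule integral_mono)
    fix \<omega> assume w: "\<omega> \<in> space M"
    have "1 + (m - S \<omega>) \<le> exp (m - S \<omega>)" by (rule exp_ge_add_one_self)
    then have "Y \<omega> * exp (- m) * (1 + (m - S \<omega>)) \<le> Y \<omega> * exp (- m) * exp (m - S \<omega>)"
      using Y(2)[OF w] by (intro mult_left_mono) auto
    also have "\<dots> = Y \<omega> * exp (- S \<omega>)" by (simp add: exp_add[symmetric] mult.assoc)
    finally show "exp (- m) * ((1 + m) * Y \<omega> - Y \<omega> * S \<omega>) \<le> Y \<omega> * exp (- S \<omega>)"
      by (simp add: algebra_simps)
  qed (use intY int intE in auto)
  finally show ?thesis .
qed

text \<open>By independence, raising the lower bounds at \<open>i\<close> and \<open>j\<close>
  changes just two factors of the product. Each is at least \<pi> before and at most the tail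
  afterwards, which gives the ratio \<open>A * B / \<pi>\<^sup>2\<close>.\<close>

lemma (in prob_space) prob_marks_two_lower_bounds:
  fixes W :: "nat \<Rightarrow> 'a \<Rightarrow> real"
  assumes indep: "indep_vars (\<lambda>_. borel) W UNIV"
    and I: "finite I" "i \<in> I" "j \<in> I" "i \<noteq> j"
    and \<pi>: "\<pi> > 0" "\<And>u. u \<in> I \<Longrightarrow> \<pi> \<le> prob {\<omega> \<in> space M. 1 \<le> W u \<omega> \<and> W u \<omega> \<le> b u}"
    and A: "prob {\<omega> \<in> space M. x \<le> W i \<omega>} \<le> A" and B: "prob {\<omega> \<in> space M. y \<le> W j \<omega>} \<le> B"
  shows "prob {\<omega> \<in> space M. (\<forall>u\<in>I. 1 \<le> W u \<omega> \<and> W u \<omega> \<le> b u) \<and> x \<le> W i \<omega> \<and> y \<le> W j \<omega>}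
    \<le> A * B / \<pi>\<^sup>2 * prob {\<omega> \<in> space M. \<forall>u\<in>I. 1 \<le> W u \<omega> \<and> W u \<omega> \<le> b u}"
proof -
  have rv [measurable]: "random_variable borel (W u)" for u
    using indep by (auto simp: indep_vars_def)
  define P where "P u = prob {\<omega> \<in> space M. 1 \<le> W u \<omega> \<and> W u \<omega> \<le> b u}" for u
  define T where "T u = (if u = i then {max 1 x..b u} else if u = j then {max 1 y..b u} else {1..b u})" for u
  have I0: "I \<noteq> {}" using I by auto
  have all: "prob {\<omega> \<in> space M. \<forall>u\<in>I. W u \<omega> \<in> D u} = (\<Prod>u\<in>I. prob {\<omega> \<in> space M. W u \<omega> \<in> D u})"
    if "\<And>u. D u \<in> sets borel" for D :: "nat \<Rightarrow> real set"
  proof -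
    have "{\<omega> \<in> space M. \<forall>u\<in>I. W u \<omega> \<in> D u} = (\<Inter>u\<in>I. W u -` D u \<inter> space M)" using I0 by auto
    moreover have "{\<omega> \<in> space M. W u \<omega> \<in> D u} = W u -` D u \<inter> space M" for u by auto
    ultimately show ?thesis using indep_varsD[OF indep I0 I(1), of D] that by simp
  qed
  have A0: "A \<ge> 0" "B \<ge> 0" using A B measure_nonneg order_trans by blast+
  define F where "F u = (if u = i then A / \<pi> else if u = j then B / \<pi> else 1)" for u
  have "prob {\<omega> \<in> space M. (\<forall>u\<in>I. 1 \<le> W u \<omega> \<and> W u \<omega> \<le> b u) \<and> x \<le> W i \<omega> \<and> y \<le> W j \<omega>}
     = prob {\<omega> \<in> space M. \<forall>u\<in>I. W u \<omega> \<in> T u}"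
    using I by (intro arg_cong[where f = prob]) (auto simp: T_def)
  also have "\<dots> = (\<Prod>u\<in>I. prob {\<omega> \<in> space M. W u \<omega> \<in> T u})" by (rule all) (simp add: T_def)
  also have "\<dots> \<le> (\<Prod>u\<in>I. F u * P u)"
  proof (rule prod_mono)
    fix u assume u: "u \<in> I"
    have Pu: "\<pi> \<le> P u" using \<pi>(2)[OF u] by (simp add: P_def)
    have key: "prob {\<omega> \<in> space M. W u \<omega> \<in> T u} \<le> C / \<pi> * P u"
      if "T u \<subseteq> {z..}" "prob {\<omega> \<in> space M. z \<le> W u \<omega>} \<le> C" "C \<ge> 0" for z C
    proof -
      have "prob {\<omega> \<in> space M. W u \<omega> \<in> T u} \<le> prob {\<omega> \<in> space M. z \<le> W u \<omega>}"
        using that(1) by (intro finite_measure_mono) auto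
      also have "\<dots> \<le> C" by (rule that(2))
      also have "C \<le> C / \<pi> * P u" using that(3) \<pi>(1) Pu by (simp add: field_simps mult_left_mono)
      finally show ?thesis .
    qed
    have "prob {\<omega> \<in> space M. W u \<omega> \<in> T u} \<le> F u * P u"
    proof -
      consider "u = i" | "u = j" | "u \<noteq> i" "u \<noteq> j" by blast
      then show ?thesis
      proof cases
        case 1
        then show ?thesis using key[of x A] A A0 by (auto simp: T_def F_def)
      next
        case 2
        then show ?thesis using key[of y B] B A0 I(4) by (auto simp: T_def F_def)
      next
        case 3
        then show ?thesis by (simp add: F_def T_def P_def)
      qed
    qed
    then show "0 \<le> prob {\<omega> \<in> space M. W u \<omega> \<in> T u} \<and> prob {\<omega> \<in> space M. W u \<omega> \<in> T u} \<le> F u * P u"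
      by (simp add: measure_nonneg)
  qed
  also have "\<dots> = (\<Prod>u\<in>I. F u) * (\<Prod>u\<in>I. P u)" by (rule prod.distrib)
  also have "(\<Prod>u\<in>I. F u) = A / \<pi> * (B / \<pi>)"
  proof -
    have "(\<Prod>u\<in>I. F u) = F i * (\<Prod>u\<in>I - {i}. F u)" using I by (intro prod.remove) auto
    also have "(\<Prod>u\<in>I - {i}. F u) = F j * (\<Prod>u\<in>I - {i} - {j}. F u)" using I by (intro prod.remove) auto
    also have "(\<Prod>u\<in>I - {i} - {j}. F u) = 1" by (rule prod.neutral) (auto simp: F_def)
    finally show ?thesis using I(4) by (simp add: F_def)
  qed
  also have "(\<Prod>u\<in>I. P u) = prob {\<omega> \<in> space M. \<forall>u\<in>I. W u \<omega> \<in> {1..b u}}"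
    by (subst all) (auto simp: P_def)
  finally show ?thesis by (simp add: power2_eq_square)
qed

text \<open>The pair interaction is a combination of products of threshold indicators, so that its
  expectation factorizes although the kernel does not.\<close>

lemma (in prob_space) marks_lower_bound:
  fixes W :: "nat \<Rightarrow> 'a \<Rightarrow> real" and K :: "nat \<Rightarrow> nat \<Rightarrow> nat"
    and C :: "nat \<Rightarrow> nat \<Rightarrow> nat \<Rightarrow> nat \<Rightarrow> real"
  assumes indep: "indep_vars (\<lambda>_. borel) W UNIV"
    and I: "finite I"
    and F: "finite F" "\<And>i j. (i, j) \<in> F \<Longrightarrow> i \<in> I \<and> j \<in> I \<and> i \<noteq> j"
    and \<pi>: "\<pi> > 0" "\<And>u. u \<in> I \<Longrightarrow> \<pi> \<le> prob {\<omega> \<in> space M. 1 \<le> W u \<omega> \<and> W u \<omega> \<le> b u}"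
    and g: "\<And>u. u \<in> I \<Longrightarrow> exp (- g u) \<le> prob {\<omega> \<in> space M. 1 \<le> W u \<omega> \<and> W u \<omega> \<le> b u}"
    and tail: "\<And>u x. x \<ge> 1 \<Longrightarrow> prob {\<omega> \<in> space M. x \<le> W u \<omega>} \<le> x powr (- t)"
    and C: "\<And>i j k m. C i j k m \<ge> 0"
  shows "exp (- (\<Sum>u\<in>I. g u) - (\<Sum>(i, j)\<in>F. \<Sum>k\<le>K i j. \<Sum>m\<le>K i j. C i j k m * 2 powr (- t * real (k + m)) / \<pi>\<^sup>2))
    \<le> expectation (\<lambda>\<omega>. indicator {\<omega> \<in> space M. \<forall>u\<in>I. 1 \<le> W u \<omega> \<and> W u \<omega> \<le> b u} \<omega> *
        exp (- (\<Sum>(i, j)\<in>F. \<Sum>k\<le>K i j. \<Sum>m\<le>K i j. C i j k m *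
          indicator {w. 2 ^ k \<le> w} (W i \<omega>) * indicator {w. 2 ^ m \<le> w} (W j \<omega>))))"
proof -
  have rv [measurable]: "random_variable borel (W u)" for u
    using indep by (auto simp: indep_vars_def)
  have fin_all: "Measurable.pred M (\<lambda>\<omega>. \<forall>u\<in>I. 1 \<le> W u \<omega> \<and> W u \<omega> \<le> b u)"
    by (intro pred_intros_finite I) measurable
  define G where "G = {\<omega> \<in> space M. \<forall>u\<in>I. 1 \<le> W u \<omega> \<and> W u \<omega> \<le> b u}"
  have G [measurable]: "G \<in> events" unfolding G_def using fin_all by measurable
  define H where "H i j k m \<omega> = indicator {w. 2 ^ k \<le> w} (W i \<omega>) * (indicator {w. 2 ^ m \<le> w} (W j \<omega>) :: real)" for i j k m \<omega>
  define S where "S \<omega> = (\<Sum>(i, j)\<in>F. \<Sum>k\<le>K i j. \<Sum>m\<le>K i j. C i j k m * H i j k m \<omega>)" for \<omega>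
  define s where "s = (\<Sum>(i, j)\<in>F. \<Sum>k\<le>K i j. \<Sum>m\<le>K i j. C i j k m * 2 powr (- t * real (k + m)) / \<pi>\<^sup>2)"
  have H [measurable]: "H i j k m \<in> borel_measurable M" for i j k m unfolding H_def by measurable
  have H01: "0 \<le> H i j k m \<omega>" "H i j k m \<omega> \<le> 1" for i j k m \<omega>
    by (auto simp: H_def indicator_def)
  have intH: "integrable M (\<lambda>\<omega>. indicator G \<omega> * H i j k m \<omega>)" for i j k m
    using H01 by (intro integrable_const_bound[of _ 1]) (auto simp: indicator_def)
  have EH: "expectation (\<lambda>\<omega>. indicator G \<omega> * H i j k m \<omega>) \<le> 2 powr (- t * real (k + m)) / \<pi>\<^sup>2 * prob G"
    if "(i, j) \<in> F" for i j k m
  proof -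
    have "expectation (\<lambda>\<omega>. indicator G \<omega> * H i j k m \<omega>)
      = expectation (indicator {\<omega> \<in> space M. (\<forall>u\<in>I. 1 \<le> W u \<omega> \<and> W u \<omega> \<le> b u) \<and> 2 ^ k \<le> W i \<omega> \<and> 2 ^ m \<le> W j \<omega>})"
      by (intro Bochner_Integration.integral_cong refl) (auto simp: G_def H_def indicator_def)
    also have "\<dots> = prob {\<omega> \<in> space M. (\<forall>u\<in>I. 1 \<le> W u \<omega> \<and> W u \<omega> \<le> b u) \<and> 2 ^ k \<le> W i \<omega> \<and> 2 ^ m \<le> W j \<omega>}"
      using fin_all by (subst Bochner_Integration.integral_indicator) (auto simp: Int_absorb2 emeasure_finite)
    also have "\<dots> \<le> (2 ^ k) powr (- t) * (2 ^ m) powr (- t) / \<pi>\<^sup>2 * prob G"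
      unfolding G_def using F(2)[OF that] by (intro prob_marks_two_lower_bounds indep I \<pi> tail) auto
    also have "(2 ^ k) powr (- t) * (2 ^ m) powr (- t) = 2 powr (- t * real (k + m))"
      by (simp add: powr_realpow[symmetric] powr_powr powr_add[symmetric] algebra_simps)
    finally show ?thesis .
  qed
  have S_eq: "indicator G \<omega> * S \<omega> = (\<Sum>(i, j)\<in>F. \<Sum>k\<le>K i j. \<Sum>m\<le>K i j. C i j k m * (indicator G \<omega> * H i j k m \<omega>))" for \<omega>
    unfolding S_def by (simp add: sum_distrib_left case_prod_unfold mult_ac)
  have ES: "expectation (\<lambda>\<omega>. indicator G \<omega> * S \<omega>) \<le> prob G * s"
  proof -
    have "expectation (\<lambda>\<omega>. indicator G \<omega> * S \<omega>)
      = (\<Sum>(i, j)\<in>F. \<Sum>k\<le>K i j. \<Sum>m\<le>K i j. C i j k m * expectation (\<lambda>\<omega>. indicator G \<omega> * H i j k m \<omega>))"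
      unfolding S_eq case_prod_unfold using intH by (simp add: Bochner_Integration.integral_sum)
    also have "\<dots> \<le> (\<Sum>(i, j)\<in>F. \<Sum>k\<le>K i j. \<Sum>m\<le>K i j. C i j k m * (2 powr (- t * real (k + m)) / \<pi>\<^sup>2 * prob G))"
      unfolding case_prod_unfold by (intro sum_mono mult_left_mono EH C) simp
    also have "\<dots> = prob G * s"
      unfolding s_def by (simp add: sum_distrib_left case_prod_unfold mult_ac)
    finally show ?thesis .
  qed
  have "prob G * exp (- s) \<le> expectation (\<lambda>\<omega>. indicator G \<omega> * exp (- S \<omega>))"
  proof -
    have EG: "expectation (indicator G) = prob G"
      using G by (subst Bochner_Integration.integral_indicator)
        (auto simp: Int_absorb2 emeasure_finite sets.sets_into_space)
    have "expectation (indicator G) * exp (- s) \<le> expectation (\<lambda>\<omega>. indicator G \<omega> * exp (- S \<omega>))"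
    proof (rule exp_jensen_event)
      show "S \<in> borel_measurable M" unfolding S_def case_prod_unfold by measurable
      show "0 \<le> S \<omega>" for \<omega> unfolding S_def case_prod_unfold
        using C H01 by (intro sum_nonneg mult_nonneg_nonneg) auto
      show "integrable M (\<lambda>\<omega>. indicator G \<omega> * S \<omega>)"
        unfolding S_eq case_prod_unfold using intH by auto
      show "expectation (\<lambda>\<omega>. indicator G \<omega> * S \<omega>) \<le> expectation (indicator G) * s"
        using ES EG by simp
    qed (auto simp: indicator_def)
    then show ?thesis using EG by simp
  qed
  moreover have "exp (- (\<Sum>u\<in>I. g u)) \<le> prob G"
  proof (cases "I = {}")
    case True
    then show ?thesis by (simp add: G_def prob_space)
  next
    case False
    have "exp (- (\<Sum>u\<in>I. g u)) = (\<Prod>u\<in>I. exp (- g u))"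
      using I by (simp add: exp_sum[symmetric] sum_negf)
    also have "\<dots> \<le> (\<Prod>u\<in>I. prob (W u -` {1..b u} \<inter> space M))"
    proof (rule prod_mono)
      fix u assume u: "u \<in> I"
      have "W u -` {1..b u} \<inter> space M = {\<omega> \<in> space M. 1 \<le> W u \<omega> \<and> W u \<omega> \<le> b u}" by auto
      then show "0 \<le> exp (- g u) \<and> exp (- g u) \<le> prob (W u -` {1..b u} \<inter> space M)"
        using g[OF u] by simp
    qed
    also have "\<dots> = prob (\<Inter>u\<in>I. W u -` {1..b u} \<inter> space M)"
      using False I by (intro indep_varsD[OF indep, symmetric]) auto
    also have "(\<Inter>u\<in>I. W u -` {1..b u} \<inter> space M) = G" using False by (auto simp: G_def)
    finally show ?thesis .
  qed
  ultimately have "exp (- (\<Sum>u\<in>I. g u)) * exp (- s) \<le> expectation (\<lambda>\<omega>. indicator G \<omega> * exp (- S \<omega>))"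
    by (meson exp_ge_zero mult_right_mono order_trans)
  then show ?thesis
    unfolding G_def S_def H_def s_def by (simp add: exp_add[symmetric] mult.assoc)
qed

lemma cube_measurable [measurable]: "cube \<in> borel \<rightarrow>\<^sub>M count_space UNIV"
proof (subst measurable_count_space_eq2_countable, safe)
  fix z :: "int ^ 'd"
  have "cube -` {z} \<inter> space borel = {x :: real ^ 'd. \<forall>i. \<lfloor>x $ i\<rfloor> = z $ i}"
    by (auto simp: cube_def vec_eq_iff)
  also have "\<dots> \<in> sets borel" by measurable
  finally show "cube -` {z} \<inter> space borel \<in> sets (borel :: (real ^ 'd) measure)" .
qed simp

lemma prod_one_minus_expand:
  fixes f :: "'b \<Rightarrow> real"
  assumes "finite A"
  shows "(\<Prod>x\<in>A. 1 - f x) = (\<Sum>T\<in>Pow A. (- 1) ^ card T * (\<Prod>x\<in>T. f x))"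
proof -
  have "(\<Prod>x\<in>A. 1 - f x) = (\<Prod>x\<in>A. - f x + 1)" by simp
  also have "\<dots> = (\<Sum>T\<in>Pow A. (\<Prod>x\<in>T. - f x) * (\<Prod>x\<in>A - T. 1))"
    by (rule prod_add[OF assms])
  finally show ?thesis by (simp add: prod_uminus)
qed

section \<open>Edges, locations and marks of the model\<close>

context kernel_spatial_random_graph
begin

definition edge_prob :: "nat \<Rightarrow> nat \<Rightarrow> 'a \<Rightarrow> real" where
  "edge_prob i j \<omega> = p * profile \<alpha>
     (\<beta> * kernel_fun CARD('d) K (W i \<omega>) (W j \<omega>) / norm (X i \<omega> - X j \<omega>) ^ CARD('d))"

definition locations_marks :: "'a measure" where
  "locations_marks =
     vimage_algebra (space M) (\<lambda>\<omega> i. (X i \<omega>, W i \<omega>)) seq_space"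

lemma mark_measurable [measurable]: "W i \<in> borel_measurable M"
  using marks_indep by (auto simp: indep_vars_def)

declare location_measurable [measurable]

lemma edge_event [measurable]: "Measurable.pred M (\<lambda>\<omega>. {i, j} \<in> E \<omega>)"
  unfolding pred_def by (rule edge_measurable)

lemma locations_marks_subalgebra: "subalgebra M locations_marks"
proof -
  have "(\<lambda>\<omega> i. (X i \<omega>, W i \<omega>)) \<in> M \<rightarrow>\<^sub>M seq_space"
    by (intro measurable_PiM_single') (auto simp: borel_prod[symmetric] space_pair_measure)
  then show ?thesis
    unfolding subalgebra_def locations_marks_def
    by (intro conjI sets_image_in_sets) auto
qed

lemma locations_marks_measurable:
  "X i \<in> borel_measurable locations_marks" "W i \<in> borel_measurable locations_marks"
proof -
  have seq: "(\<lambda>\<omega> i. (X i \<omega>, W i \<omega>)) \<in> locations_marks \<rightarrow>\<^sub>M seq_space"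
    unfolding locations_marks_def by (rule measurable_vimage_algebra1) (auto simp: space_PiM)
  have "(\<lambda>\<omega>. (X i \<omega>, W i \<omega>)) \<in> locations_marks \<rightarrow>\<^sub>M borel"
    using measurable_compose[OF seq measurable_component_singleton[of i UNIV]] by simp
  then have pair: "(\<lambda>\<omega>. (X i \<omega>, W i \<omega>)) \<in> locations_marks \<rightarrow>\<^sub>M borel \<Otimes>\<^sub>M borel"
    by (simp add: borel_prod)
  show "X i \<in> borel_measurable locations_marks" "W i \<in> borel_measurable locations_marks"
    using measurable_compose[OF pair measurable_fst] measurable_compose[OF pair measurable_snd] by simp_all
qed

sublocale info: finite_measure_subalgebra M locations_marks
  by unfold_locales (rule locations_marks_subalgebra)

text \<open>Inclusion-exclusion over the edges that are present turns the joint edge probabilities of the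
  model into a lower bound for the probability that no edge of a given set is present.\<close>

lemma no_edge_lower_bound:
  assumes F: "finite F" "F \<subseteq> {(i, j). i < j}" and B: "B \<in> sets locations_marks"
    and f: "f \<in> borel_measurable M" "\<And>\<omega>. \<omega> \<in> space M \<Longrightarrow> 0 \<le> f \<omega> \<and> f \<omega> \<le> 1"
    and le: "\<And>\<omega>. \<omega> \<in> B \<Longrightarrow> f \<omega> \<le> (\<Prod>(i, j)\<in>F. 1 - edge_prob i j \<omega>)"
  shows "expectation (\<lambda>\<omega>. indicator B \<omega> * f \<omega>)
    \<le> prob (B \<inter> {\<omega> \<in> space M. \<forall>(i, j)\<in>F. {i, j} \<notin> E \<omega>})"
proof -
  define ET where "ET T = {\<omega> \<in> space M. \<forall>(i, j)\<in>T. {i, j} \<in> E \<omega>}" for T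
  define R where "R T = real_cond_exp M locations_marks (indicator (ET T))" for T
  define N where "N = {\<omega> \<in> space M. \<forall>(i, j)\<in>F. {i, j} \<notin> E \<omega>}"
  have finT: "finite T" if "T \<in> Pow F" for T using F(1) that finite_subset by auto
  have BM [measurable]: "B \<in> events" using B locations_marks_subalgebra by (auto simp: subalgebra_def)
  have ET_meas: "ET T \<in> events" if "T \<in> Pow F" for T
    unfolding ET_def case_prod_unfold using finT[OF that]
    by (intro sets.sets_Collect_finite_All' edge_measurable sets.sets_Collect_finite_All) auto
  have N_meas [measurable]: "N \<in> events"
    unfolding N_def case_prod_unfold using F(1)
    by (intro sets.sets_Collect_finite_All sets.sets_Collect_neg edge_measurable) auto
  have R_meas: "R T \<in> borel_measurable M" if "T \<in> Pow F" for T
    unfolding R_def by simp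
  have int_ET: "integrable M (\<lambda>\<omega>. indicator B \<omega> * (indicator (ET T) \<omega> :: real))" if "T \<in> Pow F" for T
    using ET_meas[OF that] by (intro integrable_const_bound[of _ 1]) (auto simp: indicator_def)
  have R: "integrable M (\<lambda>\<omega>. indicator B \<omega> * R T \<omega>)"
    "expectation (\<lambda>\<omega>. indicator B \<omega> * R T \<omega>) = expectation (\<lambda>\<omega>. indicator B \<omega> * indicator (ET T) \<omega>)"
    if "T \<in> Pow F" for T
    unfolding R_def using info.real_cond_exp_intg[OF int_ET[OF that]] B ET_meas[OF that] by auto
  have N_expand: "indicator N \<omega> = (\<Sum>T\<in>Pow F. (- 1) ^ card T * (indicator (ET T) \<omega> :: real))"
    if w: "\<omega> \<in> space M" for \<omega>
  proof -
    define e where "e x = (of_bool ({fst x, snd x} \<in> E \<omega>) :: real)" for x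
    have "indicator N \<omega> = (\<Prod>x\<in>F. 1 - e x)"
    proof (cases "\<omega> \<in> N")
      case True
      then have "(\<Prod>x\<in>F. 1 - e x) = 1" by (intro prod.neutral) (auto simp: N_def e_def)
      then show ?thesis using True by simp
    next
      case False
      then obtain x where "x \<in> F" "1 - e x = 0" using w by (auto simp: N_def e_def)
      then have "(\<Prod>x\<in>F. 1 - e x) = 0" using F(1) by (intro prod_zero) auto
      then show ?thesis using False by simp
    qed
    also have "\<dots> = (\<Sum>T\<in>Pow F. (- 1) ^ card T * (\<Prod>x\<in>T. e x))"
      by (rule prod_one_minus_expand[OF F(1)])
    also have "\<dots> = (\<Sum>T\<in>Pow F. (- 1) ^ card T * indicator (ET T) \<omega>)"
    proof (intro sum.cong refl arg_cong2[where f = "(*)"])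
      fix T assume T: "T \<in> Pow F"
      show "(\<Prod>x\<in>T. e x) = indicator (ET T) \<omega>"
      proof (cases "\<omega> \<in> ET T")
        case True
        then have "(\<Prod>x\<in>T. e x) = 1" by (intro prod.neutral) (auto simp: ET_def e_def)
        then show ?thesis using True by simp
      next
        case False
        then obtain x where "x \<in> T" "e x = 0" using w by (auto simp: ET_def e_def)
        then have "(\<Prod>x\<in>T. e x) = 0" using finT[OF T] by (intro prod_zero) auto
        then show ?thesis using False by simp
      qed
    qed
    finally show ?thesis .
  qed
  \<comment> \<open>\<open>F\<close> has finitely many subsets, so one null set serves for all of
    them.\<close>
  have AE_R: "AE \<omega> in M. \<forall>T\<in>Pow F. R T \<omega> = (\<Prod>(i, j)\<in>T. edge_prob i j \<omega>)"
  proof (intro AE_ball_countable[THEN iffD2] ballI)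
    show "countable (Pow F)" using F(1) by (simp add: countable_finite)
    fix T assume T: "T \<in> Pow F"
    then have "T \<subseteq> {(i, j). i < j}" using F(2) by auto
    from edges_cond_indep[OF finT[OF T] this]
    show "AE \<omega> in M. R T \<omega> = (\<Prod>(i, j)\<in>T. edge_prob i j \<omega>)"
      by (simp add: R_def ET_def edge_prob_def locations_marks_def)
  qed
  have "expectation (\<lambda>\<omega>. indicator B \<omega> * f \<omega>)
    \<le> expectation (\<lambda>\<omega>. \<Sum>T\<in>Pow F. (- 1) ^ card T * (indicator B \<omega> * R T \<omega>))"
  proof (rule integral_mono_AE)
    show "integrable M (\<lambda>\<omega>. indicator B \<omega> * f \<omega>)"
      using f by (intro integrable_const_bound[of _ 1]) (auto simp: indicator_def)
    show "integrable M (\<lambda>\<omega>. \<Sum>T\<in>Pow F. (- 1) ^ card T * (indicator B \<omega> * R T \<omega>))"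
      using R by (intro Bochner_Integration.integrable_sum integrable_mult_right) auto
    show "AE \<omega> in M. indicator B \<omega> * f \<omega> \<le> (\<Sum>T\<in>Pow F. (- 1) ^ card T * (indicator B \<omega> * R T \<omega>))"
      using AE_R
    proof eventually_elim
      case (elim \<omega>)
      have "(\<Sum>T\<in>Pow F. (- 1) ^ card T * (indicator B \<omega> * R T \<omega>))
        = indicator B \<omega> * (\<Sum>T\<in>Pow F. (- 1) ^ card T * (\<Prod>x\<in>T. edge_prob (fst x) (snd x) \<omega>))"
        unfolding sum_distrib_left using elim by (intro sum.cong refl) (simp add: case_prod_unfold)
      also have "\<dots> = indicator B \<omega> * (\<Prod>x\<in>F. 1 - edge_prob (fst x) (snd x) \<omega>)"
        by (simp add: prod_one_minus_expand[OF F(1)])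
      finally show ?case using le[of \<omega>] by (cases "\<omega> \<in> B") (auto simp: case_prod_unfold)
    qed
  qed
  \<comment> \<open>\<open>B\<close> belongs to the sigma-algebra of locations and marks, so under
    the expectation the conditional probabilities may be exchanged for the edge events themselves.
    The alternating sum is then read backwards.\<close>
  also have "\<dots> = (\<Sum>T\<in>Pow F. (- 1) ^ card T * expectation (\<lambda>\<omega>. indicator B \<omega> * indicator (ET T) \<omega>))"
    using R by (simp add: Bochner_Integration.integral_sum)
  also have "\<dots> = expectation (\<lambda>\<omega>. \<Sum>T\<in>Pow F. (- 1) ^ card T * (indicator B \<omega> * indicator (ET T) \<omega>))"
    using int_ET by (simp add: Bochner_Integration.integral_sum)
  also have "\<dots> = expectation (\<lambda>\<omega>. indicator (B \<inter> N) \<omega>)"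
    by (intro Bochner_Integration.integral_cong refl)
      (simp add: N_expand indicator_inter_arith sum_distrib_left mult_ac)
  also have "\<dots> = prob (B \<inter> N)"
    by (subst Bochner_Integration.integral_indicator)
      (auto simp: Int_absorb2 emeasure_finite sets.sets_into_space)
  finally show ?thesis by (simp add: N_def)
qed

text \<open>Independence is assumed for the sigma-algebras generated by the two whole sequences;
  those generated by functions of the sequences are contained in them.\<close>

lemma locations_marks_expectation:
  fixes \<phi> :: "(nat \<Rightarrow> real ^ 'd) \<Rightarrow> real" and \<psi> :: "(nat \<Rightarrow> real) \<Rightarrow> real"
  assumes \<phi>: "\<phi> \<in> borel_measurable seq_space" "\<And>x. \<bar>\<phi> x\<bar> \<le> 1"
    and \<psi>: "\<psi> \<in> borel_measurable seq_space" "\<And>w. \<bar>\<psi> w\<bar> \<le> 1"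
  shows "expectation (\<lambda>\<omega>. \<phi> (\<lambda>i. X i \<omega>) * \<psi> (\<lambda>i. W i \<omega>))
    = expectation (\<lambda>\<omega>. \<phi> (\<lambda>i. X i \<omega>)) * expectation (\<lambda>\<omega>. \<psi> (\<lambda>i. W i \<omega>))"
proof -
  have rvX: "(\<lambda>\<omega> i. X i \<omega>) \<in> M \<rightarrow>\<^sub>M seq_space"
    by (intro measurable_PiM_single') auto
  have rvW: "(\<lambda>\<omega> i. W i \<omega>) \<in> M \<rightarrow>\<^sub>M seq_space"
    by (intro measurable_PiM_single') auto
  have sub: "sigma_sets (space M) {(\<phi> \<circ> (\<lambda>\<omega> i. X i \<omega>)) -` A \<inter> space M | A. A \<in> sets borel}
      \<subseteq> sets (vimage_algebra (space M) (\<lambda>\<omega> i. X i \<omega>) seq_space)"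
    "sigma_sets (space M) {(\<psi> \<circ> (\<lambda>\<omega> i. W i \<omega>)) -` A \<inter> space M | A. A \<in> sets borel}
      \<subseteq> sets (vimage_algebra (space M) (\<lambda>\<omega> i. W i \<omega>) seq_space)"
  proof -
    have m: "\<phi> \<circ> (\<lambda>\<omega> i. X i \<omega>) \<in> vimage_algebra (space M) (\<lambda>\<omega> i. X i \<omega>) seq_space \<rightarrow>\<^sub>M borel"
      "\<psi> \<circ> (\<lambda>\<omega> i. W i \<omega>) \<in> vimage_algebra (space M) (\<lambda>\<omega> i. W i \<omega>) seq_space \<rightarrow>\<^sub>M borel"
      by (auto intro!: measurable_comp[OF _ \<phi>(1)] measurable_comp[OF _ \<psi>(1)] measurable_vimage_algebra1 simp: space_PiM)
    show "sigma_sets (space M) {(\<phi> \<circ> (\<lambda>\<omega> i. X i \<omega>)) -` A \<inter> space M | A. A \<in> sets borel}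
      \<subseteq> sets (vimage_algebra (space M) (\<lambda>\<omega> i. X i \<omega>) seq_space)"
      using measurable_sets[OF m(1)]
      by (subst space_vimage_algebra[of "space M" "\<lambda>\<omega> i. X i \<omega>" "seq_space", symmetric])
        (intro sets.sigma_sets_subset, auto)
    show "sigma_sets (space M) {(\<psi> \<circ> (\<lambda>\<omega> i. W i \<omega>)) -` A \<inter> space M | A. A \<in> sets borel}
      \<subseteq> sets (vimage_algebra (space M) (\<lambda>\<omega> i. W i \<omega>) seq_space)"
      using measurable_sets[OF m(2)]
      by (subst space_vimage_algebra[of "space M" "\<lambda>\<omega> i. W i \<omega>" "seq_space", symmetric])
        (intro sets.sigma_sets_subset, auto)
  qed
  have "indep_var borel (\<phi> \<circ> (\<lambda>\<omega> i. X i \<omega>)) borel (\<psi> \<circ> (\<lambda>\<omega> i. W i \<omega>))"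
    unfolding indep_var_eq
  proof (intro conjI)
    show "random_variable borel (\<phi> \<circ> (\<lambda>\<omega> i. X i \<omega>))" by (rule measurable_comp[OF rvX \<phi>(1)])
    show "random_variable borel (\<psi> \<circ> (\<lambda>\<omega> i. W i \<omega>))" by (rule measurable_comp[OF rvW \<psi>(1)])
    show "indep_set (sigma_sets (space M) {(\<phi> \<circ> (\<lambda>\<omega> i. X i \<omega>)) -` A \<inter> space M | A. A \<in> sets borel})
        (sigma_sets (space M) {(\<psi> \<circ> (\<lambda>\<omega> i. W i \<omega>)) -` A \<inter> space M | A. A \<in> sets borel})"
      using marks_locations_indep sub unfolding indep_set_def
      by (elim indep_sets_mono_sets) (auto split: bool.split)
  qed
  moreover have "integrable M (\<phi> \<circ> (\<lambda>\<omega> i. X i \<omega>))"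
    using \<phi> measurable_compose[OF rvX \<phi>(1)] by (intro integrable_const_bound[of _ 1]) (auto simp: comp_def)
  moreover have "integrable M (\<psi> \<circ> (\<lambda>\<omega> i. W i \<omega>))"
    using \<psi> measurable_compose[OF rvW \<psi>(1)] by (intro integrable_const_bound[of _ 1]) (auto simp: comp_def)
  ultimately show ?thesis
    using indep_var_lebesgue_integral by (simp add: comp_def)
qed

text \<open>The size is determined by the finite set of indices in \<open>B\<close> and by the edges
  among them, and there are only countably many such pairs of data.\<close>

lemma largest_component_measurable:
  assumes B: "B \<in> sets borel" and fin: "\<And>\<omega>. \<omega> \<in> space M \<Longrightarrow> finite {i. X i \<omega> \<in> B}"
  shows "{\<omega> \<in> space M. real (largest_component_size (E \<omega>) {i. X i \<omega> \<in> B}) < x} \<in> events"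
proof -
  define pairs where "pairs S = {{i, j} | i j. i \<in> S \<and> j \<in> S}" for S :: "nat set"
  have fin_pairs: "finite (pairs S)" if "finite S" for S
  proof -
    have "pairs S = (\<lambda>(i, j). {i, j}) ` (S \<times> S)" by (auto simp: pairs_def)
    then show ?thesis using that by simp
  qed
  define A where "A S F = {\<omega> \<in> space M. (\<forall>i. (X i \<omega> \<in> B) = (i \<in> S)) \<and>
      (\<forall>i\<in>S. \<forall>j\<in>S. ({i, j} \<in> E \<omega>) = ({i, j} \<in> F))}" for S F
  have A_meas: "A S F \<in> events" if "finite S" for S F
  proof -
    have [measurable]: "Measurable.pred M (\<lambda>\<omega>. \<forall>i\<in>S. \<forall>j\<in>S. ({i, j} \<in> E \<omega>) = ({i, j} \<in> F))"
      by (intro pred_intros_finite that) measurable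
    note B [measurable]
    show ?thesis unfolding A_def by measurable
  qed
  have A_eq1: "{i. X i \<omega> \<in> B} = S" if "\<omega> \<in> A S F" for \<omega> S F
    using that by (simp add: A_def)
  have A_eq2: "E \<omega> \<inter> pairs S = F" if A: "\<omega> \<in> A S F" and F: "F \<subseteq> pairs S" for \<omega> S F
  proof -
    have "e \<in> E \<omega> \<longleftrightarrow> e \<in> F" if e: "e \<in> pairs S" for e
    proof -
      obtain i j where "e = {i, j}" "i \<in> S" "j \<in> S" using e unfolding pairs_def by blast
      then show ?thesis using A by (simp add: A_def)
    qed
    then show ?thesis using F by blast
  qed
  have "{\<omega> \<in> space M. real (largest_component_size (E \<omega>) {i. X i \<omega> \<in> B}) < x}
    = (\<Union>S\<in>Collect finite. \<Union>F\<in>{F \<in> Pow (pairs S). real (largest_component_size F S) < x}. A S F)"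
  proof (intro set_eqI iffI)
    fix \<omega> assume w: "\<omega> \<in> {\<omega> \<in> space M. real (largest_component_size (E \<omega>) {i. X i \<omega> \<in> B}) < x}"
    define S where "S = {i. X i \<omega> \<in> B}"
    have "\<omega> \<in> A S (E \<omega> \<inter> pairs S)" using w by (auto simp: A_def S_def pairs_def)
    moreover have "real (largest_component_size (E \<omega> \<inter> pairs S) S) < x"
      using w largest_component_size_restrict[of "E \<omega>" S] by (simp add: S_def pairs_def)
    moreover have "finite S" using fin w by (simp add: S_def)
    ultimately show "\<omega> \<in> (\<Union>S\<in>Collect finite. \<Union>F\<in>{F \<in> Pow (pairs S). real (largest_component_size F S) < x}. A S F)"
      by (intro UN_I[of S] UN_I[of "E \<omega> \<inter> pairs S"]) simp_all
  next
    fix \<omega> assume "\<omega> \<in> (\<Union>S\<in>Collect finite. \<Union>F\<in>{F \<in> Pow (pairs S). real (largest_component_size F S) < x}. A S F)"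
    then obtain S F where SF: "F \<subseteq> pairs S" "real (largest_component_size F S) < x" "\<omega> \<in> A S F" by auto
    show "\<omega> \<in> {\<omega> \<in> space M. real (largest_component_size (E \<omega>) {i. X i \<omega> \<in> B}) < x}"
      using SF A_eq1[OF SF(3)] A_eq2[OF SF(3,1)] largest_component_size_restrict[of "E \<omega>" S]
      by (simp add: A_def pairs_def)
  qed
  also have "\<dots> \<in> events"
  proof (rule sets.countable_UN'')
    show "countable (Collect finite :: nat set set)" by (rule countable_Collect_finite)
    fix S :: "nat set" assume "S \<in> Collect finite"
    then have S: "finite S" by simp
    show "(\<Union>F\<in>{F \<in> Pow (pairs S). real (largest_component_size F S) < x}. A S F) \<in> events"
      using A_meas[OF S] fin_pairs[OF S] by (intro sets.finite_UN) auto
  qed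
  finally show ?thesis .
qed

text \<open>For infinite \<tau> the mark is 1 almost surely: its tail vanishes beyond
  \<open>x = 1\<close>, and at that point the bound is 1. Hence every \<open>t > 0\<close> is
  allowed in that case.\<close>

lemma mark_tail:
  assumes t: "t > 0" and "\<tau> \<noteq> \<infinity> \<Longrightarrow> t = real_of_ereal \<tau> - 1" and x: "x \<ge> 1"
  shows "prob {\<omega> \<in> space M. x \<le> W i \<omega>} \<le> x powr (- t)"
proof (cases "\<tau> = \<infinity>")
  case False
  then show ?thesis using marks_pareto[of x i] assms by simp
next
  case True
  show ?thesis
  proof (cases "x = 1")
    case False
    have "AE \<omega> in M. \<not> x \<le> W i \<omega>" using marks_one[OF True, of i] by eventually_elim (use x False in auto)
    then have "prob {\<omega> \<in> space M. x \<le> W i \<omega>} = 0"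
      by (subst prob_eq_0) (auto elim: eventually_mono)
    then show ?thesis by simp
  qed simp
qed

lemma mark_ge_1: "AE \<omega> in M. 1 \<le> W i \<omega>"
proof (cases "\<tau> = \<infinity>")
  case True
  show ?thesis using marks_one[OF True, of i] by eventually_elim simp
next
  case False
  have "prob {\<omega> \<in> space M. 1 \<le> W i \<omega>} = 1" using marks_pareto[OF False, of 1 i] by simp
  then show ?thesis by (subst (asm) prob_eq_1) auto
qed

lemma mark_below:
  assumes t: "t > 0" and "\<tau> \<noteq> \<infinity> \<Longrightarrow> t = real_of_ereal \<tau> - 1" and b: "b \<ge> 1"
  shows "1 - b powr (- t) \<le> prob {\<omega> \<in> space M. 1 \<le> W i \<omega> \<and> W i \<omega> \<le> b}"
proof -
  have "1 - b powr (- t) \<le> 1 - prob {\<omega> \<in> space M. b \<le> W i \<omega>}"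
    using mark_tail[OF assms, of i] by simp
  also have "\<dots> = prob {\<omega> \<in> space M. \<not> b \<le> W i \<omega>}"
    by (subst prob_neg) auto
  also have "\<dots> \<le> prob {\<omega> \<in> space M. 1 \<le> W i \<omega> \<and> W i \<omega> \<le> b}"
    using mark_ge_1[of i] by (intro finite_measure_mono_AE) (auto elim: eventually_mono)
  finally show ?thesis .
qed

end

section \<open>Vertices in cubes\<close>

lemma bounded_cube: "bounded (cube -` {z} :: (real ^ 'd::finite) set)"
proof -
  have "cube -` {z} \<subseteq> cbox (\<chi> i. real_of_int (z $ i)) (\<chi> i. real_of_int (z $ i) + 1)"
  proof
    fix x :: "real ^ 'd" assume "x \<in> cube -` {z}"
    then have "z $ i = \<lfloor>x $ i\<rfloor>" for i by (auto simp: cube_def)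
    then show "x \<in> cbox (\<chi> i. real_of_int (z $ i)) (\<chi> i. real_of_int (z $ i) + 1)"
      by (simp add: mem_box_cart)
  qed
  then show ?thesis by (rule bounded_subset[rotated]) simp
qed

lemma cube_borel: "cube -` {z} \<in> sets (borel :: (real ^ 'd::finite) measure)"
  using measurable_sets[OF cube_measurable, of "{z}"] by simp

context kernel_spatial_random_graph
begin

definition cube_count :: "int ^ 'd \<Rightarrow> 'a \<Rightarrow> nat" where
  "cube_count z \<omega> = card (V \<omega> \<inter> cube -` {z})"

lemma lattice_cube: "integer_lattice \<inter> cube -` {z :: int ^ 'd} = {(\<chi> i. real_of_int (z $ i)) :: real ^ 'd}"
proof (intro set_eqI iffI)
  fix x :: "real ^ 'd" assume "x \<in> integer_lattice \<inter> cube -` {z}"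
  then have x: "x $ i \<in> \<int>" "z $ i = \<lfloor>x $ i\<rfloor>" for i
    by (auto simp: integer_lattice_def cube_def)
  have "x $ i = real_of_int (z $ i)" for i
    unfolding x(2) using x(1)[of i] by (auto elim: Ints_cases)
  then show "x \<in> {\<chi> i. real_of_int (z $ i)}" by (simp add: vec_eq_iff)
next
  fix x :: "real ^ 'd" assume "x \<in> {\<chi> i. real_of_int (z $ i)}"
  then show "x \<in> integer_lattice \<inter> cube -` {z}"
    by (auto simp: integer_lattice_def cube_def vec_eq_iff)
qed

lemma lattice_cube_count: "vs = Integer_Lattice \<Longrightarrow> \<omega> \<in> space M \<Longrightarrow> cube_count z \<omega> = 1"
  by (simp add: cube_count_def vertices_lattice lattice_cube)

lemma finite_vertices_cube:
  assumes "\<omega> \<in> space M"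
  shows "finite (V \<omega> \<inter> cube -` {z})"
proof (cases vs)
  case Integer_Lattice
  then show ?thesis using assms by (simp add: vertices_lattice lattice_cube)
next
  case Poisson_Process
  then show ?thesis
    using vertices_poisson assms bounded_cube[of z] by (simp add: unit_poisson_process_def)
qed

lemma indices_in_cube:
  assumes w: "\<omega> \<in> space M"
  shows "finite {i. cube (X i \<omega>) = z}" "card {i. cube (X i \<omega>) = z} = cube_count z \<omega>"
proof -
  have bij: "bij_betw (\<lambda>i. X i \<omega>) {i. cube (X i \<omega>) = z} (V \<omega> \<inter> cube -` {z})"
    using enumeration[OF w] by (auto simp: bij_betw_def inj_on_def)
  show "finite {i. cube (X i \<omega>) = z}"
    using bij_betw_finite[OF bij] finite_vertices_cube[OF w] by simp
  show "card {i. cube (X i \<omega>) = z} = cube_count z \<omega>"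
    using bij_betw_same_card[OF bij] by (simp add: cube_count_def)
qed

lemma cube_count_measurable [measurable]: "cube_count z \<in> M \<rightarrow>\<^sub>M count_space UNIV"
proof (cases vs)
  case Integer_Lattice
  then show ?thesis
    by (subst measurable_cong[of _ _ "\<lambda>_. 1"]) (auto simp: lattice_cube_count)
next
  case Poisson_Process
  then have "\<forall>B\<in>sets borel. bounded B \<longrightarrow> random_variable (count_space UNIV) (\<lambda>\<omega>. card (V \<omega> \<inter> B))"
    using vertices_poisson unfolding unit_poisson_process_def by blast
  then show ?thesis
    using cube_borel[of z] bounded_cube[of z] by (simp add: cube_count_def[abs_def])
qed

text \<open>Removes the enumeration: afterwards the costs depend on the randomness only through the
  counts of fixed cubes.\<close>

lemma sum_over_indices:
  assumes w: "\<omega> \<in> space M" and Z: "finite Z"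
  shows "finite {i. cube (X i \<omega>) \<in> Z}"
    and "(\<Sum>i | cube (X i \<omega>) \<in> Z. f (cube (X i \<omega>))) = (\<Sum>z\<in>Z. real (cube_count z \<omega>) * f z)"
proof -
  have "{i. cube (X i \<omega>) \<in> Z} = (\<Union>z\<in>Z. {i. cube (X i \<omega>) = z})" by auto
  then show fin: "finite {i. cube (X i \<omega>) \<in> Z}" using Z indices_in_cube[OF w] by simp
  have "(\<Sum>i | cube (X i \<omega>) \<in> Z. f (cube (X i \<omega>)))
    = (\<Sum>z\<in>Z. \<Sum>i | i \<in> {i. cube (X i \<omega>) \<in> Z} \<and> cube (X i \<omega>) = z. f (cube (X i \<omega>)))"
    using fin Z by (intro sum.group[symmetric]) auto
  also have "\<dots> = (\<Sum>z\<in>Z. real (cube_count z \<omega>) * f z)"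
  proof (intro sum.cong refl)
    fix z assume "z \<in> Z"
    then have "{i. i \<in> {i. cube (X i \<omega>) \<in> Z} \<and> cube (X i \<omega>) = z} = {i. cube (X i \<omega>) = z}" by auto
    then show "(\<Sum>i | i \<in> {i. cube (X i \<omega>) \<in> Z} \<and> cube (X i \<omega>) = z. f (cube (X i \<omega>)))
      = real (cube_count z \<omega>) * f z"
      using indices_in_cube[OF w, of z] by simp
  qed
  finally show "(\<Sum>i | cube (X i \<omega>) \<in> Z. f (cube (X i \<omega>))) = (\<Sum>z\<in>Z. real (cube_count z \<omega>) * f z)" .
qed

text \<open>The price on a logarithmic scale, given the locations: \<open>g\<close> for the cap on
  the mark of a vertex, \<open>h\<close> for the absence of an edge. Pairs are counted in both
  orders, an overcount that avoids any reference to the enumeration.\<close>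

definition separation_cost ::
  "(int ^ 'd) set \<Rightarrow> (int ^ 'd \<Rightarrow> 'q) \<Rightarrow> (int ^ 'd \<Rightarrow> real) \<Rightarrow> (int ^ 'd \<Rightarrow> int ^ 'd \<Rightarrow> real) \<Rightarrow> 'a \<Rightarrow> real"
  where "separation_cost Z c g h \<omega> = (\<Sum>z\<in>Z. real (cube_count z \<omega>) * g z) +
    (\<Sum>z\<in>Z. real (cube_count z \<omega>) * (\<Sum>z'\<in>{z'\<in>Z. c z' \<noteq> c z}. real (cube_count z' \<omega>) * h z z'))"

lemma separation_cost_measurable [measurable]:
  "separation_cost Z c g h \<in> borel_measurable M"
  unfolding separation_cost_def[abs_def] by measurable

lemma separation_cost_nonneg:
  "(\<And>z. g z \<ge> 0) \<Longrightarrow> (\<And>z z'. h z z' \<ge> 0) \<Longrightarrow> separation_cost Z c g h \<omega> \<ge> 0"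
  unfolding separation_cost_def by (intro add_nonneg_nonneg sum_nonneg mult_nonneg_nonneg) auto

lemma index_cost_le:
  assumes w: "\<omega> \<in> space M" and Z: "finite Z" and g: "\<And>z. g z \<ge> 0" and h: "\<And>z z'. h z z' \<ge> 0"
    and I: "I \<subseteq> {i. cube (X i \<omega>) \<in> Z}"
    and F: "\<And>i j. (i, j) \<in> F \<Longrightarrow> i \<in> I \<and> j \<in> I \<and> c (cube (X i \<omega>)) \<noteq> c (cube (X j \<omega>))"
  shows "(\<Sum>u\<in>I. g (cube (X u \<omega>))) + (\<Sum>(i, j)\<in>F. h (cube (X i \<omega>)) (cube (X j \<omega>)))
    \<le> separation_cost Z c g h \<omega>"
proof -
  define A where "A = {i. cube (X i \<omega>) \<in> Z}"
  have A: "finite A" unfolding A_def by (rule sum_over_indices[OF w Z])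
  have "(\<Sum>u\<in>I. g (cube (X u \<omega>))) \<le> (\<Sum>u\<in>A. g (cube (X u \<omega>)))"
    using I A g by (intro sum_mono2) (auto simp: A_def)
  also have "\<dots> = (\<Sum>z\<in>Z. real (cube_count z \<omega>) * g z)"
    unfolding A_def by (rule sum_over_indices[OF w Z])
  finally have 1: "(\<Sum>u\<in>I. g (cube (X u \<omega>))) \<le> (\<Sum>z\<in>Z. real (cube_count z \<omega>) * g z)" .
  have "(\<Sum>(i, j)\<in>F. h (cube (X i \<omega>)) (cube (X j \<omega>)))
     \<le> (\<Sum>(i, j)\<in>(SIGMA i:A. {j. cube (X j \<omega>) \<in> {z'\<in>Z. c z' \<noteq> c (cube (X i \<omega>))}}). h (cube (X i \<omega>)) (cube (X j \<omega>)))"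
  proof (rule sum_mono2)
    show "finite (SIGMA i:A. {j. cube (X j \<omega>) \<in> {z'\<in>Z. c z' \<noteq> c (cube (X i \<omega>))}})"
      using A Z by (intro finite_SigmaI sum_over_indices(1)[OF w]) auto
    show "F \<subseteq> (SIGMA i:A. {j. cube (X j \<omega>) \<in> {z'\<in>Z. c z' \<noteq> c (cube (X i \<omega>))}})"
      using F I unfolding A_def by fastforce
  qed (use h in auto)
  also have "\<dots> = (\<Sum>i\<in>A. \<Sum>j | cube (X j \<omega>) \<in> {z'\<in>Z. c z' \<noteq> c (cube (X i \<omega>))}. h (cube (X i \<omega>)) (cube (X j \<omega>)))"
    using A Z by (intro sum.Sigma[symmetric] ballI sum_over_indices(1)[OF w]) auto
  also have "\<dots> = (\<Sum>i\<in>A. \<Sum>z'\<in>{z'\<in>Z. c z' \<noteq> c (cube (X i \<omega>))}. real (cube_count z' \<omega>) * h (cube (X i \<omega>)) z')"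
    using Z by (intro sum.cong refl sum_over_indices(2)[OF w]) auto
  also have "\<dots> = (\<Sum>z\<in>Z. real (cube_count z \<omega>) * (\<Sum>z'\<in>{z'\<in>Z. c z' \<noteq> c z}. real (cube_count z' \<omega>) * h z z'))"
    unfolding A_def by (rule sum_over_indices[OF w Z])
  finally show ?thesis using 1 unfolding separation_cost_def by linarith
qed

text \<open>Conditioning on which of the first \<open>n\<close> vertices lie in which cube leaves only finitely many cases,
  in each of which the marks and edges are handled for deterministic cubes.\<close>

lemma no_crossing_edges:
  fixes Z :: "(int ^ 'd) set" and c :: "int ^ 'd \<Rightarrow> 'q" and f g :: "int ^ 'd \<Rightarrow> real"
    and Kf :: "int ^ 'd \<Rightarrow> int ^ 'd \<Rightarrow> nat" and C :: "int ^ 'd \<Rightarrow> int ^ 'd \<Rightarrow> nat \<Rightarrow> nat \<Rightarrow> real"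
  assumes Z: "finite Z" and ok: "Measurable.pred seq_space ok"
    and \<pi>: "\<pi> > 0" "\<And>u z. z \<in> Z \<Longrightarrow> \<pi> \<le> prob {\<omega> \<in> space M. 1 \<le> W u \<omega> \<and> W u \<omega> \<le> f z}"
    and g: "\<And>z. g z \<ge> 0" "\<And>u z. z \<in> Z \<Longrightarrow> exp (- g z) \<le> prob {\<omega> \<in> space M. 1 \<le> W u \<omega> \<and> W u \<omega> \<le> f z}"
    and tail: "\<And>u x. x \<ge> 1 \<Longrightarrow> prob {\<omega> \<in> space M. x \<le> W u \<omega>} \<le> x powr (- t)"
    and C: "\<And>z z' k m. C z z' k m \<ge> 0"
    and edge: "\<And>i j \<omega> z z'. \<omega> \<in> space M \<Longrightarrow> ok (\<lambda>i. X i \<omega>) \<Longrightarrow> i < j \<Longrightarrow>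
      z = cube (X i \<omega>) \<Longrightarrow> z' = cube (X j \<omega>) \<Longrightarrow> z \<in> Z \<Longrightarrow> z' \<in> Z \<Longrightarrow> c z \<noteq> c z' \<Longrightarrow>
      1 \<le> W i \<omega> \<Longrightarrow> W i \<omega> \<le> f z \<Longrightarrow> 1 \<le> W j \<omega> \<Longrightarrow> W j \<omega> \<le> f z' \<Longrightarrow>
      exp (- thresholds (C z z') (Kf z z') (W i \<omega>) (W j \<omega>)) \<le> 1 - edge_prob i j \<omega>"
  defines "h z z' \<equiv> \<Sum>k\<le>Kf z z'. \<Sum>m\<le>Kf z z'. C z z' k m * 2 powr (- t * real (k + m)) / \<pi>\<^sup>2"
  shows "expectation (\<lambda>\<omega>. indicator {\<omega> \<in> space M. ok (\<lambda>i. X i \<omega>)} \<omega> * exp (- separation_cost Z c g h \<omega>))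
    \<le> prob {\<omega> \<in> space M. ok (\<lambda>i. X i \<omega>) \<and> (\<forall>j. \<forall>i<j. cube (X i \<omega>) \<in> Z \<longrightarrow> cube (X j \<omega>) \<in> Z \<longrightarrow>
      c (cube (X i \<omega>)) \<noteq> c (cube (X j \<omega>)) \<longrightarrow> {i, j} \<notin> E \<omega>)}"
proof -
  note ok [measurable]
  have seqX [measurable]: "(\<lambda>\<omega> i. X i \<omega>) \<in> M \<rightarrow>\<^sub>M seq_space"
    by (intro measurable_PiM_single') auto
  have seqX': "(\<lambda>\<omega> i. X i \<omega>) \<in> locations_marks \<rightarrow>\<^sub>M seq_space"
    by (intro measurable_PiM_single') (auto simp: locations_marks_measurable)
  have h0: "h z z' \<ge> 0" for z z'
    unfolding h_def using C by (intro sum_nonneg divide_nonneg_nonneg mult_nonneg_nonneg) auto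
  \<comment> \<open>Only the vertices numbered below \<open>n\<close> are looked at. These events
    decrease to the wanted one, and the lower bound to be shown does not depend on
    \<open>n\<close>.\<close>
  define B where "B n = {\<omega> \<in> space M. ok (\<lambda>i. X i \<omega>) \<and> (\<forall>j<n. \<forall>i<j. cube (X i \<omega>) \<in> Z \<longrightarrow> cube (X j \<omega>) \<in> Z \<longrightarrow>
      c (cube (X i \<omega>)) \<noteq> c (cube (X j \<omega>)) \<longrightarrow> {i, j} \<notin> E \<omega>)}" for n
  have B_meas: "B n \<in> events" for n
  proof -
    have [measurable]: "Measurable.pred M (\<lambda>\<omega>. cube (X i \<omega>) \<in> Z)" for i by measurable
    have cc [measurable]: "Measurable.pred M (\<lambda>\<omega>. c (cube (X i \<omega>)) \<noteq> c (cube (X j \<omega>)))" for i j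
    proof -
      \<comment> \<open>The labels are of an arbitrary type; comparing them is measurable because it
        factors through the countable set of pairs of cubes.\<close>
      have "(\<lambda>\<omega>. (cube (X i \<omega>), cube (X j \<omega>))) \<in> M \<rightarrow>\<^sub>M count_space UNIV \<Otimes>\<^sub>M count_space UNIV"
        by measurable
      then have "(\<lambda>\<omega>. (cube (X i \<omega>), cube (X j \<omega>))) \<in> M \<rightarrow>\<^sub>M count_space UNIV"
        by (simp add: pair_measure_countable)
      from measurable_compose[OF this, of "\<lambda>p. c (fst p) \<noteq> c (snd p)" "count_space UNIV"]
      show ?thesis by (simp add: pred_def)
    qed
    show ?thesis unfolding B_def by measurable
  qed
  have upto: "expectation (\<lambda>\<omega>. indicator {\<omega> \<in> space M. ok (\<lambda>i. X i \<omega>)} \<omega> * exp (- separation_cost Z c g h \<omega>)) \<le> prob (B n)" for n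
  proof -
  \<comment> \<open>A configuration records the cube of each of the first \<open>n\<close> vertices,
    with \<open>None\<close> for a vertex outside \<open>Z\<close>. On one configuration the set
    \<open>F\<close> of index pairs with different labels is deterministic.\<close>
  define conf where "conf x = (\<lambda>i\<in>{..<n}. if cube (x i) \<in> Z then Some (cube (x i)) else None)"
    for x :: "nat \<Rightarrow> real ^ 'd"
  define Cf where "Cf = PiE {..<n} (\<lambda>_. insert None (Some ` Z))"
  have finCf: "finite Cf" unfolding Cf_def using Z by (intro finite_PiE) auto
  have conf_in: "conf x \<in> Cf" for x by (auto simp: conf_def Cf_def)
  define I where "I \<kappa> = {i. i < n \<and> \<kappa> i \<noteq> None}" for \<kappa> :: "nat \<Rightarrow> (int ^ 'd) option"
  define F where "F \<kappa> = {(i, j). i < j \<and> i \<in> I \<kappa> \<and> j \<in> I \<kappa> \<and> c (the (\<kappa> i)) \<noteq> c (the (\<kappa> j))}" for \<kappa>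
  have finI: "finite (I \<kappa>)" for \<kappa> by (simp add: I_def)
  have finF: "finite (F \<kappa>)" for \<kappa>
    by (rule finite_subset[of _ "I \<kappa> \<times> I \<kappa>"]) (use finI in \<open>auto simp: F_def\<close>)
  have I_Z: "the (\<kappa> i) \<in> Z" if "\<kappa> \<in> Cf" "i \<in> I \<kappa>" for \<kappa> i
  proof -
    have "\<kappa> i \<in> insert None (Some ` Z)" using that unfolding Cf_def I_def by (intro PiE_mem[of \<kappa> "{..<n}"]) auto
    then show ?thesis using that(2) by (auto simp: I_def)
  qed
  define Q where "Q \<kappa> = {x. ok x \<and> conf x = \<kappa>}" for \<kappa>
  have Q_eq: "Q \<kappa> = {x. ok x \<and> (\<forall>i<n. (if cube (x i) \<in> Z then Some (cube (x i)) else None) = \<kappa> i)}"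
    if "\<kappa> \<in> Cf" for \<kappa>
    using that unfolding Q_def conf_def Cf_def
    by (auto simp: fun_eq_iff restrict_def PiE_def extensional_def)
  have conf_i: "Measurable.pred seq_space (\<lambda>x. (if cube (x i) \<in> Z then Some (cube (x i)) else None) = y)"
    for y i
  proof -
    have "(\<lambda>x. cube (x i)) \<in> Pi\<^sub>M UNIV (\<lambda>_. borel :: (real ^ 'd) measure) \<rightarrow>\<^sub>M count_space UNIV"
      by measurable
    from measurable_compose[OF this, of "\<lambda>z. (if z \<in> Z then Some z else None) = y" "count_space UNIV"]
    show ?thesis by (simp add: pred_def)
  qed
  have Q_meas: "Measurable.pred seq_space (\<lambda>x. x \<in> Q \<kappa>)" if "\<kappa> \<in> Cf" for \<kappa>
    unfolding Q_eq[OF that] mem_Collect_eq by (intro pred_intros_logic pred_intros_countable ok conf_i) simp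
  define A where "A \<kappa> = {\<omega> \<in> space M. (\<lambda>i. X i \<omega>) \<in> Q \<kappa>}" for \<kappa>
  have A_meas: "A \<kappa> \<in> events" if "\<kappa> \<in> Cf" for \<kappa>
    unfolding A_def using measurable_compose[OF seqX Q_meas[OF that]] by (simp add: pred_def)
  have A_info: "A \<kappa> \<in> sets locations_marks" if "\<kappa> \<in> Cf" for \<kappa>
    using measurable_compose[OF seqX' Q_meas[OF that]] locations_marks_subalgebra
    by (simp add: pred_def A_def subalgebra_def)
  have A_cube: "the (\<kappa> i) = cube (X i \<omega>)" "cube (X i \<omega>) \<in> Z" if "\<omega> \<in> A \<kappa>" "i \<in> I \<kappa>" for \<kappa> i \<omega>
    using that by (auto simp: A_def Q_def I_def conf_def split: if_splits)
  define G where "G \<kappa> = {\<omega> \<in> space M. \<forall>u\<in>I \<kappa>. 1 \<le> W u \<omega> \<and> W u \<omega> \<le> f (the (\<kappa> u))}" for \<kappa>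
  have G_meas: "G \<kappa> \<in> events" for \<kappa>
  proof -
    have "Measurable.pred M (\<lambda>\<omega>. \<forall>u\<in>I \<kappa>. 1 \<le> W u \<omega> \<and> W u \<omega> \<le> f (the (\<kappa> u)))"
      by (intro pred_intros_finite finI) measurable
    then show ?thesis unfolding G_def by measurable
  qed
  have G_info: "G \<kappa> \<in> sets locations_marks" for \<kappa>
  proof -
    note locations_marks_measurable(2) [measurable]
    have "Measurable.pred locations_marks (\<lambda>\<omega>. \<forall>u\<in>I \<kappa>. 1 \<le> W u \<omega> \<and> W u \<omega> \<le> f (the (\<kappa> u)))"
      by (intro pred_intros_finite finI) measurable
    then have "{\<omega> \<in> space locations_marks. \<forall>u\<in>I \<kappa>. 1 \<le> W u \<omega> \<and> W u \<omega> \<le> f (the (\<kappa> u))} \<in> sets locations_marks"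
      by measurable
    moreover have "space locations_marks = space M"
      using locations_marks_subalgebra by (simp add: subalgebra_def)
    ultimately show ?thesis unfolding G_def by (simp only:)
  qed
  define T where "T \<kappa> w = (\<Sum>(i, j)\<in>F \<kappa>. \<Sum>k\<le>Kf (the (\<kappa> i)) (the (\<kappa> j)). \<Sum>m\<le>Kf (the (\<kappa> i)) (the (\<kappa> j)).
      C (the (\<kappa> i)) (the (\<kappa> j)) k m * indicator {w. 2 ^ k \<le> w} (w i) * (indicator {w. 2 ^ m \<le> w} (w j) :: real))"
    for \<kappa> and w :: "nat \<Rightarrow> real"
  have T0: "T \<kappa> w \<ge> 0" for \<kappa> w
    unfolding T_def case_prod_unfold using C by (intro sum_nonneg mult_nonneg_nonneg) auto
  have T_meas: "T \<kappa> \<in> borel_measurable seq_space" for \<kappa>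
    unfolding T_def[abs_def] case_prod_unfold by measurable
  define cost where "cost \<kappa> = (\<Sum>u\<in>I \<kappa>. g (the (\<kappa> u))) + (\<Sum>(i, j)\<in>F \<kappa>. h (the (\<kappa> i)) (the (\<kappa> j)))" for \<kappa>
  define NE where "NE \<kappa> = {\<omega> \<in> space M. \<forall>(i, j)\<in>F \<kappa>. {i, j} \<notin> E \<omega>}" for \<kappa>
  have NE_meas: "NE \<kappa> \<in> events" for \<kappa>
    unfolding NE_def case_prod_unfold
    by (intro sets.sets_Collect_finite_All sets.sets_Collect_neg edge_measurable finF)
  \<comment> \<open>On a fixed configuration three factors are separated: the locations, which are
    independent of the marks; the marks, by \<open>marks_lower_bound\<close>; and the edges given
    both, by \<open>no_edge_lower_bound\<close>.\<close>
  have step: "prob (A \<kappa>) * exp (- cost \<kappa>) \<le> prob (A \<kappa> \<inter> G \<kappa> \<inter> NE \<kappa>)" if \<kappa>: "\<kappa> \<in> Cf" for \<kappa>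
  proof -
    define \<psi> where "\<psi> w = indicator {w. \<forall>u\<in>I \<kappa>. 1 \<le> w u \<and> w u \<le> f (the (\<kappa> u))} w * exp (- T \<kappa> w)"
      for w :: "nat \<Rightarrow> real"
    have "exp (- cost \<kappa>) \<le> expectation (\<lambda>\<omega>. indicator (G \<kappa>) \<omega> * exp (- T \<kappa> (\<lambda>i. W i \<omega>)))"
      using marks_lower_bound[OF marks_indep finI[of \<kappa>] finF[of \<kappa>] _ \<pi>(1), of "\<lambda>u. f (the (\<kappa> u))" "\<lambda>u. g (the (\<kappa> u))" t
          "\<lambda>i j. C (the (\<kappa> i)) (the (\<kappa> j))" "\<lambda>i j. Kf (the (\<kappa> i)) (the (\<kappa> j))"]
        \<pi>(2)[OF I_Z[OF \<kappa>]] g(2)[OF I_Z[OF \<kappa>]] tail C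
      unfolding cost_def h_def G_def T_def by (fastforce simp: F_def)
    also have "\<dots> = expectation (\<lambda>\<omega>. \<psi> (\<lambda>i. W i \<omega>))"
      by (intro Bochner_Integration.integral_cong refl) (auto simp: \<psi>_def G_def indicator_def)
    finally have "prob (A \<kappa>) * exp (- cost \<kappa>) \<le> prob (A \<kappa>) * expectation (\<lambda>\<omega>. \<psi> (\<lambda>i. W i \<omega>))"
      by (intro mult_left_mono) auto
    also have pA: "prob (A \<kappa>) = expectation (\<lambda>\<omega>. indicator (Q \<kappa>) (\<lambda>i. X i \<omega>))"
    proof -
      have "expectation (\<lambda>\<omega>. indicator (Q \<kappa>) (\<lambda>i. X i \<omega>) :: real) = expectation (indicator (A \<kappa>))"
        by (intro Bochner_Integration.integral_cong refl) (auto simp: A_def indicator_def)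
      then show ?thesis using A_meas[OF \<kappa>]
        by (simp add: Int_absorb2 emeasure_finite sets.sets_into_space)
    qed
    also have "expectation (\<lambda>\<omega>. indicator (Q \<kappa>) (\<lambda>i. X i \<omega>)) * expectation (\<lambda>\<omega>. \<psi> (\<lambda>i. W i \<omega>))
      = expectation (\<lambda>\<omega>. indicator (Q \<kappa>) (\<lambda>i. X i \<omega>) * \<psi> (\<lambda>i. W i \<omega>))"
    proof (rule locations_marks_expectation[symmetric])
      show "indicator (Q \<kappa>) \<in> borel_measurable seq_space"
        using Q_meas[OF \<kappa>] by (simp add: pred_def borel_measurable_indicator_iff Int_def space_PiM)
      have "Measurable.pred seq_space (\<lambda>w. \<forall>u\<in>I \<kappa>. 1 \<le> w u \<and> w u \<le> f (the (\<kappa> u)))"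
        by (intro pred_intros_finite finI) measurable
      then have [measurable]: "(indicator {w. \<forall>u\<in>I \<kappa>. 1 \<le> w u \<and> w u \<le> f (the (\<kappa> u))} :: _ \<Rightarrow> real)
          \<in> borel_measurable seq_space"
        by (simp add: pred_def borel_measurable_indicator_iff Int_def space_PiM)
      note T_meas [measurable]
      show "\<psi> \<in> borel_measurable seq_space" unfolding \<psi>_def[abs_def] by measurable
    qed (use T0 in \<open>auto simp: \<psi>_def indicator_def\<close>)
    also have "\<dots> = expectation (\<lambda>\<omega>. indicator (A \<kappa> \<inter> G \<kappa>) \<omega> * exp (- T \<kappa> (\<lambda>i. W i \<omega>)))"
      by (intro Bochner_Integration.integral_cong refl) (auto simp: A_def G_def \<psi>_def indicator_def)
    also have "\<dots> \<le> prob (A \<kappa> \<inter> G \<kappa> \<inter> NE \<kappa>)"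
      unfolding NE_def
    proof (rule no_edge_lower_bound)
      show "A \<kappa> \<inter> G \<kappa> \<in> sets locations_marks" using A_info[OF \<kappa>] G_info by blast
      have "(\<lambda>\<omega> i. W i \<omega>) \<in> M \<rightarrow>\<^sub>M seq_space" by (intro measurable_PiM_single') auto
      from measurable_compose[OF this T_meas]
      show "(\<lambda>\<omega>. exp (- T \<kappa> (\<lambda>i. W i \<omega>))) \<in> borel_measurable M" by simp
      fix \<omega> assume w: "\<omega> \<in> A \<kappa> \<inter> G \<kappa>"
      have "exp (- T \<kappa> (\<lambda>i. W i \<omega>)) = (\<Prod>(i, j)\<in>F \<kappa>. exp (- thresholds (C (the (\<kappa> i)) (the (\<kappa> j))) (Kf (the (\<kappa> i)) (the (\<kappa> j))) (W i \<omega>) (W j \<omega>)))"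
        unfolding T_def case_prod_unfold using finF by (simp add: exp_sum[symmetric] sum_negf)
      also have "\<dots> \<le> (\<Prod>(i, j)\<in>F \<kappa>. 1 - edge_prob i j \<omega>)"
      proof (rule prod_mono, clarify)
        fix i j assume ij: "(i, j) \<in> F \<kappa>"
        then have "i \<in> I \<kappa>" "j \<in> I \<kappa>" by (auto simp: F_def)
        then have "exp (- thresholds (C (the (\<kappa> i)) (the (\<kappa> j))) (Kf (the (\<kappa> i)) (the (\<kappa> j))) (W i \<omega>) (W j \<omega>))
          \<le> 1 - edge_prob i j \<omega>"
          using w ij A_cube[of \<omega> \<kappa> i] A_cube[of \<omega> \<kappa> j]
          by (intro edge) (auto simp: F_def A_def Q_def G_def)
        then show "0 \<le> exp (- thresholds (C (the (\<kappa> i)) (the (\<kappa> j))) (Kf (the (\<kappa> i)) (the (\<kappa> j))) (W i \<omega>) (W j \<omega>)) \<and>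
          exp (- thresholds (C (the (\<kappa> i)) (the (\<kappa> j))) (Kf (the (\<kappa> i)) (the (\<kappa> j))) (W i \<omega>) (W j \<omega>))
          \<le> 1 - edge_prob i j \<omega>" by simp
      qed
      finally show "exp (- T \<kappa> (\<lambda>i. W i \<omega>)) \<le> (\<Prod>(i, j)\<in>F \<kappa>. 1 - edge_prob i j \<omega>)" .
    qed (use finF T0 in \<open>auto simp: F_def\<close>)
    finally show ?thesis unfolding pA .
  qed
  define S where "S = separation_cost Z c g h"
  have S0: "S \<omega> \<ge> 0" for \<omega> unfolding S_def by (rule separation_cost_nonneg) (use g(1) h0 in auto)
  have S_meas [measurable]: "S \<in> borel_measurable M" unfolding S_def by measurable
  have intA: "integrable M (\<lambda>\<omega>. indicator (A \<kappa>) \<omega> * exp (- S \<omega>))" if "\<kappa> \<in> Cf" for \<kappa>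
    using A_meas[OF that] S0 by (intro integrable_const_bound[of _ 1]) (auto simp: indicator_def)
  have "expectation (\<lambda>\<omega>. indicator {\<omega> \<in> space M. ok (\<lambda>i. X i \<omega>)} \<omega> * exp (- S \<omega>))
    = expectation (\<lambda>\<omega>. \<Sum>\<kappa>\<in>Cf. indicator (A \<kappa>) \<omega> * exp (- S \<omega>))"
  proof (intro Bochner_Integration.integral_cong refl)
    fix \<omega> assume w: "\<omega> \<in> space M"
    have "(\<Sum>\<kappa>\<in>Cf. indicator (A \<kappa>) \<omega> * exp (- S \<omega>))
       = (\<Sum>\<kappa>\<in>{conf (\<lambda>i. X i \<omega>)}. indicator (A \<kappa>) \<omega> * exp (- S \<omega>))"
      using finCf conf_in by (intro sum.mono_neutral_right) (auto simp: A_def Q_def indicator_def)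
    then show "indicator {\<omega> \<in> space M. ok (\<lambda>i. X i \<omega>)} \<omega> * exp (- S \<omega>)
       = (\<Sum>\<kappa>\<in>Cf. indicator (A \<kappa>) \<omega> * exp (- S \<omega>))"
      using w by (simp add: A_def Q_def indicator_def)
  qed
  also have "\<dots> = (\<Sum>\<kappa>\<in>Cf. expectation (\<lambda>\<omega>. indicator (A \<kappa>) \<omega> * exp (- S \<omega>)))"
    using intA by (intro Bochner_Integration.integral_sum)
  also have "\<dots> \<le> (\<Sum>\<kappa>\<in>Cf. prob (A \<kappa>) * exp (- cost \<kappa>))"
  proof (rule sum_mono)
    fix \<kappa> assume \<kappa>: "\<kappa> \<in> Cf"
    have "expectation (\<lambda>\<omega>. indicator (A \<kappa>) \<omega> * exp (- S \<omega>)) \<le> expectation (\<lambda>\<omega>. indicator (A \<kappa>) \<omega> * exp (- cost \<kappa>))"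
    proof (rule integral_mono[OF intA[OF \<kappa>]])
      show "integrable M (\<lambda>\<omega>. indicator (A \<kappa>) \<omega> * exp (- cost \<kappa>))"
        using A_meas[OF \<kappa>] by (intro integrable_const_bound[of _ "exp (- cost \<kappa>)"]) (auto simp: indicator_def)
      fix \<omega> assume w: "\<omega> \<in> space M"
      show "indicator (A \<kappa>) \<omega> * exp (- S \<omega>) \<le> indicator (A \<kappa>) \<omega> * exp (- cost \<kappa>)"
      proof (cases "\<omega> \<in> A \<kappa>")
        case True
        have "cost \<kappa> = (\<Sum>u\<in>I \<kappa>. g (cube (X u \<omega>))) + (\<Sum>(i, j)\<in>F \<kappa>. h (cube (X i \<omega>)) (cube (X j \<omega>)))"
          unfolding cost_def using A_cube(1)[OF True]
          by (intro arg_cong2[where f = "(+)"] sum.cong refl) (auto simp: F_def)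
        also have "\<dots> \<le> S \<omega>"
          unfolding S_def using A_cube[OF True]
          by (intro index_cost_le w Z g(1) h0) (auto simp: F_def)
        finally show ?thesis by (intro mult_left_mono) auto
      qed simp
    qed
    also have "\<dots> = prob (A \<kappa>) * exp (- cost \<kappa>)"
      using A_meas[OF \<kappa>] by (simp add: Int_absorb2 sets.sets_into_space)
    finally show "expectation (\<lambda>\<omega>. indicator (A \<kappa>) \<omega> * exp (- S \<omega>)) \<le> prob (A \<kappa>) * exp (- cost \<kappa>)" .
  qed
  also have "\<dots> \<le> (\<Sum>\<kappa>\<in>Cf. prob (A \<kappa> \<inter> G \<kappa> \<inter> NE \<kappa>))"
    by (rule sum_mono) (rule step)
  also have "\<dots> = prob (\<Union>\<kappa>\<in>Cf. A \<kappa> \<inter> G \<kappa> \<inter> NE \<kappa>)"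
  proof (rule finite_measure_finite_Union[symmetric])
    show "(\<lambda>\<kappa>. A \<kappa> \<inter> G \<kappa> \<inter> NE \<kappa>) ` Cf \<subseteq> events" using A_meas G_meas NE_meas by auto
    show "disjoint_family_on (\<lambda>\<kappa>. A \<kappa> \<inter> G \<kappa> \<inter> NE \<kappa>) Cf"
      by (auto simp: disjoint_family_on_def A_def Q_def)
  qed (rule finCf)
  also have "\<dots> \<le> prob (B n)"
  proof (rule finite_measure_mono)
    show "(\<Union>\<kappa>\<in>Cf. A \<kappa> \<inter> G \<kappa> \<inter> NE \<kappa>) \<subseteq> B n"
    proof clarify
      fix \<omega> \<kappa> assume w: "\<omega> \<in> A \<kappa>" "\<omega> \<in> NE \<kappa>"
      have "{i, j} \<notin> E \<omega>" if "j < n" "i < j" "cube (X i \<omega>) \<in> Z" "cube (X j \<omega>) \<in> Z"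
        "c (cube (X i \<omega>)) \<noteq> c (cube (X j \<omega>))" for i j
      proof -
        have "\<kappa> i = Some (cube (X i \<omega>))" "\<kappa> j = Some (cube (X j \<omega>))"
          using w(1) that by (auto simp: A_def Q_def conf_def)
        then have "(i, j) \<in> F \<kappa>" using that by (auto simp: F_def I_def)
        then show ?thesis using w(2) by (auto simp: NE_def)
      qed
      then have "\<omega> \<in> space M \<and> ok (\<lambda>i. X i \<omega>) \<and> (\<forall>j<n. \<forall>i<j. cube (X i \<omega>) \<in> Z \<longrightarrow> cube (X j \<omega>) \<in> Z \<longrightarrow>
      c (cube (X i \<omega>)) \<noteq> c (cube (X j \<omega>)) \<longrightarrow> {i, j} \<notin> E \<omega>)"
        using w(1) by (simp add: A_def Q_def)
      then show "\<omega> \<in> B n" by (simp add: B_def)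
    qed
    show "B n \<in> events" by (rule B_meas)
  qed
  finally show ?thesis by (simp add: S_def)
  qed
  have "decseq B" unfolding B_def by (rule antimonoI) auto
  then have "(\<lambda>n. prob (B n)) \<longlonglongrightarrow> prob (\<Inter>n. B n)"
    using B_meas by (intro finite_Lim_measure_decseq) auto
  then have "expectation (\<lambda>\<omega>. indicator {\<omega> \<in> space M. ok (\<lambda>i. X i \<omega>)} \<omega> * exp (- separation_cost Z c g h \<omega>))
      \<le> prob (\<Inter>n. B n)"
    by (rule LIMSEQ_le_const) (use upto in auto)
  also have "(\<Inter>n. B n) = {\<omega> \<in> space M. ok (\<lambda>i. X i \<omega>) \<and> (\<forall>j. \<forall>i<j. cube (X i \<omega>) \<in> Z \<longrightarrow> cube (X j \<omega>) \<in> Z \<longrightarrow>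
      c (cube (X i \<omega>)) \<noteq> c (cube (X j \<omega>)) \<longrightarrow> {i, j} \<notin> E \<omega>)}"
    unfolding B_def by (auto intro: lessI)
  finally show ?thesis .
qed

end

section \<open>Poisson counts in unit cubes\<close>

lemma cube_lebesgue: "measure lborel (cube -` {z} :: (real ^ 'd::finite) set) = 1"
proof -
  define a b :: "real ^ 'd" where "a = (\<chi> i. real_of_int (z $ i))" and "b = (\<chi> i. real_of_int (z $ i) + 1)"
  have ab: "(b - a) \<bullet> e = 1" if "e \<in> Basis" for e
    using that by (auto simp: Basis_vec_def a_def b_def inner_axis)
  then have le: "a \<bullet> e \<le> b \<bullet> e" if "e \<in> Basis" for e
    using ab[OF that] by (simp add: inner_diff_left)
  have "box a b \<subseteq> cube -` {z}"
  proof
    fix x assume "x \<in> box a b"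
    then have "real_of_int (z $ i) < x $ i" "x $ i < real_of_int (z $ i) + 1" for i
      by (auto simp: mem_box_cart a_def b_def)
    then have "\<lfloor>x $ i\<rfloor> = z $ i" for i by (intro floor_unique) (auto intro: less_imp_le)
    then show "x \<in> cube -` {z}" by (simp add: cube_def vec_eq_iff)
  qed
  moreover have "cube -` {z} \<subseteq> cbox a b"
  proof
    fix x :: "real ^ 'd" assume "x \<in> cube -` {z}"
    then have "z $ i = \<lfloor>x $ i\<rfloor>" for i by (auto simp: cube_def)
    then show "x \<in> cbox a b" by (simp add: mem_box_cart a_def b_def)
  qed
  ultimately have "emeasure lborel (box a b) \<le> emeasure lborel (cube -` {z})"
    "emeasure lborel (cube -` {z}) \<le> emeasure lborel (cbox a b)"
    using cube_borel[of z] by (auto intro!: emeasure_mono)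
  moreover have "emeasure lborel (box a b) = 1" "emeasure lborel (cbox a b) = 1"
    using ab le by (simp_all add: emeasure_lborel_box emeasure_lborel_cbox)
  ultimately have "emeasure lborel (cube -` {z}) = 1" by simp
  then show ?thesis by (simp add: measure_def)
qed

text \<open>Shifted by one index, the series of the mean is the exponential series.\<close>

lemma (in prob_space) poisson_mean:
  fixes N :: "'a \<Rightarrow> nat"
  assumes N [measurable]: "N \<in> M \<rightarrow>\<^sub>M count_space UNIV"
    and P: "\<And>k. prob {\<omega> \<in> space M. N \<omega> = k} = 1 / fact k * exp (- 1)"
  shows "integrable M (\<lambda>\<omega>. real (N \<omega>))" "expectation (\<lambda>\<omega>. real (N \<omega>)) = 1"
proof -
  have series: "(\<lambda>k. real k * (1 / fact k * exp (- 1))) sums 1"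
  proof -
    have "(\<lambda>k. (1 / fact k) * exp (- 1)) sums (exp 1 * exp (- 1 :: real))"
      using exp_converges[of "1 :: real"] by (intro sums_mult2) (simp add: divide_inverse)
    then have "(\<lambda>k. (1 / fact k) * exp (- 1)) sums (1 :: real)" by (simp add: exp_add[symmetric])
    moreover have "(\<lambda>k. real (Suc k) * (1 / fact (Suc k) * exp (- 1))) = (\<lambda>k. (1 / fact k) * exp (- 1))"
      by (rule ext) (simp add: field_simps del: of_nat_Suc)
    ultimately have "(\<lambda>k. real (Suc k) * (1 / fact (Suc k) * exp (- 1))) sums (1 :: real)" by simp
    then show ?thesis using sums_Suc[of "\<lambda>k. real k * (1 / fact k * exp (- 1))" 1] by simp
  qed
  have "(\<integral>\<^sup>+\<omega>. ennreal (real (N \<omega>)) \<partial>M)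
     = (\<integral>\<^sup>+\<omega>. (\<Sum>k. ennreal (real k) * indicator {\<omega> \<in> space M. N \<omega> = k} \<omega>) \<partial>M)"
  proof (intro nn_integral_cong)
    fix \<omega> assume w: "\<omega> \<in> space M"
    have "(\<Sum>k. ennreal (real k) * indicator {\<omega> \<in> space M. N \<omega> = k} \<omega>)
      = (\<Sum>k\<in>{N \<omega>}. ennreal (real k) * indicator {\<omega> \<in> space M. N \<omega> = k} \<omega>)"
      by (rule suminf_finite) auto
    then show "ennreal (real (N \<omega>)) = (\<Sum>k. ennreal (real k) * indicator {\<omega> \<in> space M. N \<omega> = k} \<omega>)"
      using w by simp
  qed
  also have "\<dots> = (\<Sum>k. \<integral>\<^sup>+\<omega>. ennreal (real k) * indicator {\<omega> \<in> space M. N \<omega> = k} \<omega> \<partial>M)"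
    by (intro nn_integral_suminf) measurable
  also have "\<dots> = (\<Sum>k. ennreal (real k * (1 / fact k * exp (- 1))))"
  proof (intro arg_cong[where f = suminf] ext)
    fix k
    have "(\<integral>\<^sup>+\<omega>. ennreal (real k) * indicator {\<omega> \<in> space M. N \<omega> = k} \<omega> \<partial>M)
      = ennreal (real k) * emeasure M {\<omega> \<in> space M. N \<omega> = k}"
      by (intro nn_integral_cmult_indicator) measurable
    then show "(\<integral>\<^sup>+\<omega>. ennreal (real k) * indicator {\<omega> \<in> space M. N \<omega> = k} \<omega> \<partial>M)
      = ennreal (real k * (1 / fact k * exp (- 1)))"
      using P[of k] by (simp add: emeasure_eq_measure ennreal_mult[symmetric])
  qed
  also have "\<dots> = ennreal 1"
    using series by (intro suminf_ennreal_eq) auto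
  finally have I: "(\<integral>\<^sup>+\<omega>. ennreal (real (N \<omega>)) \<partial>M) = ennreal 1" .
  have meas: "(\<lambda>\<omega>. real (N \<omega>)) \<in> borel_measurable M" by measurable
  show "integrable M (\<lambda>\<omega>. real (N \<omega>))"
    using I by (intro integrableI_nonneg meas) auto
  show "expectation (\<lambda>\<omega>. real (N \<omega>)) = 1"
    using I by (subst integral_eq_nn_integral[OF meas]) auto
qed

context kernel_spatial_random_graph
begin

lemma poisson_cube_count:
  assumes vs: "vs = Poisson_Process"
  shows "prob {\<omega> \<in> space M. cube_count z \<omega> = k} = 1 / fact k * exp (- 1)"
    and "integrable M (\<lambda>\<omega>. real (cube_count z \<omega>))" "expectation (\<lambda>\<omega>. real (cube_count z \<omega>)) = 1"
proof -
  have "\<forall>B\<in>sets borel. bounded B \<longrightarrow> (\<forall>k. prob {\<omega> \<in> space M. card (V \<omega> \<inter> B) = k} =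
              measure lborel B ^ k / fact k * exp (- measure lborel B))"
    using vertices_poisson[OF vs] unfolding unit_poisson_process_def by blast
  then have P: "prob {\<omega> \<in> space M. cube_count z \<omega> = k} = 1 / fact k * exp (- 1)" for k
    using cube_borel[of z] bounded_cube[of z] by (simp add: cube_count_def cube_lebesgue)
  then show "prob {\<omega> \<in> space M. cube_count z \<omega> = k} = 1 / fact k * exp (- 1)" .
  show "integrable M (\<lambda>\<omega>. real (cube_count z \<omega>))" "expectation (\<lambda>\<omega>. real (cube_count z \<omega>)) = 1"
    by (rule poisson_mean[OF cube_count_measurable P])+
qed

text \<open>The independence in \<open>unit_poisson_process\<close> is indexed by the regions
  themselves. Grouping them into singletons transfers it to the index \<open>z\<close>; this
  requires different cubes to be different regions, which follows as they are disjoint and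
  nonempty.\<close>

lemma poisson_cube_counts_indep:
  assumes vs: "vs = Poisson_Process" and Z: "finite Z"
  shows "indep_vars (\<lambda>_. count_space UNIV) cube_count Z"
proof -
  define B where "B z = cube -` {z}" for z :: "int ^ 'd"
  have ne: "B z \<noteq> {}" for z
  proof -
    have "(\<chi> i. real_of_int (z $ i)) \<in> B z" by (simp add: B_def cube_def vec_eq_iff)
    then show ?thesis by blast
  qed
  have disj: "B z \<inter> B z' = {}" if "z \<noteq> z'" for z z' using that by (auto simp: B_def)
  have "disjoint (B ` Z)" unfolding disjoint_def
  proof (intro ballI impI)
    fix a b assume "a \<in> B ` Z" "b \<in> B ` Z" "a \<noteq> b"
    then obtain z z' where "a = B z" "b = B z'" "z \<noteq> z'" by auto
    then show "a \<inter> b = {}" using disj by simp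
  qed
  moreover have "\<forall>A\<in>B ` Z. A \<in> sets borel \<and> bounded A" using cube_borel bounded_cube by (auto simp: B_def)
  ultimately have ind: "indep_vars (\<lambda>_. count_space UNIV) (\<lambda>B \<omega>. card (V \<omega> \<inter> B)) (B ` Z)"
    using vertices_poisson[OF vs] Z unfolding unit_poisson_process_def by blast
  have "disjoint_family_on (\<lambda>z. {B z}) Z"
    using disj ne unfolding disjoint_family_on_def by (metis Int_absorb Int_commute disjoint_insert(2) inf_bot_right singletonD)
  from indep_vars_restrict[OF ind _ this]
  have "indep_vars (\<lambda>z. Pi\<^sub>M {B z} (\<lambda>_. count_space UNIV)) (\<lambda>z \<omega>. \<lambda>A\<in>{B z}. card (V \<omega> \<inter> A)) Z" by auto
  from indep_vars_compose2[OF this, of "\<lambda>z x. x (B z)" "\<lambda>_. count_space UNIV"]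
  show ?thesis by (simp add: B_def cube_count_def[abs_def])
qed

text \<open>On the event that the cubes of a layer are empty and every cell has few vertices, which is an
  intersection of independent events that (apart from the layer) have probability at least one half,
  the intensities increase by at most a constant factor.\<close>

lemma poisson_separation_cost:
  fixes Z L :: "(int ^ 'd) set" and c :: "int ^ 'd \<Rightarrow> 'q"
  assumes vs: "vs = Poisson_Process" and Z: "finite Z" and L: "L \<subseteq> Z"
    and x: "x > 0" "\<And>q. 2 * real (card {z \<in> Z - L. c z = q}) \<le> x"
    and g: "\<And>z. g z \<ge> 0" and h: "\<And>z z'. h z z' \<ge> 0"
  defines "ok \<equiv> {\<omega> \<in> space M. (\<forall>z\<in>L. cube_count z \<omega> = 0) \<and>
      (\<forall>q\<in>c ` (Z - L). real (\<Sum>z | z \<in> Z - L \<and> c z = q. cube_count z \<omega>) < x)}"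
  shows "exp (- real (card L) - ln 2 * real (card (c ` (Z - L)))
      - (2 * (\<Sum>z\<in>Z. g z) + 4 * (\<Sum>z\<in>Z. \<Sum>z'\<in>{z'\<in>Z. c z' \<noteq> c z}. h z z')))
    \<le> expectation (\<lambda>\<omega>. indicator ok \<omega> * exp (- separation_cost Z c g h \<omega>))"
proof -
  \<comment> \<open>The independent blocks: \<open>None\<close> stands for the layer
    \<open>L\<close>, and \<open>Some q\<close> for the part of the cell \<open>q\<close> outside
    it.\<close>
  define J where "J = insert None (Some ` c ` (Z - L))"
  define Kj where "Kj j = (case j of None \<Rightarrow> L | Some q \<Rightarrow> {z \<in> Z - L. c z = q})" for j
  define D where "D j y \<longleftrightarrow> (case j of None \<Rightarrow> \<forall>z\<in>L. y z = 0 | Some q \<Rightarrow> real (\<Sum>z\<in>Kj j. y z) < x)"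
    for j and y :: "int ^ 'd \<Rightarrow> nat"
  have finL: "finite L" using L Z by (rule finite_subset)
  have finJ: "finite J" using Z by (simp add: J_def)
  have Kj_Z: "Kj j \<subseteq> Z" for j using L by (auto simp: Kj_def split: option.splits)
  have finK: "finite (Kj j)" for j using Kj_Z Z finite_subset by blast
  have disj: "disjoint_family_on Kj J"
    by (auto simp: disjoint_family_on_def Kj_def J_def split: option.splits)
  have D_cong: "D j (restrict y (Kj j)) = D j y" for j y
    by (cases j) (auto simp: D_def Kj_def)
  note ind = indep_vars_restrict[OF poisson_cube_counts_indep[OF vs Z] Kj_Z disj]
  have pred_D: "Measurable.pred (Pi\<^sub>M (Kj j) (\<lambda>_. count_space UNIV)) (\<lambda>y. D j y)" for j
  proof (cases j)
    case None
    have "Measurable.pred (Pi\<^sub>M L (\<lambda>_. count_space UNIV)) (\<lambda>y. \<forall>z\<in>L. y z = (0 :: nat))"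
      by (intro pred_intros_finite finL) measurable
    then show ?thesis by (simp add: None D_def Kj_def)
  next
    case (Some q)
    have "Measurable.pred (Pi\<^sub>M (Kj j) (\<lambda>_. count_space UNIV)) (\<lambda>y. (\<Sum>z\<in>Kj j. real (y z :: nat)) < x)"
      by measurable
    then show ?thesis by (simp add: Some D_def)
  qed
  define N where "N \<omega> = (\<lambda>z. cube_count z \<omega>)" for \<omega>
  define P where "P j = prob {\<omega> \<in> space M. D j (N \<omega>)}" for j
  have pred_DN: "Measurable.pred M (\<lambda>\<omega>. D j (N \<omega>))" for j
  proof (cases j)
    case None
    have "Measurable.pred M (\<lambda>\<omega>. \<forall>z\<in>L. cube_count z \<omega> = 0)"
      by (intro pred_intros_finite finL) measurable
    then show ?thesis by (simp add: None D_def N_def)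
  next
    case (Some q)
    have "Measurable.pred M (\<lambda>\<omega>. (\<Sum>z\<in>Kj j. real (cube_count z \<omega>)) < x)" by measurable
    then show ?thesis by (simp add: Some D_def N_def)
  qed
  have ok_eq: "ok = {\<omega> \<in> space M. \<forall>j\<in>J. D j (N \<omega>)}"
    unfolding ok_def J_def by (auto simp: D_def Kj_def N_def)
  have ok_meas [measurable]: "ok \<in> events"
    unfolding ok_eq using finJ pred_DN by (intro sets.sets_Collect_finite_All) (auto simp: pred_def)
  have ind_ok: "indicator ok \<omega> = (\<Prod>j\<in>J. of_bool (D j (N \<omega>)) :: real)" if w: "\<omega> \<in> space M" for \<omega>
  proof (cases "\<omega> \<in> ok")
    case False
    then obtain j where "j \<in> J" "of_bool (D j (N \<omega>)) = (0 :: real)" using w by (auto simp: ok_eq)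
    then have "(\<Prod>j\<in>J. of_bool (D j (N \<omega>)) :: real) = 0" using finJ by (intro prod_zero) auto
    then show ?thesis using False by simp
  qed (simp add: ok_eq)
  have EN: "integrable M (\<lambda>\<omega>. real (N \<omega> z))" "expectation (\<lambda>\<omega>. real (N \<omega> z)) = 1" for z
    unfolding N_def by (rule poisson_cube_count[OF vs])+
  have N_meas [measurable]: "(\<lambda>\<omega>. N \<omega> z) \<in> M \<rightarrow>\<^sub>M count_space UNIV" for z unfolding N_def by measurable
  \<comment> \<open>Markov's inequality: the expected number of vertices in a block is its number of
    cubes, which is at most half of \<open>x\<close>.\<close>
  have half: "1 / 2 \<le> P (Some q)" for q
  proof -
    have int: "integrable M (\<lambda>\<omega>. \<Sum>z\<in>Kj (Some q). real (N \<omega> z))" using EN by auto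
    have "prob {\<omega> \<in> space M. (\<Sum>z\<in>Kj (Some q). real (N \<omega> z)) \<ge> x} \<le> expectation (\<lambda>\<omega>. \<Sum>z\<in>Kj (Some q). real (N \<omega> z)) / x"
      by (rule integral_Markov_inequality_measure[OF int, where A = "{}"]) (auto simp: x(1) sum_nonneg)
    also have "expectation (\<lambda>\<omega>. \<Sum>z\<in>Kj (Some q). real (N \<omega> z)) = real (card (Kj (Some q)))"
      using EN by (simp add: Bochner_Integration.integral_sum)
    also have "real (card (Kj (Some q))) / x \<le> 1 / 2"
      using x(2)[of q] x(1) by (simp add: Kj_def field_simps)
    finally have *: "prob {\<omega> \<in> space M. (\<Sum>z\<in>Kj (Some q). real (N \<omega> z)) \<ge> x} \<le> 1 / 2" .
    have "P (Some q) = prob {\<omega> \<in> space M. \<not> (\<Sum>z\<in>Kj (Some q). real (N \<omega> z)) \<ge> x}"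
      unfolding P_def D_def by (intro arg_cong[where f = prob]) auto
    also have "\<dots> = 1 - prob {\<omega> \<in> space M. (\<Sum>z\<in>Kj (Some q). real (N \<omega> z)) \<ge> x}"
      by (rule prob_neg) measurable
    finally show ?thesis using * by simp
  qed
  have P0: "P j \<ge> 0" for j by (simp add: P_def)
  \<comment> \<open>By injectivity of \<open>c\<close> each block contains at most one cube of
    \<open>A\<close>. The count of this cube has mean 1, which is at most \<open>2 * P j\<close>, so
    relative to the probability of \<open>ok\<close> every cube of \<open>A\<close> costs a factor
    2. One cube gives the constant 2 of the conclusion, and two cubes in different cells give the
    constant 4.\<close>
  have weighted: "integrable M (\<lambda>\<omega>. indicator ok \<omega> * (\<Prod>z\<in>A. real (N \<omega> z)))"
    "expectation (\<lambda>\<omega>. indicator ok \<omega> * (\<Prod>z\<in>A. real (N \<omega> z))) \<le> 2 ^ card A * (\<Prod>j\<in>J. P j)"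
    "A = {} \<Longrightarrow> expectation (\<lambda>\<omega>. indicator ok \<omega> * (\<Prod>z\<in>A. real (N \<omega> z))) = (\<Prod>j\<in>J. P j)"
    if A: "A \<subseteq> Z - L" "inj_on c A" for A
  proof -
    have finA: "finite A" using A Z finite_subset by blast
    have img: "(\<lambda>z. Some (c z)) ` A \<subseteq> J" using A(1) by (auto simp: J_def)
    define Aj where "Aj j = {z \<in> A. Some (c z) = j}" for j
    have Aj_K: "Aj j \<subseteq> Kj j" for j using A by (auto simp: Aj_def Kj_def)
    have Aj_cases: "Aj j = {} \<or> (\<exists>z. Aj j = {z} \<and> j = Some (c z))" for j
    proof (cases "Aj j = {}")
      case False
      then obtain z where z: "z \<in> A" "j = Some (c z)" by (auto simp: Aj_def)
      have "Aj j = {z}" using z A(2) by (auto simp: Aj_def inj_on_def)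
      then show ?thesis using z by blast
    qed simp
    define \<phi> where "\<phi> j y = of_bool (D j y) * (\<Prod>z\<in>Aj j. real (y z))" for j and y :: "int ^ 'd \<Rightarrow> nat"
    have \<phi>_cong: "\<phi> j (restrict y (Kj j)) = \<phi> j y" for j y
      unfolding \<phi>_def D_cong using Aj_K[of j] by (intro arg_cong2[where f = "(*)"] prod.cong refl) auto
    have \<phi>_meas: "\<phi> j \<in> borel_measurable (Pi\<^sub>M (Kj j) (\<lambda>_. count_space UNIV))" for j
    proof -
      have comp: "(\<lambda>y. y z) \<in> Pi\<^sub>M (Kj j) (\<lambda>_. count_space UNIV) \<rightarrow>\<^sub>M count_space UNIV" if "z \<in> Aj j" for z
        using that Aj_K by (intro measurable_component_singleton) auto
      have "(\<lambda>y. real (y z :: nat)) \<in> borel_measurable (Pi\<^sub>M (Kj j) (\<lambda>_. count_space UNIV))" if "z \<in> Aj j" for z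
        by (rule measurable_compose[OF comp[OF that]]) simp
      moreover have "(\<lambda>y. of_bool (D j y) :: real) \<in> borel_measurable (Pi\<^sub>M (Kj j) (\<lambda>_. count_space UNIV))"
        using measurable_compose[OF pred_D[of j], of "of_bool :: bool \<Rightarrow> real" borel] by (simp add: pred_def)
      ultimately show ?thesis unfolding \<phi>_def[abs_def] by (intro borel_measurable_times borel_measurable_prod) auto
    qed
    have ind': "indep_vars (\<lambda>_. borel) (\<lambda>j \<omega>. \<phi> j (N \<omega>)) J"
    proof -
      have "indep_vars (\<lambda>_. borel) (\<lambda>j \<omega>. \<phi> j (\<lambda>z\<in>Kj j. cube_count z \<omega>)) J"
        by (rule indep_vars_compose2[OF ind \<phi>_meas])
      then show ?thesis by (simp add: \<phi>_cong N_def)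
    qed
    have intD: "integrable M (\<lambda>\<omega>. of_bool (D j (N \<omega>)) :: real)"
      "expectation (\<lambda>\<omega>. of_bool (D j (N \<omega>)) :: real) = P j" for j
    proof -
      have eq: "(\<lambda>\<omega>. of_bool (D j (N \<omega>)) :: real) = (\<lambda>\<omega>. indicator {\<omega>. D j (N \<omega>)} \<omega>)"
        by (auto simp: indicator_def)
      have "{\<omega> \<in> space M. D j (N \<omega>)} \<in> events" using pred_DN[of j] by (simp add: pred_def)
      then show "integrable M (\<lambda>\<omega>. of_bool (D j (N \<omega>)) :: real)"
        using pred_DN[of j] by (intro integrable_const_bound[of _ 1]) (auto intro: measurable_compose[where g = "of_bool :: bool \<Rightarrow> real"])
      have "expectation (\<lambda>\<omega>. of_bool (D j (N \<omega>)) :: real) = expectation (indicator {\<omega> \<in> space M. D j (N \<omega>)})"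
        by (intro Bochner_Integration.integral_cong refl) auto
      then show "expectation (\<lambda>\<omega>. of_bool (D j (N \<omega>)) :: real) = P j"
        using \<open>{\<omega> \<in> space M. D j (N \<omega>)} \<in> events\<close> by (simp add: P_def Int_absorb2 sets.sets_into_space)
    qed
    have Aj_int: "integrable M (\<lambda>\<omega>. \<phi> j (N \<omega>)) \<and> expectation (\<lambda>\<omega>. \<phi> j (N \<omega>)) \<le> 2 ^ card (Aj j) * P j
        \<and> 0 \<le> expectation (\<lambda>\<omega>. \<phi> j (N \<omega>)) \<and> (Aj j = {} \<longrightarrow> expectation (\<lambda>\<omega>. \<phi> j (N \<omega>)) = P j)" for j
    proof (cases "Aj j = {}")
      case True
      then show ?thesis using intD[of j] P0 by (simp add: \<phi>_def)
    next
      case False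
      then obtain z where z: "Aj j = {z}" "j = Some (c z)" using Aj_cases[of j] by auto
      have le: "0 \<le> \<phi> j (N \<omega>) \<and> \<phi> j (N \<omega>) \<le> real (N \<omega> z)" for \<omega> by (simp add: \<phi>_def z(1))
      have meas: "(\<lambda>\<omega>. \<phi> j (N \<omega>)) \<in> borel_measurable M"
        using ind' pred_DN[of j] unfolding \<phi>_def z(1)
        by (auto intro!: borel_measurable_times intro: measurable_compose[where g = "of_bool :: bool \<Rightarrow> real"])
      have int: "integrable M (\<lambda>\<omega>. \<phi> j (N \<omega>))"
        by (rule Bochner_Integration.integrable_bound[OF EN(1)[of z] meas]) (use le in auto)
      have "expectation (\<lambda>\<omega>. \<phi> j (N \<omega>)) \<le> expectation (\<lambda>\<omega>. real (N \<omega> z))"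
        using int EN le by (intro integral_mono) auto
      then have "expectation (\<lambda>\<omega>. \<phi> j (N \<omega>)) \<le> 2 * P j"
        using EN(2)[of z] half[of "c z"] z(2) by simp
      then show ?thesis using int le z(1) by (auto intro: integral_nonneg_AE)
    qed
    have prod_eq: "indicator ok \<omega> * (\<Prod>z\<in>A. real (N \<omega> z)) = (\<Prod>j\<in>J. \<phi> j (N \<omega>))" if w: "\<omega> \<in> space M" for \<omega>
    proof -
      have "(\<Prod>z\<in>A. real (N \<omega> z)) = (\<Prod>j\<in>J. \<Prod>z\<in>Aj j. real (N \<omega> z))"
        unfolding Aj_def using prod.group[OF finA finJ img, of "\<lambda>z. real (N \<omega> z)"] by simp
      then show ?thesis unfolding ind_ok[OF w] \<phi>_def by (simp add: prod.distrib)
    qed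
    have "integrable M (\<lambda>\<omega>. \<Prod>j\<in>J. \<phi> j (N \<omega>))"
      by (rule indep_vars_integrable[OF finJ ind']) (use Aj_int in auto)
    then show "integrable M (\<lambda>\<omega>. indicator ok \<omega> * (\<Prod>z\<in>A. real (N \<omega> z)))"
      by (subst Bochner_Integration.integrable_cong[OF refl prod_eq])
    have E: "expectation (\<lambda>\<omega>. indicator ok \<omega> * (\<Prod>z\<in>A. real (N \<omega> z))) = (\<Prod>j\<in>J. expectation (\<lambda>\<omega>. \<phi> j (N \<omega>)))"
    proof -
      have "expectation (\<lambda>\<omega>. indicator ok \<omega> * (\<Prod>z\<in>A. real (N \<omega> z))) = expectation (\<lambda>\<omega>. \<Prod>j\<in>J. \<phi> j (N \<omega>))"
        by (intro Bochner_Integration.integral_cong refl prod_eq)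
      also have "\<dots> = (\<Prod>j\<in>J. expectation (\<lambda>\<omega>. \<phi> j (N \<omega>)))"
        by (rule indep_vars_lebesgue_integral[OF finJ ind']) (use Aj_int in auto)
      finally show ?thesis .
    qed
    also have "\<dots> \<le> (\<Prod>j\<in>J. 2 ^ card (Aj j) * P j)" using Aj_int by (intro prod_mono) auto
    also have "\<dots> = 2 ^ (\<Sum>j\<in>J. card (Aj j)) * (\<Prod>j\<in>J. P j)" by (simp add: prod.distrib power_sum)
    also have "(\<Sum>j\<in>J. card (Aj j)) = card A"
      unfolding Aj_def using sum.group[OF finA finJ img, of "\<lambda>_. 1 :: nat"] by simp
    finally show "expectation (\<lambda>\<omega>. indicator ok \<omega> * (\<Prod>z\<in>A. real (N \<omega> z))) \<le> 2 ^ card A * (\<Prod>j\<in>J. P j)" .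
    show "expectation (\<lambda>\<omega>. indicator ok \<omega> * (\<Prod>z\<in>A. real (N \<omega> z))) = (\<Prod>j\<in>J. P j)" if "A = {}"
      unfolding E using Aj_int that by (intro prod.cong) (auto simp: Aj_def)
  qed
  define p0 where "p0 = (\<Prod>j\<in>J. P j)"
  have p0: "p0 \<ge> 0" unfolding p0_def by (intro prod_nonneg) (simp add: P0)
  have Eok: "expectation (indicator ok) = p0" using weighted(3)[of "{}"] by (simp add: p0_def)
  \<comment> \<open>Cubes of the layer are empty on \<open>ok\<close>, which makes the estimates for
    sets \<open>A\<close> outside the layer sufficient.\<close>
  have zero_L: "indicator ok \<omega> * real (N \<omega> z) = 0" if "z \<in> L" for \<omega> z
    using that by (cases "\<omega> \<in> ok") (auto simp: ok_def N_def)
  have single: "integrable M (\<lambda>\<omega>. indicator ok \<omega> * real (N \<omega> z)) \<and>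
    expectation (\<lambda>\<omega>. indicator ok \<omega> * real (N \<omega> z)) \<le> 2 * p0" if "z \<in> Z" for z
  proof (cases "z \<in> L")
    case True
    then show ?thesis using p0 by (simp only: zero_L) simp
  next
    case False
    then show ?thesis using weighted(1,2)[of "{z}"] that by (simp add: p0_def)
  qed
  have pair: "integrable M (\<lambda>\<omega>. indicator ok \<omega> * (real (N \<omega> z) * real (N \<omega> z'))) \<and>
    expectation (\<lambda>\<omega>. indicator ok \<omega> * (real (N \<omega> z) * real (N \<omega> z'))) \<le> 4 * p0"
    if "z \<in> Z" "z' \<in> Z" "c z' \<noteq> c z" for z z'
  proof (cases "z \<in> L \<or> z' \<in> L")
    case True
    then have "indicator ok \<omega> * (real (N \<omega> z) * real (N \<omega> z')) = 0" for \<omega>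
      using zero_L[of z \<omega>] zero_L[of z' \<omega>] by auto
    then show ?thesis using p0 by (simp only:) simp
  next
    case False
    have "z \<noteq> z'" using that by auto
    then have "card {z, z'} = 2" "inj_on c {z, z'}" using that by auto
    then show ?thesis using weighted(1,2)[of "{z, z'}"] that False \<open>z \<noteq> z'\<close> by (simp add: p0_def)
  qed
  have S_eq: "indicator ok \<omega> * separation_cost Z c g h \<omega> = (\<Sum>z\<in>Z. g z * (indicator ok \<omega> * real (N \<omega> z))) +
      (\<Sum>z\<in>Z. \<Sum>z'\<in>{z'\<in>Z. c z' \<noteq> c z}. h z z' * (indicator ok \<omega> * (real (N \<omega> z) * real (N \<omega> z'))))" for \<omega>
    unfolding separation_cost_def N_def by (simp add: sum_distrib_left distrib_left mult_ac)
  define m where "m = 2 * (\<Sum>z\<in>Z. g z) + 4 * (\<Sum>z\<in>Z. \<Sum>z'\<in>{z'\<in>Z. c z' \<noteq> c z}. h z z')"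
  have i1: "integrable M (\<lambda>\<omega>. \<Sum>z\<in>Z. g z * (indicator ok \<omega> * real (N \<omega> z)))"
    using single by (intro Bochner_Integration.integrable_sum integrable_mult_right) auto
  have i2: "integrable M (\<lambda>\<omega>. \<Sum>z\<in>Z. \<Sum>z'\<in>{z'\<in>Z. c z' \<noteq> c z}. h z z' * (indicator ok \<omega> * (real (N \<omega> z) * real (N \<omega> z'))))"
    using pair by (intro Bochner_Integration.integrable_sum integrable_mult_right) auto
  have "p0 * exp (- m) \<le> expectation (\<lambda>\<omega>. indicator ok \<omega> * exp (- separation_cost Z c g h \<omega>))"
    unfolding Eok[symmetric]
  proof (rule exp_jensen_event)
    show "separation_cost Z c g h \<in> borel_measurable M" by measurable
    show "0 \<le> separation_cost Z c g h \<omega>" for \<omega> by (rule separation_cost_nonneg) (use g h in auto)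
    show "integrable M (\<lambda>\<omega>. indicator ok \<omega> * separation_cost Z c g h \<omega>)"
      unfolding S_eq using i1 i2 by (rule Bochner_Integration.integrable_add)
    have "expectation (\<lambda>\<omega>. indicator ok \<omega> * separation_cost Z c g h \<omega>)
      = (\<Sum>z\<in>Z. g z * expectation (\<lambda>\<omega>. indicator ok \<omega> * real (N \<omega> z))) +
        (\<Sum>z\<in>Z. \<Sum>z'\<in>{z'\<in>Z. c z' \<noteq> c z}. h z z' * expectation (\<lambda>\<omega>. indicator ok \<omega> * (real (N \<omega> z) * real (N \<omega> z'))))"
    proof -
      have "expectation (\<lambda>\<omega>. \<Sum>z\<in>Z. g z * (indicator ok \<omega> * real (N \<omega> z)))
          = (\<Sum>z\<in>Z. g z * expectation (\<lambda>\<omega>. indicator ok \<omega> * real (N \<omega> z)))"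
        using single by (subst Bochner_Integration.integral_sum) auto
      moreover have "expectation (\<lambda>\<omega>. \<Sum>z\<in>Z. \<Sum>z'\<in>{z'\<in>Z. c z' \<noteq> c z}. h z z' * (indicator ok \<omega> * (real (N \<omega> z) * real (N \<omega> z'))))
          = (\<Sum>z\<in>Z. \<Sum>z'\<in>{z'\<in>Z. c z' \<noteq> c z}. h z z' * expectation (\<lambda>\<omega>. indicator ok \<omega> * (real (N \<omega> z) * real (N \<omega> z'))))"
        using pair by (subst Bochner_Integration.integral_sum, force intro!: Bochner_Integration.integrable_sum integrable_mult_right,
          intro sum.cong refl, subst Bochner_Integration.integral_sum) auto
      ultimately show ?thesis unfolding S_eq using i1 i2 by simp
    qed
    also have "\<dots> \<le> (\<Sum>z\<in>Z. g z * (2 * p0)) + (\<Sum>z\<in>Z. \<Sum>z'\<in>{z'\<in>Z. c z' \<noteq> c z}. h z z' * (4 * p0))"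
      using single pair g h by (intro add_mono sum_mono mult_left_mono) auto
    also have "\<dots> = p0 * m" by (simp add: m_def sum_distrib_left sum_distrib_right distrib_left mult_ac)
    finally show "expectation (\<lambda>\<omega>. indicator ok \<omega> * separation_cost Z c g h \<omega>) \<le> expectation (indicator ok) * m"
      unfolding Eok .
  qed (auto simp: indicator_def)
  moreover have "exp (- real (card L) - ln 2 * real (card (c ` (Z - L)))) \<le> p0"
  proof -
    have "exp (- real (card L)) = P None"
    proof (cases "L = {}")
      case True
      then show ?thesis by (simp add: P_def D_def prob_space)
    next
      case False
      have "P None = prob (\<Inter>z\<in>L. cube_count z -` {0} \<inter> space M)"
        unfolding P_def D_def N_def using False by (intro arg_cong[where f = prob]) auto
      also have "\<dots> = (\<Prod>z\<in>L. prob (cube_count z -` {0} \<inter> space M))"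
        using False finL L by (intro indep_varsD[OF poisson_cube_counts_indep[OF vs Z]]) auto
      also have "\<dots> = (\<Prod>z\<in>L. exp (- 1))"
      proof (intro prod.cong refl)
        fix z assume "z \<in> L"
        have "cube_count z -` {0} \<inter> space M = {\<omega> \<in> space M. cube_count z \<omega> = 0}" by auto
        then show "prob (cube_count z -` {0} \<inter> space M) = exp (- 1)"
          using poisson_cube_count(1)[OF vs, of z 0] by simp
      qed
      finally show ?thesis by (simp add: exp_of_nat_mult[symmetric])
    qed
    moreover have "exp (- ln 2 * real (card (c ` (Z - L)))) \<le> (\<Prod>j\<in>Some ` c ` (Z - L). P j)"
    proof -
      have "exp (- ln 2 * real (card (c ` (Z - L)))) = (1 / 2 :: real) ^ card (c ` (Z - L))"
        by (simp add: exp_of_nat2_mult exp_minus inverse_eq_divide power_one_over)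
      also have "\<dots> = (\<Prod>j\<in>Some ` c ` (Z - L). 1 / 2)" by (simp add: card_image)
      also have "\<dots> \<le> (\<Prod>j\<in>Some ` c ` (Z - L). P j)" using half by (intro prod_mono) auto
      finally show ?thesis .
    qed
    ultimately have "exp (- real (card L)) * exp (- ln 2 * real (card (c ` (Z - L))))
        \<le> P None * (\<Prod>j\<in>Some ` c ` (Z - L). P j)"
      using P0 by (intro mult_mono) auto
    also have "\<dots> = p0" unfolding p0_def J_def using Z by (subst prod.insert) auto
    finally show ?thesis by (simp add: exp_add[symmetric])
  qed
  ultimately have "exp (- real (card L) - ln 2 * real (card (c ` (Z - L)))) * exp (- m)
      \<le> expectation (\<lambda>\<omega>. indicator ok \<omega> * exp (- separation_cost Z c g h \<omega>))"
    by (meson exp_ge_zero mult_right_mono order_trans)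
  then show ?thesis unfolding m_def mult_exp_exp by (simp only: diff_conv_add_uminus)
qed

end

section \<open>Edge probabilities\<close>

text \<open>Invert the exponential bound on \<open>1 / (1 - q) = 1 + q / (1 - q)\<close>. The price
  of a missing edge is thus linear in its probability as long as this stays below some
  \<open>q0 < 1\<close>.\<close>

lemma one_minus_ge_exp:
  fixes q q0 :: real
  assumes "0 \<le> q" "q \<le> q0" "q0 < 1"
  shows "exp (- (q / (1 - q0))) \<le> 1 - q"
proof -
  have "1 / (1 - q) = 1 + q / (1 - q)" using assms by (simp add: field_simps)
  also have "\<dots> \<le> exp (q / (1 - q))" by (rule exp_ge_add_one_self)
  also have "\<dots> \<le> exp (q / (1 - q0))" using assms by (simp add: frac_le)
  finally have "1 / exp (q / (1 - q0)) \<le> 1 - q" using assms by (simp add: field_simps)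
  then show ?thesis by (simp add: exp_minus inverse_eq_divide)
qed

lemma profile_nonneg: "0 \<le> profile \<alpha> x" by (simp add: profile_def)

lemma profile_le_1: "\<alpha> > 1 \<Longrightarrow> 0 \<le> x \<Longrightarrow> profile \<alpha> x \<le> 1"
  by (cases \<alpha>) (auto simp: profile_def intro!: powr_le1)

lemma profile_mono: "\<alpha> > 1 \<Longrightarrow> 0 \<le> x \<Longrightarrow> x \<le> y \<Longrightarrow> profile \<alpha> x \<le> profile \<alpha> y"
  by (cases \<alpha>) (auto simp: profile_def intro!: powr_mono2)

lemma profile_le_self:
  assumes "\<alpha> > 1" "0 \<le> x" "x < 1"
  shows "profile \<alpha> x \<le> x"
proof (cases \<alpha>)
  case (real a)
  then have "x powr a \<le> x powr 1" using assms by (intro powr_mono') auto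
  then show ?thesis using assms real by (auto simp: profile_def)
qed (use assms in \<open>auto simp: profile_def\<close>)

text \<open>Both summands of \<open>Kernel_sum\<close> are at most the root of order
  \<open>d\<close> of the larger mark. Up to the factor \<open>2 ^ d\<close> this kernel is
  therefore the other one with parameter 0.\<close>

lemma kernel_fun_le:
  assumes d: "d \<ge> 1" and w: "1 \<le> w" "1 \<le> w'"
  shows "0 \<le> kernel_fun d K w w'" 
    "kernel_fun d K w w' \<le> (if K = Kernel_sum then 2 ^ d else 1) * (max w w' * min w w' powr kernel_param K)"
proof -
  show "0 \<le> kernel_fun d K w w'" using w by (cases K) auto
  show "kernel_fun d K w w' \<le> (if K = Kernel_sum then 2 ^ d else 1) * (max w w' * min w w' powr kernel_param K)"
  proof (cases K)
    case Kernel_sum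
    have "w powr (1 / real d) \<le> max w w' powr (1 / real d)" "w' powr (1 / real d) \<le> max w w' powr (1 / real d)"
      using w by (auto intro!: powr_mono2)
    then have "(w powr (1 / real d) + w' powr (1 / real d)) ^ d \<le> (2 * max w w' powr (1 / real d)) ^ d"
      by (intro power_mono) auto
    also have "\<dots> = 2 ^ d * max w w'"
      using d w by (simp add: power_mult_distrib powr_realpow[symmetric] powr_powr)
    finally have "(w powr (1 / real d) + w' powr (1 / real d)) ^ d \<le> 2 ^ d * max w w'" .
    \<comment> \<open>\<open>0 powr 0\<close> is 0, so the power with exponent 0 equals 1 only for a
      nonzero base.\<close>
    moreover have "min w w' \<noteq> 0" using w by (simp add: min_def)
    ultimately show ?thesis by (simp add: Kernel_sum)
  qed simp
qed

lemma floor_log_real_bounds: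
  assumes "D \<ge> 1"
  shows "2 powr real (floor_log D) \<le> real D" "real D \<le> 2 * 2 powr real (floor_log D)"
  using floor_log_bounds[OF assms] unfolding two_powr_nat
  by (metis of_nat_le_iff of_nat_mult of_nat_numeral of_nat_power)+

lemma dyadic_index:
  fixes w :: real
  assumes "1 \<le> w" "w \<le> 2 powr y"
  shows "\<exists>k::nat. k \<le> nat \<lfloor>y\<rfloor> \<and> 2 ^ k \<le> w \<and> w \<le> 2 powr (real k + 1)"
proof -
  define k where "k = nat \<lfloor>log 2 w\<rfloor>"
  have lg: "0 \<le> log 2 w" "log 2 w \<le> y" using assms by (auto simp: log_le_iff zero_le_log_cancel_iff)
  then have k: "real k \<le> log 2 w" "log 2 w \<le> real k + 1" unfolding k_def by linarith+
  have "k \<le> nat \<lfloor>y\<rfloor>" unfolding k_def using lg by (intro nat_mono floor_mono) auto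
  moreover have "2 ^ k \<le> w" using k(1) assms by (simp add: le_log_iff two_powr_nat)
  moreover have "w \<le> 2 powr (real k + 1)" using k(2) assms by (simp add: log_le_iff)
  ultimately show ?thesis by blast
qed

text \<open>The pair interaction: \<open>D\<close> is the distance of two cubes and \<open>l\<close> the side length of the cells; marks
  of vertices at depth at most \<open>min D l\<close> are considered.\<close>

lemma edge_threshold_bound:
  fixes \<alpha> :: ereal and b p s \<gamma> t \<theta> R r :: real and d :: nat
  assumes \<alpha>: "\<alpha> > 1" and b: "b > 0" and p: "0 \<le> p" "p \<le> 1" and s: "s \<ge> 0" and \<gamma>: "\<gamma> > 0" "\<gamma> * (s + 1) \<le> 1"
    and d: "d \<ge> 1" and \<theta>: "\<theta> > 1" and R: "R \<ge> 1" and r: "b * \<theta> powr (s + 1) \<le> r * R ^ d" "r < 1"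
  defines "x \<equiv> real_of_ereal \<alpha> * s - t"
  defines "y \<equiv> real_of_ereal \<alpha> - t + max x 0"
  defines "a \<equiv> (if \<alpha> = \<infinity> then 3 else real_of_ereal \<alpha>)"
    and "e \<equiv> (if \<alpha> = \<infinity> then 0 else \<gamma> * max y 0)"
    and "J \<equiv> (if \<alpha> = \<infinity> \<or> y < 0 then 0 else (if y = 0 then 1 else 0) + (if x = 0 then 1 else 0)) :: nat"
  shows "\<exists>(C :: nat \<Rightarrow> nat \<Rightarrow> nat \<Rightarrow> real) (Kf :: nat \<Rightarrow> nat \<Rightarrow> nat) H. H > 0 \<and> (\<forall>D k m. C D k m \<ge> 0) \<and>
    (\<forall>D l w w'. D \<ge> 1 \<longrightarrow> l \<ge> 1 \<longrightarrow> R \<le> real D \<or> p < 1 \<longrightarrow> 1 \<le> w \<longrightarrow> 1 \<le> w' \<longrightarrow>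
      w \<le> \<theta> * max 1 (real (min D l) / R) powr (real d * \<gamma>) \<longrightarrow>
      w' \<le> \<theta> * max 1 (real (min D l) / R) powr (real d * \<gamma>) \<longrightarrow>
      exp (- thresholds (C D) (Kf D l) w w')
      \<le> 1 - p * profile \<alpha> (b * (max w w' * min w w' powr s) / real D ^ d)) \<and>
    (\<forall>D l. D \<ge> 1 \<longrightarrow> l \<ge> 1 \<longrightarrow>
      (\<Sum>k\<le>Kf D l. \<Sum>m\<le>Kf D l. C D k m * 2 powr (- t * real (k + m)))
      \<le> H * pair_weight d a e J l D)"
proof -
  \<comment> \<open>Edge probabilities are at most \<open>r\<close> from distance \<open>R\<close>
    on, and at most \<open>p\<close> at shorter distances, which are considered only for
    \<open>p < 1\<close>.\<close>
  define q0 where "q0 = (if p < 1 then max r p else r)"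
  have r0: "r > 0"
  proof -
    have "0 < b * \<theta> powr (s + 1)" using b \<theta> by simp
    then have "0 < r * R ^ d" using r(1) by linarith
    then show ?thesis using R by (simp add: zero_less_mult_iff)
  qed
  have q0: "q0 < 1" using r(2) by (simp add: q0_def)
  define c0 where "c0 = 1 / (1 - q0)"
  have c0: "c0 > 0" using q0 by (simp add: c0_def)
  define arg where "arg D w w' = b * (max w w' * min w w' powr s) / real D ^ d" for D :: nat and w w' :: real
  define q where "q D w w' = p * profile \<alpha> (arg D w w')" for D w w'
  define adm where "adm D l w w' \<longleftrightarrow> D \<ge> 1 \<and> l \<ge> 1 \<and> (R \<le> real D \<or> p < 1) \<and> 1 \<le> w \<and> 1 \<le> w' \<and>
      w \<le> \<theta> * max 1 (real (min D l) / R) powr (real d * \<gamma>) \<and>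
      w' \<le> \<theta> * max 1 (real (min D l) / R) powr (real d * \<gamma>)" for D l :: nat and w w' :: real
  have arg0: "0 \<le> arg D w w'" if "1 \<le> w" "1 \<le> w'" for D w w'
    using b that by (simp add: arg_def)
  \<comment> \<open>Both marks are at most \<theta> times the power \<open>d * \<gamma>\<close> of
    \<open>D / R\<close>. As \<open>\<gamma> * (s + 1) \<le> 1\<close>, the kernel is at most
    \<open>\<theta> powr (s + 1) * (D / R) ^ d\<close>, and the assumption on \<open>r\<close> and
    \<open>R\<close> turns this into the bound \<open>r\<close>.\<close>
  have far: "arg D w w' \<le> r" if A: "adm D l w w'" and D: "R \<le> real D" for D l w w'
  proof -
    define f where "f = \<theta> * (real D / R) powr (real d * \<gamma>)"
    have DR: "1 \<le> real D / R" using D R by simp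
    have "max 1 (real (min D l) / R) powr (real d * \<gamma>) \<le> (real D / R) powr (real d * \<gamma>)"
      using DR R \<gamma> d by (intro powr_mono2) (auto simp: divide_right_mono)
    then have wf: "w \<le> f" "w' \<le> f" using A \<theta> unfolding adm_def f_def
      by (smt (verit) mult_left_mono)+
    have f1: "f > 0" using wf A by (auto simp: adm_def)
    have "max w w' * min w w' powr s \<le> f * f powr s"
      using wf A s f1 by (intro mult_mono powr_mono2) (auto simp: adm_def)
    also have "\<dots> = f powr (s + 1)" using f1 by (simp add: powr_add)
    also have "\<dots> = \<theta> powr (s + 1) * (real D / R) powr (real d * (\<gamma> * (s + 1)))"
      using \<theta> DR by (simp add: f_def powr_mult powr_powr mult.assoc)
    also have "\<dots> \<le> \<theta> powr (s + 1) * (real D / R) powr (real d * 1)"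
      using DR \<gamma>(2) d by (intro mult_left_mono powr_mono) auto
    also have "(real D / R) powr (real d * 1) = real D ^ d / R ^ d"
      using DR by (simp add: powr_realpow power_divide)
    finally have "b * (max w w' * min w w' powr s) \<le> b * (\<theta> powr (s + 1) * (real D ^ d / R ^ d))"
      using b by (intro mult_left_mono) auto
    also have "\<dots> = b * \<theta> powr (s + 1) * (real D ^ d / R ^ d)" by simp
    also have "\<dots> \<le> r * R ^ d * (real D ^ d / R ^ d)" using R by (intro mult_right_mono r) auto
    also have "\<dots> = r * real D ^ d" using R by simp
    finally show ?thesis using A by (simp add: arg_def adm_def field_simps)
  qed
  have q_le: "0 \<le> q D w w'" "q D w w' \<le> q0" if A: "adm D l w w'" for D l w w'
  proof -
    have w: "1 \<le> w" "1 \<le> w'" using A by (auto simp: adm_def)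
    show "0 \<le> q D w w'" using p profile_nonneg by (simp add: q_def)
    show "q D w w' \<le> q0"
    proof (cases "R \<le> real D")
      case True
      have "q D w w' \<le> 1 * profile \<alpha> (arg D w w')"
        unfolding q_def using p profile_nonneg by (intro mult_right_mono) auto
      also have "\<dots> \<le> arg D w w'" using far[OF A True] r(2) arg0[OF w] \<alpha> by (simp add: profile_le_self)
      also have "\<dots> \<le> q0" using far[OF A True] by (auto simp: q0_def)
      finally show ?thesis .
    next
      case False
      then have "p < 1" using A by (auto simp: adm_def)
      have "q D w w' \<le> p * 1" unfolding q_def using p profile_le_1[OF \<alpha> arg0[OF w]] by (intro mult_left_mono) auto
      also have "\<dots> \<le> q0" using \<open>p < 1\<close> by (simp add: q0_def)
      finally show ?thesis .
    qed
  qed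
  have exp_q: "exp (- B) \<le> 1 - q D w w'" if A: "adm D l w w'" and B: "c0 * q D w w' \<le> B" for D l w w' B
  proof -
    have "exp (- B) \<le> exp (- (q D w w' / (1 - q0)))" using B by (simp add: c0_def)
    also have "\<dots> \<le> 1 - q D w w'" by (rule one_minus_ge_exp[OF q_le[OF A] q0])
    finally show ?thesis .
  qed
  show ?thesis
  proof (cases "\<alpha> = \<infinity>")
    case True
    \<comment> \<open>For infinite \<alpha> there are no edges at distance \<open>R\<close> or more.
      Nearer pairs get a constant cost, written with the decay \<open>3 * d\<close> so that it fits
      \<open>pair_weight\<close> with \<open>a = 3\<close>; the value 3 is a convention, any number
      above 2 makes \<open>2 - a\<close> negative.\<close>
    define C where "C D k m = (if k = 0 \<and> m = 0 then c0 * R powr (3 * real d) * 2 powr (- 3 * real d * real (floor_log D)) else 0)"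
      for D k m :: nat
    have C0: "C D k m \<ge> 0" for D k m using c0 by (simp add: C_def)
    have "c0 * q D w w' \<le> C D 0 0" if A: "adm D l w w'" for D l w w'
    proof (cases "R \<le> real D")
      case far': True
      have "arg D w w' < 1" using far[OF A far'] r(2) by linarith
      then have "q D w w' = 0" using True by (simp add: q_def profile_def)
      then show ?thesis using C0 by simp
    next
      case False
      have D: "D \<ge> 1" using A by (simp add: adm_def)
      have "q D w w' \<le> 1" using q_le[OF A] q0 by linarith
      also have "1 \<le> (R / real D) powr (3 * real d)" using False D by (intro ge_one_powr_ge_zero) auto
      also have "\<dots> \<le> (R / 2 powr real (floor_log D)) powr (3 * real d)"
        using R floor_log_real_bounds[OF D] D by (intro powr_mono2 divide_left_mono) auto
      also have "\<dots> = R powr (3 * real d) * 2 powr (- 3 * real d * real (floor_log D))"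
        using R by (simp add: powr_divide powr_powr powr_minus_divide mult_ac)
      finally show ?thesis using c0 by (simp add: C_def mult.assoc)
    qed
    then have "exp (- thresholds (C D) 0 w w')
      \<le> 1 - q D w w'" if A: "adm D l w w'" for D l w w'
      using that by (intro exp_q[OF A]) (auto simp: adm_def)
    moreover have "(\<Sum>k\<le>0::nat. \<Sum>m\<le>0::nat. C D k m * 2 powr (- t * real (k + m)))
      \<le> c0 * R powr (3 * real d) * pair_weight d a e J l D" for D l
      using True by (simp add: C_def a_def e_def J_def mult_ac)
    moreover have "c0 * R powr (3 * real d) > 0" using c0 R by simp
    ultimately show ?thesis using C0
      by (intro exI[of _ C] exI[of _ "\<lambda>_ _. 0"] exI[of _ "c0 * R powr (3 * real d)"]) (auto simp: adm_def q_def arg_def)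
  next
    case False
    then have a: "a = real_of_ereal \<alpha>" "a > 1" using \<alpha> by (auto simp: a_def) (cases \<alpha>; simp)
    \<comment> \<open>\<open>c0\<close> comes from \<open>one_minus_ge_exp\<close>; the power of 2
      pays for rounding both marks up to the next power of 2.\<close>
    define B where "B = c0 * b powr a * 2 powr (a + a * s)"
    have B0: "B > 0" using c0 b by (simp add: B_def)
    define C where "C D k m = B * 2 powr (- real d * a * real (floor_log D)) *
        2 powr (a * real (max k m) + a * s * real (min k m))" for D k m :: nat
    have C0: "C D k m \<ge> 0" for D k m using B0 by (simp add: C_def)
    define mn where "mn D l = real (min (floor_log D) (floor_log l))" for D l :: nat
    \<comment> \<open>The binary logarithm of the cap on the marks, where the \<open>+ 1\<close>
      rounds \<open>min D l\<close> up to a power of 2.\<close>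
    define Kr where "Kr D l = log 2 \<theta> + real d * \<gamma> * (mn D l + 1)" for D l
    define Kf where "Kf D l = nat \<lfloor>Kr D l\<rfloor>" for D l
    have Kr0: "Kr D l \<ge> 0" for D l using \<theta> \<gamma> by (simp add: Kr_def mn_def)
    have w_le: "\<theta> * max 1 (real (min D l) / R) powr (real d * \<gamma>) \<le> 2 powr Kr D l" if "D \<ge> 1" "l \<ge> 1" for D l
    proof -
      have "real (min D l) \<le> 2 powr (mn D l + 1)"
      proof -
        have ml: "floor_log (min D l) = min (floor_log D) (floor_log l)"
          using floor_log_le_iff[of D l] floor_log_le_iff[of l D] by (auto simp: min_def)
        have "real (min D l) \<le> 2 * 2 powr real (floor_log (min D l))"
          using that by (intro floor_log_real_bounds) auto
        then show ?thesis by (simp add: mn_def ml powr_add)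
      qed
      moreover have "real (min D l) / R \<le> real (min D l)" using R by (simp add: divide_le_eq mult_le_cancel_left1)
      moreover have "1 \<le> 2 powr (mn D l + 1)" by (intro ge_one_powr_ge_zero) (auto simp: mn_def)
      ultimately have "max 1 (real (min D l) / R) \<le> 2 powr (mn D l + 1)" by linarith
      then have "max 1 (real (min D l) / R) powr (real d * \<gamma>) \<le> (2 powr (mn D l + 1)) powr (real d * \<gamma>)"
        using \<gamma> by (intro powr_mono2) auto
      also have "\<dots> = 2 powr (real d * \<gamma> * (mn D l + 1))" by (simp add: powr_powr mult.commute)
      finally have "\<theta> * max 1 (real (min D l) / R) powr (real d * \<gamma>) \<le> 2 powr (log 2 \<theta>) * 2 powr (real d * \<gamma> * (mn D l + 1))"
        using \<theta> by simp
      then show ?thesis by (simp add: Kr_def powr_add)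
    qed
    have main: "c0 * q D w w' \<le> thresholds (C D) (Kf D l) w w'"
      if A: "adm D l w w'" for D l w w'
    proof -
      have D: "D \<ge> 1" "l \<ge> 1" and w: "1 \<le> w" "1 \<le> w'" using A by (auto simp: adm_def)
      have "w \<le> 2 powr Kr D l" "w' \<le> 2 powr Kr D l"
        using w_le[OF D] A unfolding adm_def by linarith+
      then obtain k m where k: "k \<le> Kf D l" "2 ^ k \<le> w" "w \<le> 2 powr (real k + 1)"
        and m: "m \<le> Kf D l" "2 ^ m \<le> w'" "w' \<le> 2 powr (real m + 1)"
        using dyadic_index[OF w(1)] dyadic_index[OF w(2)] unfolding Kf_def by blast
      have mx: "max w w' \<le> 2 powr (real (max k m) + 1)"
        using k(3) m(3) powr_mono[of "real k + 1" "real (max k m) + 1" 2] powr_mono[of "real m + 1" "real (max k m) + 1" 2]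
        by (auto intro: order_trans)
      have mi: "min w w' \<le> 2 powr (real (min k m) + 1)"
        using k(3) m(3) by (auto simp: min_def split: if_splits)
      have "profile \<alpha> (arg D w w') \<le> arg D w w' powr a"
        using False arg0[OF w] a by (auto simp: profile_def intro!: powr_mono2)
      also have "\<dots> = b powr a * (max w w' powr a * min w w' powr (a * s)) / (real D ^ d) powr a"
        using b w by (simp add: arg_def powr_mult powr_divide powr_powr mult.commute)
      also have "\<dots> \<le> b powr a * ((2 powr (real (max k m) + 1)) powr a * (2 powr (real (min k m) + 1)) powr (a * s)) / (real D ^ d) powr a"
        using mx mi w a s by (intro divide_right_mono mult_left_mono mult_mono powr_mono2) auto
      also have "\<dots> = b powr a * 2 powr (a + a * s) * 2 powr (a * real (max k m) + a * s * real (min k m)) / (real D ^ d) powr a"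
        by (simp add: powr_powr powr_add[symmetric] algebra_simps)
      also have "\<dots> \<le> b powr a * 2 powr (a + a * s) * 2 powr (a * real (max k m) + a * s * real (min k m)) * 2 powr (- real d * a * real (floor_log D))"
      proof -
        have "2 powr (real d * a * real (floor_log D)) = (2 powr real (floor_log D)) powr (real d * a)"
          by (simp add: powr_powr mult_ac)
        also have "\<dots> \<le> real D powr (real d * a)"
          using floor_log_real_bounds[OF D(1)] a by (intro powr_mono2) auto
        also have "\<dots> = (real D ^ d) powr a"
          using D(1) by (simp add: powr_realpow[symmetric] powr_powr)
        finally have "1 / (real D ^ d) powr a \<le> 1 / 2 powr (real d * a * real (floor_log D))"
          by (intro divide_left_mono) (use D(1) in auto)
        also have "\<dots> = 2 powr (- real d * a * real (floor_log D))" by (simp add: powr_minus_divide)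
        finally show ?thesis
          using mult_left_mono[of "1 / (real D ^ d) powr a" "2 powr (- real d * a * real (floor_log D))"
            "b powr a * 2 powr (a + a * s) * 2 powr (a * real (max k m) + a * s * real (min k m))"] by simp
      qed
      finally have pr: "profile \<alpha> (arg D w w') \<le> b powr a * 2 powr (a + a * s) * 2 powr (a * real (max k m) + a * s * real (min k m)) * 2 powr (- real d * a * real (floor_log D))" .
      have "c0 * q D w w' \<le> c0 * profile \<alpha> (arg D w w')"
        unfolding q_def using p c0 profile_nonneg[of \<alpha>] by (intro mult_left_mono mult_left_le_one_le) auto
      also have "\<dots> \<le> C D k m"
        using mult_left_mono[OF pr, of c0] c0 by (simp add: C_def B_def mult_ac)
      also have "\<dots> = C D k m * indicator {w. 2 ^ k \<le> w} w * indicator {w. 2 ^ m \<le> w} w'"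
        using k m by simp
      also have "\<dots> \<le> (\<Sum>m\<le>Kf D l. C D k m * indicator {w. 2 ^ k \<le> w} w * indicator {w. 2 ^ m \<le> w} w')"
        using m(1) C0 by (intro member_le_sum[of m]) auto
      also have "\<dots> \<le> thresholds (C D) (Kf D l) w w'"
        using k(1) C0 by (intro member_le_sum[of k] sum_nonneg) auto
      finally show ?thesis .
    qed
    have xy: "x = a * s - t" "y = a - t + max (a * s - t) 0" by (simp_all add: x_def y_def a)
    obtain C1 where C1: "C1 > 0" "\<And>K::nat. (\<Sum>k\<le>K. \<Sum>m\<le>K. 2 powr (a * real (max k m) + a * s * real (min k m) - t * real (k + m)))
       \<le> C1 * 2 powr (max y 0 * real K) * real (K + 1) ^ J"
      using geo_moment_bound[of a s t] False unfolding J_def xy by auto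
    \<comment> \<open>One constant for two bounds on the number of mark scales: an additive one for
      the exponential factor and a multiplicative one for the logarithmic factor.\<close>
    define u where "u = log 2 \<theta> + real d * \<gamma> + 1"
    have u: "u \<ge> 1" using \<theta> \<gamma> by (simp add: u_def)
    define H where "H = B * C1 * 2 powr (max y 0 * u) * u ^ J"
    have H: "H > 0" using B0 C1(1) u by (simp add: H_def)
    have bound: "(\<Sum>k\<le>Kf D l. \<Sum>m\<le>Kf D l. C D k m * 2 powr (- t * real (k + m)))
      \<le> H * (2 powr (- real d * a * real (floor_log D)) * 2 powr (real d * e * mn D l)
        * (mn D l + 1) ^ J)" for D l
    proof -
      have mn0: "mn D l \<ge> 0" by (simp add: mn_def)
      have Kf: "real (Kf D l) \<le> Kr D l" unfolding Kf_def using Kr0[of D l] by linarith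
      have K1: "real (Kf D l) \<le> u + real d * \<gamma> * mn D l" using Kf by (simp add: Kr_def u_def algebra_simps)
      have K2: "real (Kf D l + 1) \<le> u * (mn D l + 1)"
      proof -
        have "log 2 \<theta> * (mn D l) \<ge> 0" using \<theta> mn0 by simp
        then show ?thesis using Kf mn0 by (simp add: Kr_def u_def algebra_simps)
      qed
      have "(\<Sum>k\<le>Kf D l. \<Sum>m\<le>Kf D l. C D k m * 2 powr (- t * real (k + m)))
        = B * 2 powr (- real d * a * real (floor_log D)) *
          (\<Sum>k\<le>Kf D l. \<Sum>m\<le>Kf D l. 2 powr (a * real (max k m) + a * s * real (min k m) - t * real (k + m)))"
        unfolding sum_distrib_left C_def
        by (intro sum.cong refl) (simp add: powr_add[symmetric] mult.assoc algebra_simps)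
      also have "\<dots> \<le> B * 2 powr (- real d * a * real (floor_log D)) * (C1 * 2 powr (max y 0 * real (Kf D l)) * real (Kf D l + 1) ^ J)"
        using B0 by (intro mult_left_mono C1) auto
      also have "\<dots> \<le> B * 2 powr (- real d * a * real (floor_log D)) *
         (C1 * (2 powr (max y 0 * u) * 2 powr (real d * e * mn D l)) * (u * (mn D l + 1)) ^ J)"
      proof -
        have "2 powr (max y 0 * real (Kf D l)) \<le> 2 powr (max y 0 * (u + real d * \<gamma> * mn D l))"
          using K1 by (intro powr_mono mult_left_mono) auto
        also have "\<dots> = 2 powr (max y 0 * u) * 2 powr (real d * e * mn D l)"
          using False by (simp add: powr_add[symmetric] e_def algebra_simps)
        finally show ?thesis using K2 B0 C1(1) by (intro mult_left_mono mult_mono power_mono) auto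
      qed
      finally show ?thesis by (simp add: H_def power_mult_distrib mult_ac)
    qed
    have mn1: "mn D l + 1 = real (min (floor_log D) (floor_log l) + 1)" for D l by (simp add: mn_def)
    show ?thesis
    proof (intro exI conjI allI impI)
      show "H > 0" by (rule H)
      show "C D k m \<ge> 0" for D k m by (rule C0)
      show "exp (- thresholds (C D) (Kf D l) w w')
        \<le> 1 - p * profile \<alpha> (b * (max w w' * min w w' powr s) / real D ^ d)"
        if "D \<ge> 1" "l \<ge> 1" "R \<le> real D \<or> p < 1" "1 \<le> w" "1 \<le> w'"
          "w \<le> \<theta> * max 1 (real (min D l) / R) powr (real d * \<gamma>)"
          "w' \<le> \<theta> * max 1 (real (min D l) / R) powr (real d * \<gamma>)" for D l w w'
      proof -
        have A: "adm D l w w'" using that by (simp add: adm_def)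
        show ?thesis using exp_q[OF A main[OF A]] by (simp add: q_def arg_def)
      qed
      show "(\<Sum>k\<le>Kf D l. \<Sum>m\<le>Kf D l. C D k m * 2 powr (- t * real (k + m)))
      \<le> H * pair_weight d a e J l D" for D l
        using bound[of D l] unfolding mn1 by (simp add: mn_def)
    qed
  qed
qed

section \<open>Separating the cells\<close>

definition cover_radius :: "nat \<Rightarrow> real \<Rightarrow> nat \<Rightarrow> int" where
  "cover_radius d n l = \<lceil>n powr (1 / real d) / (2 * real l)\<rceil>"

definition covering_cells :: "real \<Rightarrow> nat \<Rightarrow> (int ^ 'd::finite) set" where
  "covering_cells n l = {q. \<forall>i. q $ i \<in> {- cover_radius CARD('d) n l .. cover_radius CARD('d) n l}}"

definition covering_cubes :: "real \<Rightarrow> nat \<Rightarrow> (int ^ 'd::finite) set" where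
  "covering_cubes n l = {z. cell l z \<in> covering_cells n l}"

lemma finite_covering_cells: "finite (covering_cells n l)"
  unfolding covering_cells_def by (rule card_vec_prod) simp

lemma covering_cubes_eq: "covering_cubes n l = (\<Union>q\<in>covering_cells n l. {z. cell l z = q})"
  by (auto simp: covering_cubes_def)

lemma finite_covering_cubes: "l \<ge> 1 \<Longrightarrow> finite (covering_cubes n l)"
  unfolding covering_cubes_eq by (intro finite_UN_I finite_covering_cells finite_cell)

lemma volume_box_cube:
  assumes l: "l \<ge> 1" and x: "x \<in> volume_box n"
  shows "cube x \<in> covering_cubes n l"
  unfolding covering_cubes_def covering_cells_def mem_Collect_eq
proof
  fix i
  let ?r = "cover_radius CARD('a) n l"
  have "\<bar>x $ i\<bar> \<le> n powr (1 / real CARD('a)) / 2" using x by (simp add: volume_box_def)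
  then have "\<bar>x $ i\<bar> / real l \<le> n powr (1 / real CARD('a)) / 2 / real l" by (intro divide_right_mono) auto
  also have "\<dots> = n powr (1 / real CARD('a)) / (2 * real l)" by simp
  also have "\<dots> \<le> real_of_int ?r" by (simp add: cover_radius_def)
  finally have "\<bar>x $ i / real l\<bar> \<le> real_of_int ?r" using l by (simp add: abs_divide)
  then have "- real_of_int ?r \<le> x $ i / real l" "x $ i / real l \<le> real_of_int ?r"
    by (simp_all only: abs_le_iff) linarith
  then have "- ?r \<le> \<lfloor>x $ i / real l\<rfloor>" "\<lfloor>x $ i / real l\<rfloor> \<le> ?r"
    by (auto simp: le_floor_iff floor_le_iff)
  moreover have "\<lfloor>x $ i / real_of_int (int l)\<rfloor> = \<lfloor>x $ i\<rfloor> div int l" by (rule floor_divide_real_eq_div) simp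
  ultimately show "cell l (cube x) $ i \<in> {- ?r .. ?r}" by (simp add: cell_def cube_def)
qed

lemma card_covering_cells:
  assumes n: "n \<ge> 1" and l: "l \<ge> 1" "real l \<le> n powr (1 / real CARD('d))"
  shows "real (card (covering_cells n l :: (int ^ 'd::finite) set)) * real l ^ CARD('d) \<le> 4 ^ CARD('d) * n"
proof -
  define y where "y = n powr (1 / real CARD('d))"
  define r where "r = cover_radius CARD('d) n l"
  have y: "y \<ge> 1" using n by (simp add: y_def ge_one_powr_ge_zero)
  have r0: "r \<ge> 0" unfolding r_def cover_radius_def by (simp add: ceiling_le_iff) (smt (verit) divide_nonneg_nonneg of_nat_0_le_iff powr_ge_zero zero_le_ceiling)
  have "card (covering_cells n l :: (int ^ 'd) set) = nat (2 * r + 1) ^ CARD('d)"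
    unfolding covering_cells_def r_def[symmetric] by (subst card_vec_prod) (auto simp: algebra_simps)
  then have "real (card (covering_cells n l :: (int ^ 'd) set)) * real l ^ CARD('d) = ((2 * real_of_int r + 1) * real l) ^ CARD('d)"
    using r0 by (simp add: power_mult_distrib)
  also have "\<dots> \<le> (4 * y) ^ CARD('d)"
  proof (rule power_mono)
    \<comment> \<open>Rounding adds at most one cell on either side, and the central cell is extra:
      three sides \<open>l\<close> in all. As \<open>l\<close> is at most the side of the box, the
      factor becomes 4.\<close>
    have "real_of_int r \<le> y / (2 * real l) + 1" unfolding r_def cover_radius_def y_def by linarith
    then have "(2 * real_of_int r + 1) * real l \<le> (2 * (y / (2 * real l) + 1) + 1) * real l"
      by (intro mult_right_mono) auto
    also have "\<dots> = y + 3 * real l" using l by (simp add: field_simps)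
    also have "\<dots> \<le> 4 * y" using l(2) by (simp add: y_def)
    finally show "(2 * real_of_int r + 1) * real l \<le> 4 * y" .
  qed (use r0 in auto)
  also have "\<dots> = 4 ^ CARD('d) * n" using n by (simp add: power_mult_distrib y_def powr_realpow[symmetric] powr_powr)
  finally show ?thesis .
qed

context kernel_spatial_random_graph
begin

lemma finite_box_indices: "\<omega> \<in> space M \<Longrightarrow> finite {i. X i \<omega> \<in> volume_box n}"
  using sum_over_indices(1)[OF _ finite_covering_cubes[of 1], of \<omega> n] volume_box_cube[of 1]
  by (auto elim!: rev_finite_subset)

lemma volume_box_borel: "(volume_box n :: (real ^ 'd) set) \<in> sets borel"
proof -
  have "volume_box n = {x :: real ^ 'd. \<forall>i. \<bar>x $ i\<bar> \<le> n powr (1 / real CARD('d)) / 2}"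
    by (simp add: volume_box_def)
  also have "\<dots> \<in> sets borel" by measurable
  finally show ?thesis .
qed

abbreviation small_components :: "real \<Rightarrow> real \<Rightarrow> 'a set" where
  "small_components n x \<equiv>
    {\<omega> \<in> space M. real (largest_component_size (E \<omega>) {i. X i \<omega> \<in> volume_box n}) < x}"

lemma small_component_event:
  "small_components n x \<in> events"
  by (intro largest_component_measurable volume_box_borel finite_box_indices)

lemma cube_count_mean: "integrable M (\<lambda>\<omega>. real (cube_count z \<omega>))" "expectation (\<lambda>\<omega>. real (cube_count z \<omega>)) = 1"
proof -
  have "integrable M (\<lambda>\<omega>. real (cube_count z \<omega>)) \<and> expectation (\<lambda>\<omega>. real (cube_count z \<omega>)) = 1"
  proof (cases vs)
    case Integer_Lattice
    have eq: "real (cube_count z \<omega>) = 1" if "\<omega> \<in> space M" for \<omega>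
      using lattice_cube_count[OF Integer_Lattice that] by simp
    have "integrable M (\<lambda>\<omega>. real (cube_count z \<omega>)) = integrable M (\<lambda>_. 1 :: real)"
      by (intro Bochner_Integration.integrable_cong refl eq)
    moreover have "expectation (\<lambda>\<omega>. real (cube_count z \<omega>)) = expectation (\<lambda>_. 1 :: real)"
      by (intro Bochner_Integration.integral_cong refl eq)
    ultimately show ?thesis by (simp add: prob_space)
  qed (use poisson_cube_count in auto)
  then show "integrable M (\<lambda>\<omega>. real (cube_count z \<omega>))" "expectation (\<lambda>\<omega>. real (cube_count z \<omega>)) = 1" by auto
qed

text \<open>Markov's inequality for the number of vertices in the unit cubes that cover the box. It
  serves large \<rho>, where failure of order \<open>1 / \<rho>\<close> is what the exponential
  bound allows.\<close>

lemma few_vertices_bound: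
  assumes n: "n \<ge> 1" and \<rho>: "\<rho> > 0"
  shows "1 - 4 ^ CARD('d) / \<rho>
    \<le> prob (small_components n (\<rho> * n))"
proof -
  define Z where "Z = (covering_cubes n 1 :: (int ^ 'd) set)"
  have Z: "finite Z" unfolding Z_def by (rule finite_covering_cubes) simp
  have "cell 1 z = z" for z :: "int ^ 'd" by (simp add: cell_def vec_eq_iff)
  then have "Z = covering_cells n 1" by (auto simp: Z_def covering_cubes_def)
  then have cardZ: "real (card Z) \<le> 4 ^ CARD('d) * n"
    using card_covering_cells[OF n, of 1, where 'd = 'd] n by (simp add: ge_one_powr_ge_zero)
  have x: "\<rho> * n > 0" using n \<rho> by simp
  have int: "integrable M (\<lambda>\<omega>. \<Sum>z\<in>Z. real (cube_count z \<omega>))" using cube_count_mean by auto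
  have "prob {\<omega> \<in> space M. (\<Sum>z\<in>Z. real (cube_count z \<omega>)) \<ge> \<rho> * n} \<le> expectation (\<lambda>\<omega>. \<Sum>z\<in>Z. real (cube_count z \<omega>)) / (\<rho> * n)"
    by (rule integral_Markov_inequality_measure[OF int, where A = "{}"]) (auto simp: x sum_nonneg)
  also have "expectation (\<lambda>\<omega>. \<Sum>z\<in>Z. real (cube_count z \<omega>)) = real (card Z)"
    using cube_count_mean by (simp add: Bochner_Integration.integral_sum)
  also have "real (card Z) / (\<rho> * n) \<le> 4 ^ CARD('d) * n / (\<rho> * n)" using cardZ x by (intro divide_right_mono) auto
  also have "\<dots> = 4 ^ CARD('d) / \<rho>" using n by simp
  finally have "1 - 4 ^ CARD('d) / \<rho> \<le> 1 - prob {\<omega> \<in> space M. (\<Sum>z\<in>Z. real (cube_count z \<omega>)) \<ge> \<rho> * n}" by simp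
  also have "\<dots> = prob {\<omega> \<in> space M. \<not> (\<Sum>z\<in>Z. real (cube_count z \<omega>)) \<ge> \<rho> * n}"
    by (rule prob_neg[symmetric]) measurable
  also have "\<dots> \<le> prob (small_components n (\<rho> * n))"
  proof (rule finite_measure_mono[OF _ small_component_event], intro subsetI CollectI, elim CollectE conjE, intro conjI)
    fix \<omega> assume w: "\<omega> \<in> space M" and few: "\<not> \<rho> * n \<le> (\<Sum>z\<in>Z. real (cube_count z \<omega>))"
    show "real (largest_component_size (E \<omega>) {i. X i \<omega> \<in> volume_box n}) < \<rho> * n"
    proof (rule largest_component_size_less[where c = "\<lambda>_. ()"])
      show "finite {i. X i \<omega> \<in> volume_box n}" by (rule finite_box_indices[OF w])
      fix i assume "i \<in> {i. X i \<omega> \<in> volume_box n}"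
      have "card {j \<in> {i. X i \<omega> \<in> volume_box n}. () = ()} \<le> card {i. cube (X i \<omega>) \<in> Z}"
        unfolding Z_def using volume_box_cube[of 1]
        by (intro card_mono sum_over_indices(1)[OF w] finite_covering_cubes) auto
      also have "real \<dots> = (\<Sum>z\<in>Z. real (cube_count z \<omega>))"
        using sum_over_indices(2)[OF w Z, of "\<lambda>_. 1"] by simp
      finally show "real (card {j \<in> {i. X i \<omega> \<in> volume_box n}. () = ()}) < \<rho> * n" using few by simp
    qed (use x in auto)
  qed
  finally show ?thesis .
qed

text \<open>A box of side below 2 around the origin contains no other lattice point. This settles
  the small \<open>n\<close> for which \<open>ln n\<close> may be close to 0.\<close>

lemma lattice_single_vertex:
  assumes vs: "vs = Integer_Lattice" and n: "1 \<le> n" "n < 2" and \<rho>: "1 < \<rho> * n"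
  shows "prob (small_components n (\<rho> * n)) = 1"
proof -
  have "small_components n (\<rho> * n) = space M"
  proof (intro set_eqI iffI)
    fix \<omega> assume w: "\<omega> \<in> space M"
    have sub: "{i. X i \<omega> \<in> volume_box n} \<subseteq> {i. cube (X i \<omega>) = 0}"
    proof clarify
      fix i assume i: "X i \<omega> \<in> volume_box n"
      have "X i \<omega> \<in> integer_lattice"
        using enumeration[OF w] vertices_lattice[OF vs w] by (auto simp: bij_betw_def)
      have "\<lfloor>X i \<omega> $ j\<rfloor> = 0" for j
      proof -
        obtain k where k: "X i \<omega> $ j = real_of_int k"
          using \<open>X i \<omega> \<in> integer_lattice\<close> by (auto simp: integer_lattice_def elim: Ints_cases)
        have "n powr (1 / real CARD('d)) \<le> n powr 1" using n by (intro powr_mono) (auto simp: Suc_leI)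
        then have "\<bar>real_of_int k\<bar> < 1" using i n k unfolding volume_box_def by (smt (verit) mem_Collect_eq powr_one field_sum_of_halves)
        then show ?thesis using k by simp
      qed
      then show "cube (X i \<omega>) = 0" by (simp add: cube_def vec_eq_iff)
    qed
    have "card {i. X i \<omega> \<in> volume_box n} \<le> 1"
      using card_mono[OF indices_in_cube(1)[OF w] sub] indices_in_cube(2)[OF w, of 0] lattice_cube_count[OF vs w, of 0] by simp
    then have "real (largest_component_size (E \<omega>) {i. X i \<omega> \<in> volume_box n}) < \<rho> * n"
      using \<rho> by (intro largest_component_size_less[where c = "\<lambda>_. ()"] finite_box_indices[OF w]) auto
    then show "\<omega> \<in> small_components n (\<rho> * n)"
      using w by simp
  qed simp
  then show ?thesis by (simp add: prob_space)
qed

text \<open>The estimate for a given side \<open>l\<close>, with all constants as parameters so that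
  they can be fixed before the probability space. The conditions relating \<open>l\<close> and
  \<open>x\<close> are restricted to \<open>l > 1\<close> or the lattice, since for
  \<open>l = 1\<close> in the Poisson case every cube belongs to the emptied layer.\<close>

lemma cell_lower_bound:
  fixes t \<gamma> \<theta> R \<zeta> H C1 C2 a e x n :: real and l J \<mu> :: nat
  assumes t: "t > 0" "\<tau> \<noteq> \<infinity> \<Longrightarrow> t = real_of_ereal \<tau> - 1" and \<alpha>: "\<alpha> > 1"
    and \<gamma>: "\<gamma> > 0" and \<theta>: "\<theta> > 1" and R: "R \<ge> 1" and pR: "vs = Integer_Lattice \<Longrightarrow> R = 1 \<or> p < 1"
    and \<zeta>: "(real CARD('d) - 1) / real CARD('d) \<le> \<zeta>"
    and C: "\<And>D k m. C D k m \<ge> (0 :: real)"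
    and edge: "\<And>D l w w'. D \<ge> 1 \<Longrightarrow> l \<ge> 1 \<Longrightarrow> R \<le> real D \<or> p < 1 \<Longrightarrow> 1 \<le> w \<Longrightarrow> 1 \<le> w' \<Longrightarrow>
      w \<le> \<theta> * max 1 (real (min D l) / R) powr (real CARD('d) * \<gamma>) \<Longrightarrow>
      w' \<le> \<theta> * max 1 (real (min D l) / R) powr (real CARD('d) * \<gamma>) \<Longrightarrow>
      exp (- thresholds (C D) (Kf D l) w w')
      \<le> 1 - p * profile \<alpha> ((if vs = Poisson_Process then 2 ^ CARD('d) else 1) * (if K = Kernel_sum then 2 ^ CARD('d) else 1) * \<beta> *
        (max w w' * min w w' powr kernel_param K) / real D ^ CARD('d))"
    and H: "\<And>D l. D \<ge> 1 \<Longrightarrow> l \<ge> 1 \<Longrightarrow>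
      (\<Sum>k\<le>Kf D l. \<Sum>m\<le>Kf D l. C D k m * 2 powr (- t * real (k + m)))
      \<le> H * pair_weight CARD('d) a e J l D"
    and H0: "H > 0" and C1: "C1 > 0" "\<And>l (q :: int ^ 'd). l \<ge> 1 \<Longrightarrow>
      (\<Sum>u | cell l u = q. 2 powr (- real CARD('d) * (\<gamma> * t) * real (floor_log (depth l u))))
      \<le> C1 * real l powr (real CARD('d) * \<zeta>) * real (floor_log l + 1) ^ \<mu>"
    and C2: "C2 > 0" "\<And>l (q :: int ^ 'd) U. l \<ge> 1 \<Longrightarrow> finite U \<Longrightarrow>
      (\<Sum>u | cell l u = q. \<Sum>v\<in>{v \<in> U. cell l v \<noteq> q}.
       pair_weight CARD('d) a e J l (gap u v))
      \<le> C2 * real l powr (real CARD('d) * \<zeta>) * real (floor_log l + 1) ^ \<mu>"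
    and l: "l \<ge> 1" and x: "x > 0" "l > 1 \<or> vs = Integer_Lattice \<Longrightarrow> real l ^ CARD('d) < x"
      "l > 1 \<Longrightarrow> 2 * real l ^ CARD('d) \<le> x"
  defines "A \<equiv> 2 * R * real CARD('d) + ln 2 +
     2 * (R powr (real CARD('d) * \<gamma> * t) * \<theta> powr (- t) / (1 - \<theta> powr (- t))) * C1 + 4 * (H / (1 - \<theta> powr (- t))\<^sup>2) * C2"
  shows "exp (- (real (card (covering_cells n l :: (int ^ 'd) set)) * A * (real l powr (real CARD('d) * \<zeta>) * real (floor_log l + 1) ^ \<mu>)))
    \<le> prob (small_components n x)"
proof -
  define d where "d = CARD('d)"
  have d: "d \<ge> 1" by (simp add: d_def Suc_leI)
  define Q where "Q = (covering_cells n l :: (int ^ 'd) set)"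
  define Z where "Z = (covering_cubes n l :: (int ^ 'd) set)"
  have Q: "finite Q" unfolding Q_def by (rule finite_covering_cells)
  have Z: "finite Z" unfolding Z_def by (rule finite_covering_cubes[OF l])
  have Z_eq: "Z = (\<Union>q\<in>Q. {z. cell l z = q})" by (simp add: Z_def Q_def covering_cubes_eq)
  \<comment> \<open>Poisson vertices on the two sides of a cell boundary may be arbitrarily close,
    and an edge between them may be certain. Hence the cubes of depth at most \<open>R\<close> are
    emptied; lattice points keep their distance.\<close>
  define L where "L = (if vs = Poisson_Process then {z \<in> Z. real (depth l z) \<le> R} else {})"
  have L: "L \<subseteq> Z" by (auto simp: L_def)
  \<comment> \<open>\<theta> > 1 keeps even the smallest cap above 1, so the probability of
    respecting a cap is at least some \<pi> > 0 everywhere.\<close>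
  define f where "f z = \<theta> * max 1 (real (depth l z) / R) powr (real d * \<gamma>)" for z :: "int ^ 'd"
  define \<pi> where "\<pi> = 1 - \<theta> powr (- t)"
  have \<theta>t: "\<theta> powr (- t) < 1" using \<theta> t by (simp add: powr_less_one)
  have \<pi>: "\<pi> > 0" using \<theta>t by (simp add: \<pi>_def)
  \<comment> \<open>The power of \<open>R\<close> compensates the division of the depth by
    \<open>R\<close> in the cap, and the denominator comes from
    \<open>one_minus_ge_exp\<close>.\<close>
  define Cg where "Cg = R powr (real d * \<gamma> * t) * \<theta> powr (- t) / (1 - \<theta> powr (- t))"
  have Cg: "Cg \<ge> 0" using \<theta>t by (simp add: Cg_def)
  define g where "g z = Cg * 2 powr (- real d * (\<gamma> * t) * real (floor_log (depth l z)))" for z :: "int ^ 'd"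
  have g0: "g z \<ge> 0" for z using Cg by (simp add: g_def)
  define h where "h z z' = (\<Sum>k\<le>Kf (gap z z') l. \<Sum>m\<le>Kf (gap z z') l. C (gap z z') k m * 2 powr (- t * real (k + m)) / \<pi>\<^sup>2)"
    for z z' :: "int ^ 'd"
  have h0: "h z z' \<ge> 0" for z z'
    unfolding h_def using C by (intro sum_nonneg divide_nonneg_nonneg mult_nonneg_nonneg) auto
  define B where "B = real l powr (real d * \<zeta>) * real (floor_log l + 1) ^ \<mu>"
  have \<zeta>0: "\<zeta> \<ge> 0"
  proof -
    have "0 \<le> (real d - 1) / real d" using d by simp
    then show ?thesis using \<zeta> unfolding d_def by linarith
  qed
  have log1: "1 \<le> real (floor_log l + 1) ^ \<mu>" by (intro one_le_power) auto
  have surf: "real l ^ (d - 1) \<le> B"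
  proof -
    have "real l ^ (d - 1) = real l powr (real d - 1)" using l d by (simp add: powr_realpow[symmetric] of_nat_diff)
    also have "\<dots> \<le> real l powr (real d * \<zeta>)"
      using \<zeta> l d by (intro powr_mono) (auto simp: d_def[symmetric] field_simps)
    also have "\<dots> \<le> B" unfolding B_def using log1 mult_left_mono[of 1 "real (floor_log l + 1) ^ \<mu>" "real l powr (real d * \<zeta>)"] by simp
    finally show ?thesis .
  qed
  have "1 \<le> real l ^ (d - 1)" using l by (intro one_le_power) simp
  then have B1: "1 \<le> B" using surf by linarith
  \<comment> \<open>\<open>ok\<close> has to be a measurable function of the sequence of locations,
    so the number of vertices of a cell is bounded through all its partial sums.\<close>
  define cap where "cap y q m \<longleftrightarrow> (\<Sum>i<m. indicator (Z - L) (cube (y i)) * indicator {z. cell l z = q} (cube (y i))) < x"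
    for y :: "nat \<Rightarrow> real ^ 'd" and q m
  define ok where "ok y \<longleftrightarrow> (\<forall>i. cube (y i) \<notin> L) \<and> (\<forall>q\<in>Q. \<forall>m. cap y q m)" for y :: "nat \<Rightarrow> real ^ 'd"
  have ok_meas: "Measurable.pred seq_space ok"
  proof -
    have m1: "(\<lambda>y. indicator S (cube (y i)) :: real) \<in> borel_measurable seq_space" for S :: "(int ^ 'd) set" and i :: nat
    proof -
      have "(\<lambda>y. cube (y i)) \<in> Pi\<^sub>M UNIV (\<lambda>_. borel :: (real ^ 'd) measure) \<rightarrow>\<^sub>M count_space UNIV" by measurable
      then show ?thesis by (rule measurable_compose) simp
    qed
    have [measurable]: "Measurable.pred seq_space (\<lambda>y. cap y q m)" for q m
    proof -
      note m1 [measurable]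
      show ?thesis unfolding cap_def by measurable
    qed
    have [measurable]: "Measurable.pred seq_space (\<lambda>y. cube (y i) \<notin> L)" for i
      by measurable
    have "Measurable.pred seq_space (\<lambda>y. \<forall>q\<in>Q. \<forall>m. cap y q m)"
      by (intro pred_intros_finite Q pred_intros_countable) measurable
    then show ?thesis unfolding ok_def[abs_def] by measurable
  qed
  have count_cap: "(\<Sum>i<m. indicator (Z - L) (cube (X i \<omega>)) * indicator {z. cell l z = q} (cube (X i \<omega>)))
      \<le> (\<Sum>z | z \<in> Z - L \<and> cell l z = q. real (cube_count z \<omega>))"
    and count_all: "real (card {i. cube (X i \<omega>) \<in> {z \<in> Z - L. cell l z = q}}) = (\<Sum>z | z \<in> Z - L \<and> cell l z = q. real (cube_count z \<omega>))"
    if w: "\<omega> \<in> space M" for \<omega> q m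
  proof -
    define Aq where "Aq = {z \<in> Z - L. cell l z = q}"
    have Aq: "finite Aq" using Z by (simp add: Aq_def)
    have fin: "finite {i. cube (X i \<omega>) \<in> Aq}" by (rule sum_over_indices(1)[OF w Aq])
    show ca: "real (card {i. cube (X i \<omega>) \<in> {z \<in> Z - L. cell l z = q}}) = (\<Sum>z | z \<in> Z - L \<and> cell l z = q. real (cube_count z \<omega>))"
      using sum_over_indices(2)[OF w Aq, of "\<lambda>_. 1"] by (simp add: Aq_def)
    have "(\<Sum>i<m. indicator (Z - L) (cube (X i \<omega>)) * indicator {z. cell l z = q} (cube (X i \<omega>)))
      = (\<Sum>i<m. indicator {i. cube (X i \<omega>) \<in> Aq} i :: real)"
      by (intro sum.cong refl) (auto simp: indicator_def Aq_def)
    also have "\<dots> = real (card ({..<m} \<inter> {i. cube (X i \<omega>) \<in> Aq}))" by (simp add: indicator_def sum.If_cases)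
    also have "\<dots> \<le> real (card {i. cube (X i \<omega>) \<in> Aq})" using fin by (intro of_nat_mono card_mono) auto
    finally show "(\<Sum>i<m. indicator (Z - L) (cube (X i \<omega>)) * indicator {z. cell l z = q} (cube (X i \<omega>)))
      \<le> (\<Sum>z | z \<in> Z - L \<and> cell l z = q. real (cube_count z \<omega>))"
      using ca by (simp add: Aq_def)
  qed
  have okI: "ok (\<lambda>i. X i \<omega>)" if w: "\<omega> \<in> space M" and empty: "\<And>z. z \<in> L \<Longrightarrow> cube_count z \<omega> = 0"
    and few: "\<And>q. q \<in> Q \<Longrightarrow> (\<Sum>z | z \<in> Z - L \<and> cell l z = q. real (cube_count z \<omega>)) < x" for \<omega>
    unfolding ok_def cap_def
  proof (intro conjI allI ballI)
    fix i
    have "i \<in> {j. cube (X j \<omega>) = cube (X i \<omega>)}" by simp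
    then have "cube_count (cube (X i \<omega>)) \<omega> \<noteq> 0"
      using indices_in_cube[OF w, of "cube (X i \<omega>)"] by (metis card_0_eq empty_iff)
    then show "cube (X i \<omega>) \<notin> L" using empty[of "cube (X i \<omega>)"] by (simp only: not_def) auto
  next
    fix q m assume "q \<in> Q"
    then show "(\<Sum>i<m. indicator (Z - L) (cube (X i \<omega>)) * indicator {z. cell l z = q} (cube (X i \<omega>))) < x"
      by (intro le_less_trans[OF count_cap[OF w] few])
  qed
  have card_Aq: "card {z \<in> Z - L. cell l z = q} \<le> l ^ d" for q
  proof -
    have "card {z \<in> Z - L. cell l z = q} \<le> card {z :: int ^ 'd. cell l z = q}"
      by (intro card_mono finite_cell[OF l]) auto
    then show ?thesis using card_cell[OF l, of q] by (simp add: d_def)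
  qed
  have f_ge: "\<theta> \<le> f z" for z
  proof -
    have "1 \<le> max 1 (real (depth l z) / R) powr (real d * \<gamma>)" using \<gamma> by (intro ge_one_powr_ge_zero) auto
    then show ?thesis using \<theta> mult_left_mono[of 1 "max 1 (real (depth l z) / R) powr (real d * \<gamma>)" \<theta>] by (simp add: f_def)
  qed
  have f_tail: "f z powr (- t) \<le> \<theta> powr (- t)" for z using f_ge \<theta> t by (intro powr_mono2') auto
  have marks: "\<pi> \<le> prob {\<omega> \<in> space M. 1 \<le> W u \<omega> \<and> W u \<omega> \<le> f z}"
    "exp (- g z) \<le> prob {\<omega> \<in> space M. 1 \<le> W u \<omega> \<and> W u \<omega> \<le> f z}" for u z
  proof -
    have mb: "1 - f z powr (- t) \<le> prob {\<omega> \<in> space M. 1 \<le> W u \<omega> \<and> W u \<omega> \<le> f z}"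
      by (rule mark_below[OF t]) (use f_ge[of z] \<theta> in auto)
    then show "\<pi> \<le> prob {\<omega> \<in> space M. 1 \<le> W u \<omega> \<and> W u \<omega> \<le> f z}"
      using f_tail[of z] by (simp add: \<pi>_def)
    have dp: "real (depth l z) \<ge> 1" using depth_pos[of l z] by simp
    have "f z powr (- t) = \<theta> powr (- t) * max 1 (real (depth l z) / R) powr (- (real d * \<gamma> * t))"
      using \<theta> by (simp add: f_def powr_mult powr_powr)
    also have "\<dots> \<le> \<theta> powr (- t) * (2 powr real (floor_log (depth l z)) / R) powr (- (real d * \<gamma> * t))"
    proof (intro mult_left_mono powr_mono2')
      have "2 powr real (floor_log (depth l z)) / R \<le> real (depth l z) / R"
        using R floor_log_real_bounds[OF depth_pos] by (intro divide_right_mono) auto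
      then show "2 powr real (floor_log (depth l z)) / R \<le> max 1 (real (depth l z) / R)" by simp
    qed (use \<gamma> t R in auto)
    also have "\<dots> = R powr (real d * \<gamma> * t) * \<theta> powr (- t) * 2 powr (- real d * (\<gamma> * t) * real (floor_log (depth l z)))"
      using R by (simp add: powr_divide powr_powr powr_minus_divide mult_ac)
    finally have "f z powr (- t) / (1 - \<theta> powr (- t)) \<le> g z"
      using \<theta>t by (simp add: g_def Cg_def divide_right_mono)
    then have "exp (- g z) \<le> exp (- (f z powr (- t) / (1 - \<theta> powr (- t))))" by simp
    also have "\<dots> \<le> 1 - f z powr (- t)" by (rule one_minus_ge_exp) (use f_tail \<theta>t in auto)
    finally show "exp (- g z) \<le> prob {\<omega> \<in> space M. 1 \<le> W u \<omega> \<and> W u \<omega> \<le> f z}" using mb by linarith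
  qed
  have edge': "exp (- thresholds (C (gap z z')) (Kf (gap z z') l) (W i \<omega>) (W j \<omega>)) \<le> 1 - edge_prob i j \<omega>"
    if w: "\<omega> \<in> space M" and ok: "ok (\<lambda>i. X i \<omega>)" and z: "z = cube (X i \<omega>)" "z' = cube (X j \<omega>)" "z \<in> Z" "z' \<in> Z"
      and ne: "cell l z \<noteq> cell l z'"
      and W: "1 \<le> W i \<omega>" "W i \<omega> \<le> f z" "1 \<le> W j \<omega>" "W j \<omega> \<le> f z'" for i j \<omega> z z'
  proof -
    define D where "D = gap z z'"
    have D: "depth l z \<le> D" "depth l z' \<le> D" "1 \<le> D" unfolding D_def by (rule gap_ge_depth[OF l ne])+
    have L': "z \<notin> L" "z' \<notin> L" using ok z by (auto simp: ok_def)
    have DR: "R \<le> real D \<or> p < 1"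
    proof (cases vs)
      case Integer_Lattice
      then show ?thesis using pR D(3) by auto
    next
      case Poisson_Process
      then show ?thesis using L' z D(1) by (auto simp: L_def)
    qed
    \<comment> \<open>Outside the layer depths are at least 2, so \<open>D\<close> is at least 2 and
      \<open>D - 1\<close> is at least \<open>D / 2\<close>. The resulting factor
      \<open>2 ^ d\<close> is part of the constant in \<open>edge\<close>.\<close>
    have dist: "real D / (if vs = Poisson_Process then 2 else 1) \<le> norm (X i \<omega> - X j \<omega>)"
    proof (cases vs)
      case Integer_Lattice
      have "X i \<omega> \<in> integer_lattice" "X j \<omega> \<in> integer_lattice"
        using enumeration[OF w] vertices_lattice[OF Integer_Lattice w] by (auto simp: bij_betw_def)
      then show ?thesis using lattice_distance[of "X i \<omega>" "X j \<omega>"] Integer_Lattice by (simp add: D_def z)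
    next
      case Poisson_Process
      then have "R < real (depth l z)" using L' z by (auto simp: L_def)
      then have "2 \<le> depth l z" using R by linarith
      then have "2 \<le> D" using D(1) by linarith
      then show ?thesis using cube_distance[of "X i \<omega>" "X j \<omega>"] Poisson_Process by (simp add: D_def z)
    qed
    have f_le: "f y \<le> \<theta> * max 1 (real (min D l) / R) powr (real d * \<gamma>)" if "depth l y \<le> D" for y
      unfolding f_def using \<theta> R \<gamma> that depth_le_side[OF l, of y]
      by (intro mult_left_mono powr_mono2 max.mono divide_right_mono) auto
    have "edge_prob i j \<omega> \<le> p * profile \<alpha> ((if vs = Poisson_Process then 2 ^ d else 1) * (if K = Kernel_sum then 2 ^ d else 1) * \<beta> *
        (max (W i \<omega>) (W j \<omega>) * min (W i \<omega>) (W j \<omega>) powr kernel_param K) / real D ^ d)"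
      unfolding edge_prob_def
    proof (intro mult_left_mono profile_mono[OF \<alpha>])
      define \<kappa> where "\<kappa> = max (W i \<omega>) (W j \<omega>) * min (W i \<omega>) (W j \<omega>) powr kernel_param K"
      define kc where "kc = (if K = Kernel_sum then 2 ^ d else 1 :: real)"
      define lam where "lam = (if vs = Poisson_Process then 2 else 1 :: real)"
      have lam: "lam > 0" by (simp add: lam_def)
      have k0: "0 \<le> kc" "0 \<le> \<kappa>" using W by (auto simp: kc_def \<kappa>_def intro!: mult_nonneg_nonneg)
      have k: "0 \<le> kernel_fun CARD('d) K (W i \<omega>) (W j \<omega>)" "kernel_fun CARD('d) K (W i \<omega>) (W j \<omega>) \<le> kc * \<kappa>"
        using kernel_fun_le[of d "W i \<omega>" "W j \<omega>" K] d W by (simp_all add: kc_def \<kappa>_def d_def)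
      show "0 \<le> \<beta> * kernel_fun CARD('d) K (W i \<omega>) (W j \<omega>) / norm (X i \<omega> - X j \<omega>) ^ CARD('d)"
        using beta_pos k by simp
      have "\<beta> * kernel_fun CARD('d) K (W i \<omega>) (W j \<omega>) / norm (X i \<omega> - X j \<omega>) ^ CARD('d)
         \<le> \<beta> * (kc * \<kappa>) / (real D / lam) ^ d"
        unfolding d_def[symmetric] using beta_pos k k0 D lam dist
        by (intro frac_le mult_left_mono power_mono mult_nonneg_nonneg) (auto simp: lam_def d_def)
      also have "\<dots> = lam ^ d * kc * \<beta> * \<kappa> / real D ^ d" by (simp add: power_divide mult_ac)
      also have "lam ^ d = (if vs = Poisson_Process then 2 ^ d else 1)" by (simp add: lam_def)
      finally show "\<beta> * kernel_fun CARD('d) K (W i \<omega>) (W j \<omega>) / norm (X i \<omega> - X j \<omega>) ^ CARD('d)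
        \<le> (if vs = Poisson_Process then 2 ^ d else 1) * (if K = Kernel_sum then 2 ^ d else 1) * \<beta> *
          (max (W i \<omega>) (W j \<omega>) * min (W i \<omega>) (W j \<omega>) powr kernel_param K) / real D ^ d"
        by (simp add: kc_def \<kappa>_def)
    qed (use p_pos in auto)
    moreover have "exp (- thresholds (C D) (Kf D l) (W i \<omega>) (W j \<omega>))
      \<le> 1 - p * profile \<alpha> ((if vs = Poisson_Process then 2 ^ d else 1) * (if K = Kernel_sum then 2 ^ d else 1) * \<beta> *
        (max (W i \<omega>) (W j \<omega>) * min (W i \<omega>) (W j \<omega>) powr kernel_param K) / real D ^ d)"
      unfolding d_def using W f_le[OF D(1)] f_le[OF D(2)]
      by (intro edge D(3) l DR) (auto simp: d_def)
    ultimately show ?thesis unfolding D_def by linarith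
  qed
  have "expectation (\<lambda>\<omega>. indicator {\<omega> \<in> space M. ok (\<lambda>i. X i \<omega>)} \<omega> * exp (- separation_cost Z (cell l) g h \<omega>))
    \<le> prob {\<omega> \<in> space M. ok (\<lambda>i. X i \<omega>) \<and> (\<forall>j. \<forall>i<j. cube (X i \<omega>) \<in> Z \<longrightarrow> cube (X j \<omega>) \<in> Z \<longrightarrow>
      cell l (cube (X i \<omega>)) \<noteq> cell l (cube (X j \<omega>)) \<longrightarrow> {i, j} \<notin> E \<omega>)}"
    unfolding h_def
    by (rule no_crossing_edges[OF Z ok_meas \<pi> marks(1) g0 marks(2) mark_tail[OF t]]) (use C edge' in auto)
  also have "\<dots> \<le> prob (small_components n x)"
  proof (rule finite_measure_mono[OF _ small_component_event], intro subsetI CollectI, elim CollectE conjE, intro conjI)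
    fix \<omega> assume w: "\<omega> \<in> space M" and ok: "ok (\<lambda>i. X i \<omega>)"
      and ne: "\<forall>j. \<forall>i<j. cube (X i \<omega>) \<in> Z \<longrightarrow> cube (X j \<omega>) \<in> Z \<longrightarrow>
      cell l (cube (X i \<omega>)) \<noteq> cell l (cube (X j \<omega>)) \<longrightarrow> {i, j} \<notin> E \<omega>"
    have inZ: "cube (X i \<omega>) \<in> Z - L" if "X i \<omega> \<in> volume_box n" for i
      using volume_box_cube[OF l that] ok by (auto simp: Z_def ok_def)
    show "real (largest_component_size (E \<omega>) {i. X i \<omega> \<in> volume_box n}) < x"
    proof (rule largest_component_size_less[where c = "\<lambda>i. cell l (cube (X i \<omega>))"])
      show "finite {i. X i \<omega> \<in> volume_box n}" by (rule finite_box_indices[OF w])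
      fix i j assume ij: "i \<in> {i. X i \<omega> \<in> volume_box n}" "j \<in> {i. X i \<omega> \<in> volume_box n}" "{i, j} \<in> E \<omega>"
      show "cell l (cube (X i \<omega>)) = cell l (cube (X j \<omega>))"
      proof (rule ccontr)
        assume neq: "cell l (cube (X i \<omega>)) \<noteq> cell l (cube (X j \<omega>))"
        then have "i \<noteq> j" by auto
        then consider "i < j" | "j < i" by linarith
        then show False
        proof cases
          case 1
          then show ?thesis using ne inZ ij neq by blast
        next
          case 2
          have "{j, i} \<in> E \<omega>" using ij(3) by (simp add: insert_commute)
          then show ?thesis using ne inZ ij(1,2) neq 2 by force
        qed
      qed
    next
      fix i assume i: "i \<in> {i. X i \<omega> \<in> volume_box n}"
      define q where "q = cell l (cube (X i \<omega>))"
      define T where "T = {j \<in> {i. X i \<omega> \<in> volume_box n}. cell l (cube (X j \<omega>)) = q}"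
      have finT: "finite T" unfolding T_def using finite_box_indices[OF w] by simp
      obtain m where m: "T \<subseteq> {..<m}" using finT finite_nat_iff_bounded by blast
      have "q \<in> Q" using inZ i by (auto simp: q_def Z_eq)
      then have "cap (\<lambda>i. X i \<omega>) q m" using ok by (simp add: ok_def)
      moreover have "real (card T) \<le> (\<Sum>i<m. indicator (Z - L) (cube (X i \<omega>)) * indicator {z. cell l z = q} (cube (X i \<omega>)))"
      proof -
        have "real (card T) = (\<Sum>i\<in>T. indicator (Z - L) (cube (X i \<omega>)) * indicator {z. cell l z = q} (cube (X i \<omega>)))"
          using inZ by (simp add: T_def)
        also have "\<dots> \<le> (\<Sum>i<m. indicator (Z - L) (cube (X i \<omega>)) * indicator {z. cell l z = q} (cube (X i \<omega>)))"
          using m by (intro sum_mono2) auto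
        finally show ?thesis .
      qed
      ultimately show "real (card {j \<in> {i. X i \<omega> \<in> volume_box n}. cell l (cube (X j \<omega>)) = cell l (cube (X i \<omega>))}) < x"
        by (simp add: cap_def T_def q_def)
    qed (rule x)
  qed
  finally have step1: "expectation (\<lambda>\<omega>. indicator {\<omega> \<in> space M. ok (\<lambda>i. X i \<omega>)} \<omega> * exp (- separation_cost Z (cell l) g h \<omega>))
    \<le> prob (small_components n x)" .
  define G where "G = (\<Sum>z\<in>Z. g z)"
  define HH where "HH = (\<Sum>z\<in>Z. \<Sum>z'\<in>{z'\<in>Z. cell l z' \<noteq> cell l z}. h z z')"
  have G0: "G \<ge> 0" unfolding G_def using g0 by (intro sum_nonneg)
  have HH0: "HH \<ge> 0" unfolding HH_def using h0 by (intro sum_nonneg)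
  have ok_event: "{\<omega> \<in> space M. ok (\<lambda>i. X i \<omega>)} \<in> events"
  proof -
    have "(\<lambda>\<omega> i. X i \<omega>) \<in> M \<rightarrow>\<^sub>M seq_space" by (intro measurable_PiM_single') auto
    from measurable_compose[OF this ok_meas] show ?thesis by (simp add: pred_def)
  qed
  have S0: "separation_cost Z (cell l) g h \<omega> \<ge> 0" for \<omega> by (rule separation_cost_nonneg) (use g0 h0 in auto)
  have int_ok: "integrable M (\<lambda>\<omega>. indicator A \<omega> * exp (- separation_cost Z (cell l) g h \<omega>))" if "A \<in> events" for A
    using that S0 by (intro integrable_const_bound[of _ 1]) (auto simp: indicator_def)
  \<comment> \<open>In the lattice all counts are 1 and the cost is deterministic; the factors 2 and
    4 are those of the Poisson case.\<close>
  have step2: "exp (- (real (card L) + ln 2 * real (card Q) + 2 * G + 4 * HH))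
    \<le> expectation (\<lambda>\<omega>. indicator {\<omega> \<in> space M. ok (\<lambda>i. X i \<omega>)} \<omega> * exp (- separation_cost Z (cell l) g h \<omega>))"
  proof (cases vs)
    case Integer_Lattice
    have N1: "cube_count z \<omega> = 1" if "\<omega> \<in> space M" for z \<omega> using lattice_cube_count[OF Integer_Lattice that] .
    have "L = {}" using Integer_Lattice by (simp add: L_def)
    have okw: "ok (\<lambda>i. X i \<omega>)" if w: "\<omega> \<in> space M" for \<omega>
    proof (rule okI[OF w])
      fix q
      have "real (card {z \<in> Z - L. cell l z = q}) \<le> real (l ^ d)" using card_Aq by (rule of_nat_mono)
      also have "\<dots> < x" using x(2) Integer_Lattice by (simp add: d_def)
      finally show "(\<Sum>z | z \<in> Z - L \<and> cell l z = q. real (cube_count z \<omega>)) < x" using N1[OF w] by simp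
    qed (simp add: \<open>L = {}\<close>)
    have "exp (- (real (card L) + ln 2 * real (card Q) + 2 * G + 4 * HH)) \<le> exp (- (G + HH))"
    proof -
      have "0 \<le> ln 2 * real (card Q)" by simp
      then have "G + HH \<le> real (card L) + ln 2 * real (card Q) + 2 * G + 4 * HH"
        using G0 HH0 of_nat_0_le_iff[of "card L"] by linarith
      then show ?thesis by (simp only: exp_le_cancel_iff neg_le_iff_le)
    qed
    also have "\<dots> = expectation (\<lambda>_. exp (- (G + HH)))" by (simp add: prob_space)
    also have "\<dots> = expectation (\<lambda>\<omega>. indicator {\<omega> \<in> space M. ok (\<lambda>i. X i \<omega>)} \<omega> * exp (- separation_cost Z (cell l) g h \<omega>))"
      by (intro Bochner_Integration.integral_cong refl)
        (simp add: okw separation_cost_def N1 G_def HH_def)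
    finally show ?thesis .
  next
    case Poisson_Process
    define okset where "okset = {\<omega> \<in> space M. (\<forall>z\<in>L. cube_count z \<omega> = 0) \<and>
      (\<forall>q\<in>cell l ` (Z - L). real (\<Sum>z | z \<in> Z - L \<and> cell l z = q. cube_count z \<omega>) < x)}"
    have small: "2 * real (card {z \<in> Z - L. cell l z = q}) \<le> x" for q
    proof (cases "l > 1")
      case True
      have "real (card {z \<in> Z - L. cell l z = q}) \<le> real (l ^ d)" using card_Aq by (rule of_nat_mono)
      then have "2 * real (card {z \<in> Z - L. cell l z = q}) \<le> 2 * real l ^ CARD('d)" by (simp add: d_def)
      then show ?thesis using x(3)[OF True] by linarith
    next
      case False
      \<comment> \<open>In cells of side 1 all cubes have depth 1 and lie in the emptied
        layer.\<close>
      then have "l = 1" using l by simp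
      then have "real (depth l z) \<le> R" for z :: "int ^ 'd" using depth_le_side[of l z] R l by linarith
      then have e: "{z \<in> Z - L. cell l z = q} = {}" using Poisson_Process by (auto simp: L_def)
      show ?thesis unfolding e using x(1) by simp
    qed
    have "exp (- (real (card L) + ln 2 * real (card Q) + 2 * G + 4 * HH))
      \<le> exp (- real (card L) - ln 2 * real (card (cell l ` (Z - L))) - (2 * G + 4 * HH))"
    proof -
      have "cell l ` (Z - L) \<subseteq> Q" by (auto simp: Z_eq)
      then have "card (cell l ` (Z - L)) \<le> card Q" by (rule card_mono[OF Q])
      then have "ln 2 * real (card (cell l ` (Z - L))) \<le> ln 2 * real (card Q)" by (intro mult_left_mono) auto
      then show ?thesis by simp
    qed
    also have "\<dots> \<le> expectation (\<lambda>\<omega>. indicator okset \<omega> * exp (- separation_cost Z (cell l) g h \<omega>))"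
      unfolding G_def HH_def okset_def
      by (rule poisson_separation_cost[OF Poisson_Process Z L x(1) small g0 h0])
    also have "\<dots> \<le> expectation (\<lambda>\<omega>. indicator {\<omega> \<in> space M. ok (\<lambda>i. X i \<omega>)} \<omega> * exp (- separation_cost Z (cell l) g h \<omega>))"
    proof (rule integral_mono[OF int_ok int_ok[OF ok_event]])
      have "Measurable.pred M (\<lambda>\<omega>. \<forall>z\<in>L. cube_count z \<omega> = 0)"
        using L Z by (intro pred_intros_finite) (auto intro: finite_subset)
      moreover have "Measurable.pred M (\<lambda>\<omega>. \<forall>q\<in>cell l ` (Z - L). real (\<Sum>z | z \<in> Z - L \<and> cell l z = q. cube_count z \<omega>) < x)"
        using Z by (intro pred_intros_finite) auto
      ultimately show "okset \<in> events" unfolding okset_def by measurable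
      fix \<omega> assume w: "\<omega> \<in> space M"
      have "ok (\<lambda>i. X i \<omega>)" if o: "\<omega> \<in> okset"
      proof (rule okI[OF w])
        fix q
        show "(\<Sum>z | z \<in> Z - L \<and> cell l z = q. real (cube_count z \<omega>)) < x"
        proof (cases "q \<in> cell l ` (Z - L)")
          case True
          then show ?thesis using o by (auto simp: okset_def)
        next
          case False
          then have e: "{z. z \<in> Z - L \<and> cell l z = q} = {}" by auto
          show ?thesis unfolding e using x(1) by simp
        qed
      qed (use o in \<open>auto simp: okset_def\<close>)
      then show "indicator okset \<omega> * exp (- separation_cost Z (cell l) g h \<omega>)
        \<le> indicator {\<omega> \<in> space M. ok (\<lambda>i. X i \<omega>)} \<omega> * exp (- separation_cost Z (cell l) g h \<omega>)"
        using w by (auto simp: indicator_def)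
    qed
    finally show ?thesis .
  qed
  have over_cells: "(\<Sum>z\<in>Z. F z) = (\<Sum>q\<in>Q. \<Sum>z | cell l z = q. F z)" for F :: "int ^ 'd \<Rightarrow> real"
    unfolding Z_eq by (rule sum.UNION_disjoint[OF Q]) (auto intro: finite_cell[OF l])
  have G_le: "G \<le> real (card Q) * (Cg * C1 * B)"
  proof -
    have "(\<Sum>z | cell l z = q. g z) \<le> Cg * C1 * B" for q
    proof -
      have "(\<Sum>z | cell l z = q. g z) = Cg * (\<Sum>u | cell l u = q. 2 powr (- real CARD('d) * (\<gamma> * t) * real (floor_log (depth l u))))"
        by (simp add: g_def sum_distrib_left d_def)
      also have "\<dots> \<le> Cg * (C1 * real l powr (real CARD('d) * \<zeta>) * real (floor_log l + 1) ^ \<mu>)"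
        by (intro mult_left_mono C1 l Cg)
      finally show ?thesis by (simp add: B_def d_def mult_ac)
    qed
    then have "G \<le> (\<Sum>q\<in>Q. Cg * C1 * B)" unfolding G_def over_cells by (intro sum_mono)
    then show ?thesis by simp
  qed
  have HH_le: "HH \<le> real (card Q) * (H / \<pi>\<^sup>2 * C2 * B)"
  proof -
    have "(\<Sum>z | cell l z = q. \<Sum>z'\<in>{z'\<in>Z. cell l z' \<noteq> cell l z}. h z z') \<le> H / \<pi>\<^sup>2 * C2 * B" for q
    proof -
      define wt where "wt u v = pair_weight CARD('d) a e J l (gap u v)" for u v :: "int ^ 'd"
      have "(\<Sum>z | cell l z = q. \<Sum>z'\<in>{z'\<in>Z. cell l z' \<noteq> cell l z}. h z z')
        \<le> (\<Sum>z | cell l z = q. \<Sum>z'\<in>{z'\<in>Z. cell l z' \<noteq> q}. H / \<pi>\<^sup>2 * wt z z')"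
      proof (intro sum_mono)
        fix z assume z: "z \<in> {z. cell l z = q}"
        have "(\<Sum>z'\<in>{z'\<in>Z. cell l z' \<noteq> cell l z}. h z z') = (\<Sum>z'\<in>{z'\<in>Z. cell l z' \<noteq> q}. h z z')"
          using z by simp
        also have "\<dots> \<le> (\<Sum>z'\<in>{z'\<in>Z. cell l z' \<noteq> q}. H / \<pi>\<^sup>2 * wt z z')"
        proof (rule sum_mono)
          fix z' assume z': "z' \<in> {z'\<in>Z. cell l z' \<noteq> q}"
          have "cell l z \<noteq> cell l z'" using z z' by auto
          then have D1: "1 \<le> gap z z'" by (rule gap_ge_depth(3)[OF l])
          have "h z z' = (\<Sum>k\<le>Kf (gap z z') l. \<Sum>m\<le>Kf (gap z z') l. C (gap z z') k m * 2 powr (- t * real (k + m))) / \<pi>\<^sup>2"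
            by (simp add: h_def sum_divide_distrib)
          also have "\<dots> \<le> H * wt z z' / \<pi>\<^sup>2"
            unfolding wt_def by (intro divide_right_mono H D1 l) auto
          finally show "h z z' \<le> H / \<pi>\<^sup>2 * wt z z'" by simp
        qed
        finally show "(\<Sum>z'\<in>{z'\<in>Z. cell l z' \<noteq> cell l z}. h z z') \<le> (\<Sum>z'\<in>{z'\<in>Z. cell l z' \<noteq> q}. H / \<pi>\<^sup>2 * wt z z')" .
      qed
      also have "\<dots> = H / \<pi>\<^sup>2 * (\<Sum>z | cell l z = q. \<Sum>z'\<in>{z'\<in>Z. cell l z' \<noteq> q}. wt z z')"
        by (simp add: sum_distrib_left)
      also have "\<dots> \<le> H / \<pi>\<^sup>2 * (C2 * real l powr (real CARD('d) * \<zeta>) * real (floor_log l + 1) ^ \<mu>)"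
        unfolding wt_def using H0 by (intro mult_left_mono C2 l Z) auto
      finally show ?thesis by (simp add: B_def d_def mult_ac)
    qed
    then have "HH \<le> (\<Sum>q\<in>Q. H / \<pi>\<^sup>2 * C2 * B)" unfolding HH_def over_cells by (intro sum_mono)
    then show ?thesis by simp
  qed
  have L_le: "real (card L) \<le> real (card Q) * (2 * R * real d * B)"
  proof -
    have "L \<subseteq> (\<Union>q\<in>Q. {z. cell l z = q \<and> depth l z \<le> nat \<lfloor>R\<rfloor>})"
      by (auto simp: L_def Z_eq le_nat_floor split: if_splits)
    then have "card L \<le> card (\<Union>q\<in>Q. {z. cell l z = q \<and> depth l z \<le> nat \<lfloor>R\<rfloor>})"
      using Q by (intro card_mono finite_UN_I) (auto intro: finite_subset[OF _ finite_cell[OF l]])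
    also have "\<dots> \<le> (\<Sum>q\<in>Q. card {z. cell l z = q \<and> depth l z \<le> nat \<lfloor>R\<rfloor>})" by (rule card_UN_le[OF Q])
    also have "\<dots> \<le> (\<Sum>q\<in>Q. d * (2 * nat \<lfloor>R\<rfloor>) * l ^ (d - 1))"
      unfolding d_def by (intro sum_mono card_shallow[OF l])
    finally have "real (card L) \<le> real (card Q * (d * (2 * nat \<lfloor>R\<rfloor>) * l ^ (d - 1)))" by (intro of_nat_mono) simp
    also have "\<dots> = real (card Q) * (2 * real (nat \<lfloor>R\<rfloor>) * real d * real l ^ (d - 1))" by simp
    also have "\<dots> \<le> real (card Q) * (2 * R * real d * B)"
      using surf R by (intro mult_left_mono mult_mono) auto
    finally show ?thesis .
  qed
  \<comment> \<open>The four contributions to \<open>A\<close> are the empty layer, the probability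
    one half per cell of having few vertices, the caps, and the missing edges. The first two are
    covered because \<open>B\<close> is at least of surface order and at least 1.\<close>
  have "real (card L) + ln 2 * real (card Q) + 2 * G + 4 * HH \<le> real (card Q) * A * B"
  proof -
    have "ln 2 * real (card Q) \<le> real (card Q) * (ln 2 * B)"
      using B1 mult_left_mono[of 1 B "ln 2 * real (card Q)"] by (simp add: mult_ac)
    then have "real (card L) + ln 2 * real (card Q) + 2 * G + 4 * HH
      \<le> real (card Q) * (2 * R * real d * B) + real (card Q) * (ln 2 * B) + 2 * (real (card Q) * (Cg * C1 * B))
        + 4 * (real (card Q) * (H / \<pi>\<^sup>2 * C2 * B))"
      using L_le G_le HH_le by linarith
    also have "\<dots> = real (card Q) * A * B"
      unfolding A_def d_def Cg_def \<pi>_def by (simp add: algebra_simps)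
    finally show ?thesis .
  qed
  then have "exp (- (real (card Q) * A * B)) \<le> exp (- (real (card L) + ln 2 * real (card Q) + 2 * G + 4 * HH))" by simp
  then show ?thesis using step1 step2 unfolding Q_def B_def d_def by linarith
qed

end

section \<open>The exponents as extended reals, and the choice of the constants\<close>

lemma zeta_star_eq:
  "zeta_star d \<alpha> \<tau> s = max (max (zeta_ll \<alpha>) (zeta_hl \<alpha> \<tau>)) (max (zeta_hh \<alpha> \<tau> s) (zeta_short d))"
  by (simp add: zeta_star_def zeta_list_def max.assoc)

lemma mult_star_eq:
  "mult_star d \<alpha> \<tau> s = of_bool (zeta_ll \<alpha> = zeta_star d \<alpha> \<tau> s) + of_bool (zeta_hl \<alpha> \<tau> = zeta_star d \<alpha> \<tau> s)
    + of_bool (zeta_hh \<alpha> \<tau> s = zeta_star d \<alpha> \<tau> s) + of_bool (zeta_short d = zeta_star d \<alpha> \<tau> s)"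
  by (simp add: mult_star_def zeta_list_def)

abbreviation moment_exponent :: "ereal \<Rightarrow> real \<Rightarrow> real \<Rightarrow> real" where
  "moment_exponent \<alpha> s t \<equiv> real_of_ereal \<alpha> - t + max (real_of_ereal \<alpha> * s - t) 0"

text \<open>For \<open>\<tau> = \<infinity>\<close> the marks satisfy every Pareto tail bound, so a large exponent \<open>t\<close> can be chosen.\<close>

lemma exponent_data:
  fixes \<alpha> \<tau> :: ereal and s :: real and d :: nat
  assumes \<alpha>: "\<alpha> > 1" and \<tau>: "\<tau> > 2" and s: "s \<ge> 0" and d: "d \<ge> 1"
  defines "\<zeta> \<equiv> real_of_ereal (zeta_star d \<alpha> \<tau> s)" and "\<mu> \<equiv> mult_star d \<alpha> \<tau> s - 1"
  shows "\<exists>t \<gamma>. t > 0 \<and> (\<tau> \<noteq> \<infinity> \<longrightarrow> t = real_of_ereal \<tau> - 1) \<and> \<gamma> > 0 \<and> \<gamma> * (s + 1) \<le> 1 \<and>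
    (real d - 1) / real d \<le> \<zeta> \<and> admissible d \<zeta> \<mu> (1 - \<gamma> * t) 0 \<and>
    admissible d \<zeta> \<mu> (2 - (if \<alpha> = \<infinity> then 3 else real_of_ereal \<alpha>)
        + (if \<alpha> = \<infinity> then 0 else \<gamma> * max (moment_exponent \<alpha> s t) 0))
      (if \<alpha> = \<infinity> \<or> moment_exponent \<alpha> s t < 0 then 0
       else (if moment_exponent \<alpha> s t = 0 then 1 else 0)
        + (if real_of_ereal \<alpha> * s - t = 0 then 1 else 0))"
proof -
  define sh where "sh = (real d - 1) / real d"
  have sh0: "sh \<ge> 0" using d by (simp add: sh_def)
  have short: "zeta_short d = ereal sh" by (simp add: zeta_short_def sh_def)
  consider (fin) a t where "\<alpha> = ereal a" "\<tau> = ereal (t + 1)" "a > 1" "t > 1"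
    | (t_inf) a where "\<alpha> = ereal a" "\<tau> = \<infinity>" "a > 1"
    | (a_inf) t where "\<alpha> = \<infinity>" "\<tau> = ereal (t + 1)" "t > 1"
    | (inf) "\<alpha> = \<infinity>" "\<tau> = \<infinity>"
  proof (cases \<alpha>)
    case a: (real a)
    show ?thesis
    proof (cases \<tau>)
      case (real t)
      then show ?thesis using a \<alpha> \<tau> that(1)[of a "t - 1"] by simp
    qed (use a \<alpha> \<tau> that in auto)
  next
    case a: PInf
    show ?thesis
    proof (cases \<tau>)
      case (real t)
      then show ?thesis using a \<alpha> \<tau> that(3)[of "t - 1"] by simp
    qed (use a \<alpha> \<tau> that in auto)
  qed (use \<alpha> in auto)
  then show ?thesis
  proof cases
    case fin
    define zhl where "zhl = t / a - (t - 1)"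
    define zhh where "zhh = (if t \<le> s + 1 then (s + 1 - t) / (s + 1 - t / a) else (s + 1 - t) / (s + 1))"
    define z where "z = max (max (2 - a) zhl) (max zhh sh)"
    have D: "s + 1 - t / a \<noteq> 0" if "t \<le> s + 1"
    proof -
      have "t / a < t" using fin by (simp add: field_simps)
      then show ?thesis using that by linarith
    qed
    have ll: "zeta_ll \<alpha> = ereal (2 - a)"
      by (simp add: zeta_ll_def fin(1))
    have t1: "\<tau> - 1 = ereal t" "\<tau> - 2 = ereal (t - 1)"
      by (simp_all add: fin(2) one_ereal_def)
    have hl: "zeta_hl \<alpha> \<tau> = ereal zhl"
      unfolding zeta_hl_def t1 using fin by (simp add: zhl_def)
    have hh: "zeta_hh \<alpha> \<tau> s = ereal zhh"
      unfolding zeta_hh_def t1 using fin s D by (auto simp: zhh_def)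
    have star: "zeta_star d \<alpha> \<tau> s = ereal z"
      unfolding zeta_star_eq ll hl hh short z_def by (simp add: max_def)
    have \<zeta>: "\<zeta> = z" by (simp add: \<zeta>_def star)
    have \<mu>: "\<mu> = of_bool (2 - a = z) + of_bool (zhl = z) + of_bool (zhh = z) + of_bool (sh = z) - 1"
      unfolding \<mu>_def mult_star_eq star ll hl hh short by simp
    note adm = admissible_exponents[OF fin(3,4) s d, folded zhl_def zhh_def sh_def, folded z_def, folded \<mu>]
    have \<alpha>': "(\<alpha> = \<infinity>) = False" "real_of_ereal \<alpha> = a" by (simp_all add: fin)
    have short': "(real d - 1) / real d \<le> z" by (simp add: z_def sh_def)
    show ?thesis unfolding \<alpha>' \<zeta> if_False simp_thms
    proof (rule exI[of _ t], rule exI[of _ "(1 - max zhl zhh) / t"], intro conjI impI)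
      show "t > 0" "t = real_of_ereal \<tau> - 1" using fin by simp_all
    qed (fact adm short')+
  next
    case t_inf
    define z where "z = max (2 - a) sh"
    have ll: "zeta_ll \<alpha> = ereal (2 - a)"
      by (simp add: zeta_ll_def t_inf(1))
    have hl: "zeta_hl \<alpha> \<tau> = - \<infinity>" "zeta_hh \<alpha> \<tau> s = - \<infinity>"
      by (simp_all add: zeta_hl_def zeta_hh_def t_inf(2))
    have star: "zeta_star d \<alpha> \<tau> s = ereal z"
      unfolding zeta_star_eq ll hl short z_def by (simp add: max_def)
    have \<zeta>: "\<zeta> = z" by (simp add: \<zeta>_def star)
    have \<mu>: "\<mu> = of_bool (2 - a = z) + of_bool (sh = z) - 1"
      unfolding \<mu>_def mult_star_eq star ll hl short by simp
    \<comment> \<open>So large that both mark sums converge (\<open>t > a * s\<close> and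
      \<open>t > a\<close>) and that \<open>\<gamma> * t\<close> is at least 2, which makes the
      exponent of the suppressed marks negative.\<close>
    define t where "t = 2 * (s + 1) / (1 - 1 / a) + a + a * s"
    define \<gamma> where "\<gamma> = (1 - 1 / a) / (s + 1)"
    have a1: "0 < 1 - 1 / a" "1 - 1 / a \<le> 1" using t_inf(3) by auto
    have \<gamma>: "\<gamma> > 0" "\<gamma> * (s + 1) \<le> 1" using a1 s by (auto simp: \<gamma>_def)
    have "2 * (s + 1) / (1 - 1 / a) > 0" using a1 s by simp
    moreover have "a * s \<ge> 0" using t_inf(3) s by simp
    ultimately have t: "t > 0" "t > a" "t > a * s" "t \<ge> 2 * (s + 1) / (1 - 1 / a)"
      using t_inf(3) unfolding t_def by linarith+
    have "\<gamma> * t \<ge> \<gamma> * (2 * (s + 1) / (1 - 1 / a))" using \<gamma> t(4) by (intro mult_left_mono) auto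
    also have "\<gamma> * (2 * (s + 1) / (1 - 1 / a)) = 2"
    proof -
      have "u / v * (2 * v / u) = 2" if "u > 0" "v > 0" for u v :: real using that by simp
      then show ?thesis unfolding \<gamma>_def using a1(1) s by (simp only: add_nonneg_pos zero_less_one)
    qed
    finally have "1 - \<gamma> * t < 0" by simp
    moreover have "0 \<le> \<zeta>" using sh0 by (simp add: \<zeta> z_def)
    ultimately have "1 - \<gamma> * t < \<zeta>" by linarith
    then have "admissible d \<zeta> \<mu> (1 - \<gamma> * t) 0" by (simp add: admissible_def)
    moreover have "admissible d \<zeta> \<mu> (2 - a) 0"
      unfolding admissible_def \<zeta> \<mu> z_def sh_def[symmetric] by (auto simp: max_def)
    moreover have "\<alpha> \<noteq> \<infinity>" "real_of_ereal \<alpha> = a" by (simp_all add: t_inf)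
    moreover have "sh \<le> \<zeta>" by (simp add: \<zeta> z_def)
    ultimately show ?thesis using t \<gamma> t_inf(2)
      by - (rule exI[of _ t], rule exI[of _ \<gamma>], simp add: sh_def)
  next
    case a_inf
    define zhh where "zhh = (s + 1 - t) / (s + 1)"
    define z where "z = max zhh sh"
    have ll: "zeta_ll \<alpha> = - \<infinity>" by (simp add: zeta_ll_def a_inf(1))
    have t1: "\<tau> - 2 = ereal (t - 1)" by (simp add: a_inf(2) one_ereal_def)
    have hl: "zeta_hl \<alpha> \<tau> = ereal (1 - t)"
      unfolding zeta_hl_def t1 using a_inf by simp
    have hh: "zeta_hh \<alpha> \<tau> s = ereal zhh"
      using s by (simp add: zeta_hh_def a_inf zhh_def)
    have star: "zeta_star d \<alpha> \<tau> s = ereal z"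
      unfolding zeta_star_eq ll hl hh short z_def using a_inf(3) sh0 by (simp add: max_def)
    have \<zeta>: "\<zeta> = z" by (simp add: \<zeta>_def star)
    have z0: "z \<ge> 0" using sh0 by (simp add: z_def)
    have \<mu>: "\<mu> = of_bool (zhh = z) + of_bool (sh = z) - 1"
      unfolding \<mu>_def mult_star_eq star ll hl hh short using a_inf(3) z0 by simp
    \<comment> \<open>For infinite \<alpha> the only upper bound on \<gamma> is the one that
      prevents certain edges; it is attained here.\<close>
    have "1 - 1 / (s + 1) * t = zhh" using s by (simp add: zhh_def field_simps)
    then have "admissible d \<zeta> \<mu> (1 - 1 / (s + 1) * t) 0"
      unfolding admissible_def \<zeta> \<mu> z_def sh_def[symmetric] by (auto simp: max_def)
    moreover have "admissible d \<zeta> \<mu> (2 - 3) 0" using z0 by (simp add: admissible_def \<zeta>)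
    moreover have "real_of_ereal \<tau> - 1 = t" by (simp add: a_inf(2))
    moreover have "sh \<le> \<zeta>" by (simp add: \<zeta> z_def)
    ultimately show ?thesis using a_inf s
      by - (rule exI[of _ t], rule exI[of _ "1 / (s + 1)"], simp add: sh_def)
  next
    case inf
    have ll: "zeta_ll \<alpha> = - \<infinity>" by (simp add: zeta_ll_def inf)
    have hl: "zeta_hl \<alpha> \<tau> = - \<infinity>" "zeta_hh \<alpha> \<tau> s = - \<infinity>"
      by (simp_all add: zeta_hl_def zeta_hh_def inf)
    have star: "zeta_star d \<alpha> \<tau> s = ereal sh"
      unfolding zeta_star_eq ll hl short by (simp add: max_def)
    have \<zeta>: "\<zeta> = sh" by (simp add: \<zeta>_def star)
    have "1 - 1 / (s + 1) * (2 * (s + 1)) = -1"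
    proof -
      have "1 - 1 / v * (2 * v) = -1" if "v > 0" for v :: real using that by simp
      then show ?thesis using s by (simp only: add_nonneg_pos zero_less_one)
    qed
    then have "1 - 1 / (s + 1) * (2 * (s + 1)) < \<zeta>" using sh0 \<zeta> by linarith
    then have "admissible d \<zeta> \<mu> (1 - 1 / (s + 1) * (2 * (s + 1))) 0" by (simp add: admissible_def)
    moreover have "admissible d \<zeta> \<mu> (2 - 3) 0" using sh0 by (simp add: admissible_def \<zeta>)
    ultimately show ?thesis using inf s \<zeta>
      by - (rule exI[of _ "2 * (s + 1)"], rule exI[of _ "1 / (s + 1)"], simp add: sh_def)
  qed
qed

text \<open>\<open>P\<close> expresses that pairs at bounded distance are harmless, as their cubes
  are emptied or as \<open>p < 1\<close>; then a large \<open>R\<close> absorbs \<open>b\<close>.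
  Otherwise the graph lives on the lattice with \<open>p = 1\<close>, nearest neighbours force
  \<open>R = 1\<close>, and only the room between \<open>b\<close> and 1 is left for
  \<theta>.\<close>

lemma mark_threshold_choice:
  fixes b s :: real and d :: nat
  assumes b: "b > 0" and s: "s \<ge> 0" and d: "d \<ge> 1" and small: "\<not> P \<Longrightarrow> b < 1"
  shows "\<exists>\<theta> R r. \<theta> > 1 \<and> R \<ge> 1 \<and> r < 1 \<and> b * \<theta> powr (s + 1) \<le> r * R ^ d \<and> (\<not> P \<longrightarrow> R = 1)"
proof (cases P)
  case True
  define R where "R = max 1 (2 * b * 2 powr (s + 1))"
  have "2 * b * 2 powr (s + 1) \<le> R" by (simp add: R_def)
  also have "R \<le> R ^ d" using d by (intro self_le_power) (auto simp: R_def)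
  finally have "b * 2 powr (s + 1) \<le> 1 / 2 * R ^ d" by simp
  then show ?thesis using True by (intro exI[of _ 2] exI[of _ R] exI[of _ "1 / 2"]) (auto simp: R_def)
next
  case False
  then have b1: "b < 1" by (rule small)
  define \<theta> where "\<theta> = ((1 + b) / (2 * b)) powr (1 / (s + 1))"
  have q: "(1 + b) / (2 * b) > 1" using b b1 by (simp add: field_simps)
  have "\<theta> > 1" unfolding \<theta>_def using q s by (intro gr_one_powr) auto
  moreover have "b * \<theta> powr (s + 1) = (1 + b) / 2" using q s b by (simp add: \<theta>_def powr_powr)
  ultimately show ?thesis using b1 by (intro exI[of _ \<theta>] exI[of _ 1] exI[of _ "(1 + b) / 2"]) auto
qed

text \<open>The aim is \<open>l ^ d\<close> near \<open>\<rho> * n / 2\<close>, where the 2 leaves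
  room for Markov's inequality in the Poisson case. The bound on \<rho> keeps the cell no larger
  than the box. A target below 1 is rounded up to 1, which is why the upper bound on the volume is
  claimed for \<open>l > 1\<close> only.\<close>

lemma cell_side_choice:
  fixes n \<rho> :: real and d :: nat
  assumes n: "n \<ge> 1" and \<rho>: "0 < \<rho>" "\<rho> \<le> 2" and d: "d \<ge> 1"
  shows "\<exists>l::nat. l \<ge> 1 \<and> real l \<le> n powr (1 / real d) \<and> (l > 1 \<longrightarrow> 2 * real l ^ d \<le> \<rho> * n) \<and>
    \<rho> * n \<le> 2 * 2 ^ d * real l ^ d"
proof -
  define y where "y = (\<rho> * n / 2) powr (1 / real d)"
  have y0: "y > 0" using n \<rho> by (simp add: y_def)
  have yd: "y ^ d = \<rho> * n / 2" using n \<rho> d by (simp add: y_def powr_realpow[symmetric] powr_powr)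
  have yn: "y \<le> n powr (1 / real d)" unfolding y_def using n \<rho> by (intro powr_mono2) auto
  have n1: "1 \<le> n powr (1 / real d)" using n by (intro ge_one_powr_ge_zero) auto
  define l where "l = max 1 (nat \<lfloor>y\<rfloor>)"
  have fl: "real (nat \<lfloor>y\<rfloor>) \<le> y" using y0 by simp
  have "l \<ge> 1" by (simp add: l_def)
  moreover have "real l \<le> n powr (1 / real d)" using fl yn n1 by (auto simp: l_def)
  moreover have "2 * real l ^ d \<le> \<rho> * n" if "l > 1"
  proof -
    have "real l \<le> y" using that fl by (auto simp: l_def)
    then have "real l ^ d \<le> y ^ d" by (intro power_mono) auto
    then show ?thesis using yd by simp
  qed
  moreover have "\<rho> * n \<le> 2 * 2 ^ d * real l ^ d"
  proof -
    have "y \<le> 2 * real l"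
    proof (cases "y < 1")
      case False
      then have "y \<le> real (nat \<lfloor>y\<rfloor>) + 1" "1 \<le> nat \<lfloor>y\<rfloor>" by (auto simp: le_nat_floor)
      then show ?thesis by (auto simp: l_def max_def)
    qed (auto simp: l_def)
    then have "y ^ d \<le> (2 * real l) ^ d" using y0 by (intro power_mono) auto
    then show ?thesis using yd by (simp add: power_mult_distrib)
  qed
  ultimately show ?thesis by blast
qed

lemma ln_2_ge_half: "1 / 2 \<le> ln (2 :: real)"
proof -
  have "ln (1 / 2 :: real) \<le> 1 / 2 - 1" by (intro ln_le_minus_one) simp
  then show ?thesis by (simp add: ln_div)
qed

text \<open>At \<open>n = 1\<close> the right side vanishes for positive \<mu>, hence the assumption
  on \<open>n\<close>. The factor is 4 because both \<open>floor_log l\<close> and 1 are at most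
  \<open>2 * ln n\<close>.\<close>

lemma floor_log_power_le:
  fixes n :: real
  assumes l: "l \<ge> 1" "real l \<le> n" and n: "n \<ge> 2 \<or> \<mu> = 0"
  shows "real (floor_log l + 1) ^ \<mu> \<le> 4 ^ \<mu> * ln n ^ \<mu>"
proof (cases "\<mu> = 0")
  case False
  then have n2: "n \<ge> 2" using n by simp
  have l2: "ln 2 \<le> ln n" using n2 by simp
  have "2 powr real (floor_log l) \<le> n" using floor_log_real_bounds[OF l(1)] l(2) by linarith
  then have "ln (2 powr real (floor_log l)) \<le> ln n" using n2 by (subst ln_le_cancel_iff) auto
  then have "real (floor_log l) * ln 2 \<le> ln n" by (simp add: ln_powr)
  moreover have "real (floor_log l) * (1 / 2) \<le> real (floor_log l) * ln 2"
    using ln_2_ge_half by (intro mult_left_mono) auto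
  ultimately have "real (floor_log l + 1) \<le> 4 * ln n" using l2 ln_2_ge_half by simp
  then have "real (floor_log l + 1) ^ \<mu> \<le> (4 * ln n) ^ \<mu>" by (intro power_mono) auto
  then show ?thesis by (simp add: power_mult_distrib)
qed simp

text \<open>The side conditions reflect obstructions. A lattice box contains the origin, so its
  largest component is never below \<open>\<rho> * n\<close> when this is at most 1. At
  \<open>n = 1\<close> a positive power of \<open>ln n\<close> makes the right side equal to 1,
  which the Poisson case does not reach. Finally \<open>Kernel_sum\<close> is at least
  \<open>2 ^ d\<close>, so \<open>p = 1\<close> and \<open>2 ^ d * \<beta> \<ge> 1\<close> would
  join all nearest neighbours of the lattice. The constant precedes the probability space and
  depends on the parameters only.\<close>

theorem theorem2p4:
  fixes vs :: vertex_space and K :: kernel and \<alpha> \<tau> :: ereal and \<beta> p :: real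
  assumes "\<alpha> > 1" and "\<tau> > 2" and "kernel_param K \<ge> 0"
    and "vs = Integer_Lattice \<Longrightarrow> K = Kernel_sum \<Longrightarrow> min p (2 ^ CARD('d::finite) * \<beta>) < 1"
  shows "\<exists>A>0. \<forall>(M :: 'a measure) (V :: 'a \<Rightarrow> (real ^ 'd) set) X W E.
    kernel_spatial_random_graph M vs K \<alpha> \<tau> \<beta> p V X W E \<longrightarrow>
    (\<forall>\<rho>>0. \<forall>n\<ge>1.
      (vs = Integer_Lattice \<longrightarrow> 1 < \<rho> * n) \<longrightarrow>
      (vs = Poisson_Process \<and> mult_star CARD('d) \<alpha> \<tau> (kernel_param K) > 1 \<longrightarrow> n \<ge> 2) \<longrightarrow>
      measure M {\<omega> \<in> space M.
        real (largest_component_size (E \<omega>) {i. X i \<omega> \<in> volume_box n}) < \<rho> * n}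
      \<ge> exp (- (A / \<rho>) * n powr real_of_ereal (zeta_star CARD('d) \<alpha> \<tau> (kernel_param K))
              * ln n ^ (mult_star CARD('d) \<alpha> \<tau> (kernel_param K) - 1)))"
proof (cases "\<beta> > 0 \<and> p > 0 \<and> p \<le> 1 \<and> (vs = Integer_Lattice \<longrightarrow> min p \<beta> < 1)")
  case False
  \<comment> \<open>For such parameters the model has no instance, and any constant will do.\<close>
  have "\<not> kernel_spatial_random_graph M vs K \<alpha> \<tau> \<beta> p V X W E"
    for M :: "'a measure" and V :: "'a \<Rightarrow> (real ^ 'd) set" and X W E
  proof
    assume "kernel_spatial_random_graph M vs K \<alpha> \<tau> \<beta> p V X W E"
    then interpret kernel_spatial_random_graph M vs K \<alpha> \<tau> \<beta> p V X W E .
    show False using False beta_pos p_pos p_le_1 lattice_nontrivial by blast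
  qed
  then show ?thesis by (intro exI[of _ 1]) auto
next
  case True
  then have \<beta>: "\<beta> > 0" and p: "p > 0" "p \<le> 1" and nontriv: "vs = Integer_Lattice \<Longrightarrow> min p \<beta> < 1" by auto
  define s where "s = kernel_param K"
  have s: "s \<ge> 0" using assms(3) by (simp add: s_def)
  have d: "CARD('d) \<ge> 1" by (simp add: Suc_leI)
  define \<zeta> where "\<zeta> = real_of_ereal (zeta_star CARD('d) \<alpha> \<tau> s)"
  define \<mu> where "\<mu> = mult_star CARD('d) \<alpha> \<tau> s - 1"
  obtain t \<gamma> where t: "t > 0" "\<tau> \<noteq> \<infinity> \<Longrightarrow> t = real_of_ereal \<tau> - 1" and \<gamma>: "\<gamma> > 0" "\<gamma> * (s + 1) \<le> 1"
    and short: "(real CARD('d) - 1) / real CARD('d) \<le> \<zeta>"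
    and adm1: "admissible CARD('d) \<zeta> \<mu> (1 - \<gamma> * t) 0"
    and adm2: "admissible CARD('d) \<zeta> \<mu> (2 - (if \<alpha> = \<infinity> then 3 else real_of_ereal \<alpha>)
        + (if \<alpha> = \<infinity> then 0 else \<gamma> * max (moment_exponent \<alpha> s t) 0))
      (if \<alpha> = \<infinity> \<or> moment_exponent \<alpha> s t < 0 then 0
       else (if moment_exponent \<alpha> s t = 0 then 1 else 0)
        + (if real_of_ereal \<alpha> * s - t = 0 then 1 else 0))"
    using exponent_data[OF assms(1,2) s d] unfolding \<zeta>_def \<mu>_def by metis
  define a where "a = (if \<alpha> = \<infinity> then 3 else real_of_ereal \<alpha>)"
  define e where "e = (if \<alpha> = \<infinity> then 0 else \<gamma> * max (moment_exponent \<alpha> s t) 0)"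
  define J where "J = (if \<alpha> = \<infinity> \<or> moment_exponent \<alpha> s t < 0 then 0
       else (if moment_exponent \<alpha> s t = 0 then 1 else 0)
        + (if real_of_ereal \<alpha> * s - t = 0 then 1 else 0 :: nat))"
  have a: "a > 1" using assms(1) by (cases \<alpha>) (auto simp: a_def)
  have e: "e \<ge> 0" using \<gamma> by (simp add: e_def)
  have \<zeta>0: "\<zeta> \<ge> 0"
  proof -
    have "0 \<le> (real CARD('d) - 1) / real CARD('d)" using d by simp
    then show ?thesis using short by linarith
  qed
  define b where "b = (if vs = Poisson_Process then 2 ^ CARD('d) else 1) * (if K = Kernel_sum then 2 ^ CARD('d) else 1) * \<beta>"
  have b: "b > 0" using \<beta> by (simp add: b_def)
  have small: "b < 1" if "\<not> (vs = Poisson_Process \<or> p < 1)"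
  proof -
    have vs: "vs = Integer_Lattice" using that by (cases vs) auto
    show ?thesis using nontriv[OF vs] assms(4)[OF vs] that by (auto simp: b_def vs min_def split: if_splits)
  qed
  obtain \<theta> R r where \<theta>: "\<theta> > 1" and R: "R \<ge> 1" and r: "b * \<theta> powr (s + 1) \<le> r * R ^ CARD('d)" "r < 1"
    and PR: "\<not> (vs = Poisson_Process \<or> p < 1) \<longrightarrow> R = 1"
    using mark_threshold_choice[OF b s d small] by blast
  have pR: "R = 1 \<or> p < 1" if "vs = Integer_Lattice" using PR that by auto
  obtain C Kf H where H: "H > 0" and C: "\<forall>D k m. C D k m \<ge> 0"
    and edge: "\<forall>D l w w'. D \<ge> 1 \<longrightarrow> l \<ge> 1 \<longrightarrow> R \<le> real D \<or> p < 1 \<longrightarrow> 1 \<le> w \<longrightarrow> 1 \<le> w' \<longrightarrow>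
      w \<le> \<theta> * max 1 (real (min D l) / R) powr (real CARD('d) * \<gamma>) \<longrightarrow>
      w' \<le> \<theta> * max 1 (real (min D l) / R) powr (real CARD('d) * \<gamma>) \<longrightarrow>
      exp (- thresholds (C D) (Kf D l) w w')
      \<le> 1 - p * profile \<alpha> (b * (max w w' * min w w' powr s) / real D ^ CARD('d))"
    and bound: "\<forall>D l. D \<ge> 1 \<longrightarrow> l \<ge> 1 \<longrightarrow>
      (\<Sum>k\<le>Kf D l. \<Sum>m\<le>Kf D l. C D k m * 2 powr (- t * real (k + m)))
      \<le> H * pair_weight CARD('d) a e J l D"
    using edge_threshold_bound[OF assms(1) b less_imp_le[OF p(1)] p(2) s \<gamma> d \<theta> R r, of t,
        folded a_def, folded e_def, folded J_def] by blast
  obtain C1 where C1: "C1 > 0" "\<forall>l\<ge>1. \<forall>q :: int ^ 'd.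
      (\<Sum>u | cell l u = q. 2 powr (- real CARD('d) * (\<gamma> * t) * real (floor_log (depth l u))))
      \<le> C1 * real l powr (real CARD('d) * \<zeta>) * real (floor_log l + 1) ^ \<mu>"
    using cell_vertex_sum[OF short adm1] by blast
  obtain C2 where C2: "C2 > 0" "\<forall>l\<ge>1. \<forall>q :: int ^ 'd. \<forall>U. finite U \<longrightarrow>
      (\<Sum>u | cell l u = q. \<Sum>v\<in>{v \<in> U. cell l v \<noteq> q}.
       pair_weight CARD('d) a e J l (gap u v))
      \<le> C2 * real l powr (real CARD('d) * \<zeta>) * real (floor_log l + 1) ^ \<mu>"
    using cell_pair_sum[OF a e short adm2[folded a_def e_def J_def]] by blast
  define A1 where "A1 = 2 * R * real CARD('d) + ln 2 +
     2 * (R powr (real CARD('d) * \<gamma> * t) * \<theta> powr (- t) / (1 - \<theta> powr (- t))) * C1 + 4 * (H / (1 - \<theta> powr (- t))\<^sup>2) * C2"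
  have \<theta>t: "\<theta> powr (- t) < 1" using \<theta> t by (simp add: powr_less_one)
  have A1: "A1 > 0" unfolding A1_def
    using R \<theta>t C1(1) C2(1) H d by (intro add_pos_nonneg add_nonneg_pos mult_nonneg_nonneg divide_nonneg_nonneg) auto
  define m where "m = (4 :: real) ^ CARD('d)"
  have m1: "m \<ge> 1" by (simp add: m_def)
  \<comment> \<open>There are at most \<open>m * (2 * 2 ^ d) / \<rho>\<close> cells,
    \<open>A1\<close> is the constant per cell, and \<open>4 ^ \<mu>\<close> converts binary into
    natural logarithms.\<close>
  define A2 where "A2 = m * (2 * 2 ^ CARD('d)) * A1 * 4 ^ \<mu>"
  have A2: "A2 > 0" using A1 m1 by (simp add: A2_def)
  define A where "A = A2 * m + 2 * m * 2 ^ \<mu>"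
  have A: "A > 0" unfolding A_def using A2 m1 by (intro add_pos_pos mult_pos_pos) auto
  have A_ge: "A2 * m \<le> A" "A2 \<le> A" "2 * m * 2 ^ \<mu> \<le> A"
  proof -
    have "0 \<le> 2 * m * 2 ^ \<mu>" "A2 * 1 \<le> A2 * m" "0 \<le> A2 * m" using A2 m1 by (auto intro: mult_left_mono)
    then show "A2 * m \<le> A" "A2 \<le> A" "2 * m * 2 ^ \<mu> \<le> A" by (simp_all add: A_def)
  qed
  show ?thesis
  proof (intro exI[of _ A] conjI allI impI A)
    fix M :: "'a measure" and V :: "'a \<Rightarrow> (real ^ 'd) set" and X W E and \<rho> n :: real
    assume G: "kernel_spatial_random_graph M vs K \<alpha> \<tau> \<beta> p V X W E" and \<rho>: "0 < \<rho>" and n: "1 \<le> n"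
      and lat: "vs = Integer_Lattice \<longrightarrow> 1 < \<rho> * n"
      and poi: "vs = Poisson_Process \<and> 1 < mult_star CARD('d) \<alpha> \<tau> (kernel_param K) \<longrightarrow> 2 \<le> n"
    interpret kernel_spatial_random_graph M vs K \<alpha> \<tau> \<beta> p V X W E by (rule G)
    define P where "P \<rho> = prob (small_components n (\<rho> * n))"
      for \<rho>
    define B where "B = n powr \<zeta> * ln n ^ \<mu>"
    have B0: "B \<ge> 0" using n by (simp add: B_def)
    have mono: "exp (- (A' / \<rho>') * B) \<le> exp (- (A'' / \<rho>'') * B)" if "A'' / \<rho>'' \<le> A' / \<rho>'" for A' A'' \<rho>' \<rho>''
      using mult_right_mono[OF that B0] by simp
    have "exp (- (A / \<rho>) * B) \<le> P \<rho>"
    proof (cases "vs = Integer_Lattice \<and> n < 2")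
      case True
      then have "P \<rho> = 1" unfolding P_def using lat n by (intro lattice_single_vertex) auto
      moreover have "0 \<le> A / \<rho> * B" using A \<rho> B0 by simp
      ultimately show ?thesis by simp
    next
      case False
      then have n2: "n \<ge> 2 \<or> \<mu> = 0" using poi by (cases vs) (auto simp: \<mu>_def s_def)
      have main: "exp (- (A2 / \<rho>) * B) \<le> P \<rho>" if \<rho>: "0 < \<rho>" "\<rho> \<le> 2" and lat: "vs = Integer_Lattice \<longrightarrow> 1 < \<rho> * n" for \<rho>
      proof -
        obtain l :: nat where l: "l \<ge> 1" "real l \<le> n powr (1 / real CARD('d))" "l > 1 \<Longrightarrow> 2 * real l ^ CARD('d) \<le> \<rho> * n"
          "\<rho> * n \<le> 2 * 2 ^ CARD('d) * real l ^ CARD('d)"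
          using cell_side_choice[OF n \<rho> d] by blast
        have ld: "real l ^ CARD('d) > 0" using l(1) by simp
        have x0: "\<rho> * n > 0" using \<rho> n by simp
        have lx: "real l ^ CARD('d) < \<rho> * n" if "l > 1 \<or> vs = Integer_Lattice"
        proof (cases "l > 1")
          case True
          then show ?thesis using l(3) ld by linarith
        next
          case False
          then show ?thesis using that lat l(1) by (cases "l = 1") auto
        qed
        have low: "exp (- (real (card (covering_cells n l :: (int ^ 'd) set)) * A1 * (real l powr (real CARD('d) * \<zeta>) * real (floor_log l + 1) ^ \<mu>))) \<le> P \<rho>"
          unfolding A1_def P_def
          by (rule cell_lower_bound[OF t assms(1) \<gamma>(1) \<theta> R pR short C[rule_format] edge[unfolded b_def s_def, rule_format]
                bound[rule_format] H C1(1) C1(2)[rule_format] C2(1) C2(2)[rule_format] l(1) x0 lx l(3)])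
        have cells: "real (card (covering_cells n l :: (int ^ 'd) set)) \<le> m * (2 * 2 ^ CARD('d)) / \<rho>"
        proof -
          have "real (card (covering_cells n l :: (int ^ 'd) set)) * real l ^ CARD('d) \<le> m * n"
            unfolding m_def by (rule card_covering_cells[OF n l(1,2)])
          also have "\<dots> \<le> m * (2 * 2 ^ CARD('d) * real l ^ CARD('d) / \<rho>)"
            using l(4) \<rho> m1 by (intro mult_left_mono) (auto simp: field_simps)
          also have "\<dots> = m * (2 * 2 ^ CARD('d)) / \<rho> * real l ^ CARD('d)" by simp
          finally show ?thesis using ld by (rule mult_right_le_imp_le)
        qed
        have n1: "n powr (1 / real CARD('d)) \<le> n"
          using powr_mono[of "1 / real CARD('d)" 1 n] n d by simp
        have "real l powr (real CARD('d) * \<zeta>) \<le> (n powr (1 / real CARD('d))) powr (real CARD('d) * \<zeta>)"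
          using l \<zeta>0 by (intro powr_mono2) auto
        also have "\<dots> = n powr \<zeta>" by (simp add: powr_powr)
        finally have pw: "real l powr (real CARD('d) * \<zeta>) \<le> n powr \<zeta>" .
        have lg: "real (floor_log l + 1) ^ \<mu> \<le> 4 ^ \<mu> * ln n ^ \<mu>"
          using l n1 by (intro floor_log_power_le n2) auto
        have "real (card (covering_cells n l :: (int ^ 'd) set)) * A1 * (real l powr (real CARD('d) * \<zeta>) * real (floor_log l + 1) ^ \<mu>)
          \<le> m * (2 * 2 ^ CARD('d)) / \<rho> * A1 * (n powr \<zeta> * (4 ^ \<mu> * ln n ^ \<mu>))"
          using cells pw lg A1 m1 \<rho> by (intro mult_mono) auto
        also have "\<dots> = A2 / \<rho> * B" by (simp add: A2_def B_def)
        finally show ?thesis using low by (simp add: order_trans[rotated])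
      qed
      \<comment> \<open>The cells can be chosen for \<rho> at most 2. Up to \<open>2 * m\<close> the
        case of the value 2 is reused by monotonicity, at the price of the factor \<open>m\<close>
        in the first summand of \<open>A\<close>. Beyond that, few vertices suffice, which accounts
        for the second summand.\<close>
      consider "\<rho> \<le> 2" | "2 < \<rho>" "\<rho> \<le> 2 * m" | "\<rho> > 2 * m" by linarith
      then show ?thesis
      proof cases
        case 1
        have "A2 / \<rho> \<le> A / \<rho>" using A_ge \<rho> by (simp add: divide_right_mono)
        then show ?thesis using main[OF \<rho> 1 lat] mono by (meson order_trans)
      next
        case 2
        have "A2 / 2 = A2 * m / (2 * m)" using m1 by simp
        also have "\<dots> \<le> A / \<rho>" using A_ge 2 A2 m1 by (intro frac_le) auto
        finally have "exp (- (A / \<rho>) * B) \<le> exp (- (A2 / 2) * B)" by (rule mono)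
        also have "\<dots> \<le> P 2" using n by (intro main) auto
        also have "P 2 \<le> P \<rho>" unfolding P_def
        proof (rule finite_measure_mono[OF _ small_component_event], intro subsetI CollectI, elim CollectE conjE, intro conjI)
          fix \<omega> assume "real (largest_component_size (E \<omega>) {i. X i \<omega> \<in> volume_box n}) < 2 * n"
          also have "\<dots> \<le> \<rho> * n" using 2 n by (intro mult_right_mono) auto
          finally show "real (largest_component_size (E \<omega>) {i. X i \<omega> \<in> volume_box n}) < \<rho> * n" .
        qed
        finally show ?thesis .
      next
        case 3
        \<comment> \<open>Markov's inequality gives a cost of order \<open>1 / \<rho>\<close>
          without \<open>B\<close>, so \<open>B\<close> is needed from below. The power of 2 pays
          for \<open>ln n\<close>, which is only known to be at least 1/2.\<close>
        have "1 \<le> 2 ^ \<mu> * B"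
        proof (cases "\<mu> = 0")
          case True
          then show ?thesis using n \<zeta>0 by (simp add: B_def ge_one_powr_ge_zero)
        next
          case False
          then have "1 / 2 \<le> ln n" using n2 ln_2_ge_half ln_le_cancel_iff[of 2 n] by linarith
          then have "1 ^ \<mu> \<le> (2 * ln n) ^ \<mu>" by (intro power_mono) auto
          then have "1 * 1 \<le> n powr \<zeta> * (2 * ln n) ^ \<mu>"
            using n \<zeta>0 by (intro mult_mono) (auto simp: ge_one_powr_ge_zero)
          then show ?thesis by (simp add: B_def power_mult_distrib mult_ac)
        qed
        then have "2 * m * 1 \<le> 2 * m * (2 ^ \<mu> * B)" using m1 by (intro mult_left_mono) auto
        also have "\<dots> \<le> A * B" using mult_right_mono[OF A_ge(3) B0] by (simp add: mult_ac)
        finally have "m / \<rho> / (1 - 1 / 2) \<le> A / \<rho> * B" using \<rho> by (simp add: field_simps)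
        then have "exp (- (A / \<rho>) * B) \<le> exp (- (m / \<rho> / (1 - 1 / 2)))" by simp
        also have "\<dots> \<le> 1 - m / \<rho>" using 3 m1 \<rho> by (intro one_minus_ge_exp) (auto simp: field_simps)
        also have "\<dots> \<le> P \<rho>" unfolding P_def m_def by (rule few_vertices_bound[OF n \<rho>])
        finally show ?thesis .
      qed
    qed
    then show "exp (- (A / \<rho>) * n powr real_of_ereal (zeta_star CARD('d) \<alpha> \<tau> (kernel_param K))
              * ln n ^ (mult_star CARD('d) \<alpha> \<tau> (kernel_param K) - 1))
      \<le> prob (small_components n (\<rho> * n))"
      by (simp add: B_def P_def \<zeta>_def \<mu>_def s_def mult.assoc)
  qed
qed

end
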